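(* For $(m,n)\neq(0,0)$, the following vectors form a basis of $W^{M,N}_{m,n}$: \begin{equation*} \bar e_{i_1}\cdots \bar e_{i_m} \bar f_{j_1}\cdots \bar f_{j_n}\bar v \end{equation*} with $i_k\geq i_{k+1}+2$, $j_k\geq j_{k+1}+2$, $M>i_k\geq 1-n$ and $N+m> j_k >0$. The space $W^{M,N}$ is finite dimensional and its character is \begin{eqnarray*} \mathrm{ch}_{q,z_1,z_2}W^{M,N}&=& \sum_{m,n\geq 0}q^{n^2+m^2-mn}\Bigl[{M-m+n\atop m}\Bigr]\Bigl[{N-n+m\atop n}\Bigr]z_1^mz_2^n. \end{eqnarray*}
   Context: Let $\mathcal{H}$ be the Lie algebra with basis $\{\bar e_i,\bar h_i,\bar f_i\}_{i\in\mathbb{Z}}$ and brackets $[\bar e_i,\bar f_j]=\bar h_{i+j}$, all other brackets zero (currents with values in the 3-dimensional Heisenberg algebra; it is the associated graded of $\widehat{\mathfrak{sl}}_2$ for the filtration with $e_i,f_i$ in degree 1 and $h_i$ in degree 2). Let $M$ be the $\mathcal{H}$-module induced from the trivial one-dimensional representation $\mathbb{C}\bar v$ of the subalgebra spanned by $\bar e_i,\bar h_i,\bar f_i$ with $i\le 0$, and let $W$ be the quotient of $M$ by the subspace generated by the coefficients of $\bar e(z)^2m,\ \bar f(z)^2m,\ \bar e(z)\bar h(z)m,\ \bar f(z)\bar h(z)m,\ \bar h(z)^2m$ $(m\in M)$, where $\bar e(z)=\sum_i\bar e_iz^i$ etc. $W$ is $\mathbb{Z}^3$-graded by $\deg_{z_1}(\bar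 e_i,\bar h_i,\bar f_i)=(1,1,0)$, $\deg_{z_2}(\bar e_i,\bar h_i,\bar f_i)=(0,1,1)$, $\deg_q(\bar e_i,\bar h_i,\bar f_i)=(i,i,i)$, with grading operators $H_1,H_2,d$; the character is $\mathrm{ch}_{q,z_1,z_2}=\mathrm{trace}\,q^dz_1^{H_1}z_2^{H_2}$, and the subscript $m,n$ denotes the component of $(H_1,H_2)$-degree $(m,n)$. For $M,N\ge -1$, $(M,N)\neq(-1,-1)$, let $\mathfrak{g}(M,N)$ be the subalgebra generated by $\{\bar e_i\}_{i\ge M}\cup\{\bar f_j\}_{j\ge N}$ and $\overline{W}^{M,N}=W/\mathfrak{g}(M,N)W$; set $W^{M,N}=\overline{W}^{M,N}$ if $M,N\ge 0$, and $W^{M,N}=\overline{W}^{M,N}/\mathbb{C}\bar v$ if $M=-1$ or $N=-1$. Here $\Bigl[{m\atop n}\Bigr]$ is the $q$-binomial coefficient. *)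

theory Defs
  imports "HOL-Computational_Algebra.Polynomial"
begin

datatype gen = E int | Hh int | F int

fun mode :: "gen \<Rightarrow> int" where
  "mode (E i) = i" | "mode (Hh i) = i" | "mode (F i) = i"

text \<open>Elements of the Lie algebra: coefficient functions (finitely supported ones are the
  actual elements).\<close>
type_synonym hvec = "gen \<Rightarrow> complex"

definition fin_supp :: "('a \<Rightarrow> complex) \<Rightarrow> bool" where
  "fin_supp f \<longleftrightarrow> finite {x. f x \<noteq> 0}"

definition gvec :: "gen \<Rightarrow> hvec" where
  "gvec x = (\<lambda>y. if y = x then 1 else 0)"

text \<open>Bilinear extension of [e_i, f_j] = h_{i+j}, all other brackets of basis vectors zero.\<close>
definition hbr :: "hvec \<Rightarrow> hvec \<Rightarrow> hvec" where
  "hbr a b = (\<lambda>x. case x of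
      Hh k \<Rightarrow> (\<Sum>i\<in>{i. a (E i) \<noteq> 0 \<or> a (F i) \<noteq> 0}.
                   a (E i) * b (F (k - i)) - a (F i) * b (E (k - i)))
    | _ \<Rightarrow> 0)"

section \<open>The tensor (free associative) algebra on the basis, as coefficient functions on words\<close>

type_synonym word = "gen list"
type_synonym vec = "word \<Rightarrow> complex"

definition vdiff :: "vec \<Rightarrow> vec \<Rightarrow> vec" where
  "vdiff a b = (\<lambda>w. a w - b w)"

definition vsum :: "('i \<Rightarrow> complex) \<Rightarrow> ('i \<Rightarrow> vec) \<Rightarrow> 'i set \<Rightarrow> vec" where
  "vsum c v S = (\<lambda>w. \<Sum>s\<in>S. c s * v s w)"

definition wvec :: "word \<Rightarrow> vec" where
  "wvec u = (\<lambda>w. if w = u then 1 else 0)"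

definition lspan :: "vec set \<Rightarrow> vec set" where
  "lspan S = {v. \<exists>G c. finite G \<and> G \<subseteq> S \<and> v = vsum c id G}"

text \<open>Product of the tensor algebra (concatenation of words, extended bilinearly).\<close>
definition vmul :: "vec \<Rightarrow> vec \<Rightarrow> vec" where
  "vmul a b = (\<lambda>w. \<Sum>k\<le>length w. a (take k w) * b (drop k w))"

definition emb :: "hvec \<Rightarrow> vec" where
  "emb a = (\<lambda>w. case w of [x] \<Rightarrow> a x | _ \<Rightarrow> 0)"

definition Tall :: "vec set" where
  "Tall = lspan (range wvec)"

section \<open>The induced module M = U(H) / U(H) H_{\<le>0} as a quotient of the tensor algebra\<close>

definition comm_rel :: "vec set" where
  "comm_rel = {vdiff (vdiff (wvec [x, y]) (wvec [y, x])) (emb (hbr (gvec x) (gvec y))) | x y. True}"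

text \<open>Two-sided ideal defining U(H).\<close>
definition Iideal :: "vec set" where
  "Iideal = lspan {vmul (wvec u) (vmul r (wvec w)) | u r w. r \<in> comm_rel}"

text \<open>Left ideal generated by the subalgebra spanned by modes i \<le> 0 (acting trivially on v).\<close>
definition Lideal :: "vec set" where
  "Lideal = lspan {wvec (u @ [x]) | u x. mode x \<le> 0}"

text \<open>M = Tall / K0, the class of the empty word being bar v.\<close>
definition K0 :: "vec set" where
  "K0 = lspan (Iideal \<union> Lideal)"

definition rel_pairs :: "((int \<Rightarrow> gen) \<times> (int \<Rightarrow> gen)) set" where
  "rel_pairs = {(E, E), (F, F), (E, Hh), (F, Hh), (Hh, Hh)}"

text \<open>Representatives of the coefficient of z^k of X(z)Y(z)m in M, for m the class of a
  finitely supported f. The coefficient is the (formal) sum over i of X_i Y_{k-i} m, which is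
  a sum of finitely many nonzero terms in M; it is expressed via a finite set S outside of which
  all terms vanish in M.\<close>
definition coeff_rel :: "vec set" where
  "coeff_rel = {x. \<exists>X Y f k. (X, Y) \<in> rel_pairs \<and> fin_supp f \<and>
      (\<exists>S. finite S \<and> (\<forall>i. i \<notin> S \<longrightarrow> vmul (wvec [X i, Y (k - i)]) f \<in> K0) \<and>
           vdiff x (vsum (\<lambda>_. 1) (\<lambda>i. vmul (wvec [X i, Y (k - i)]) f) S) \<in> K0)}"

text \<open>W = Tall / KW (the submodule generated by the coefficients).\<close>
definition KW :: "vec set" where
  "KW = lspan (K0 \<union> {vmul (wvec u) x | u x. x \<in> coeff_rel})"

definition gsub :: "int \<Rightarrow> int \<Rightarrow> hvec set" where
  "gsub M N = \<Inter> {S. S \<subseteq> {a. fin_supp a} \<and> (\<lambda>x. 0) \<in> S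
       \<and> (\<forall>a\<in>S. \<forall>b\<in>S. (\<lambda>x. a x + b x) \<in> S)
       \<and> (\<forall>c. \<forall>a\<in>S. (\<lambda>x. c * a x) \<in> S)
       \<and> (\<forall>a\<in>S. \<forall>b\<in>S. hbr a b \<in> S)
       \<and> {gvec (E i) | i. i \<ge> M} \<subseteq> S \<and> {gvec (F j) | j. j \<ge> N} \<subseteq> S}"

text \<open>W^{M,N} = Tall / Kfull M N: quotient of W by g(M,N)W, and also by C bar v
  when M = -1 or N = -1.\<close>
definition Kfull :: "int \<Rightarrow> int \<Rightarrow> vec set" where
  "Kfull M N = lspan (KW \<union> {vmul (emb a) (wvec u) | a u. a \<in> gsub M N}
                      \<union> (if M = -1 \<or> N = -1 then {wvec []} else {}))"

fun h1deg :: "gen \<Rightarrow> nat" where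
  "h1deg (E _) = 1" | "h1deg (Hh _) = 1" | "h1deg (F _) = 0"

fun h2deg :: "gen \<Rightarrow> nat" where
  "h2deg (E _) = 0" | "h2deg (Hh _) = 1" | "h2deg (F _) = 1"

definition wH1 :: "word \<Rightarrow> nat" where "wH1 w = sum_list (map h1deg w)"
definition wH2 :: "word \<Rightarrow> nat" where "wH2 w = sum_list (map h2deg w)"
definition wdeg :: "word \<Rightarrow> int" where "wdeg w = sum_list (map mode w)"

text \<open>Preimages in Tall of the (H1,H2)-component and of the (H1,H2,d)-component.\<close>
definition comp :: "nat \<Rightarrow> nat \<Rightarrow> vec set" where
  "comp m n = lspan {wvec w | w. wH1 w = m \<and> wH2 w = n}"

definition comp3 :: "nat \<Rightarrow> nat \<Rightarrow> int \<Rightarrow> vec set" where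
  "comp3 m n d = lspan {wvec w | w. wH1 w = m \<and> wH2 w = n \<and> wdeg w = d}"

definition indep_mod :: "vec set \<Rightarrow> 'i set \<Rightarrow> ('i \<Rightarrow> vec) \<Rightarrow> bool" where
  "indep_mod K X v \<longleftrightarrow>
     (\<forall>G c. finite G \<and> G \<subseteq> X \<and> vsum c v G \<in> K \<longrightarrow> (\<forall>i\<in>G. c i = 0))"

definition spans_mod :: "vec set \<Rightarrow> vec set \<Rightarrow> 'i set \<Rightarrow> ('i \<Rightarrow> vec) \<Rightarrow> bool" where
  "spans_mod K A X v \<longleftrightarrow> (\<forall>a\<in>A. \<exists>G c. finite G \<and> G \<subseteq> X \<and> vdiff a (vsum c v G) \<in> K)"

text \<open>The images of the family v indexed by X form a basis of A/(A \<inter> K).\<close>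
definition basis_mod :: "vec set \<Rightarrow> vec set \<Rightarrow> 'i set \<Rightarrow> ('i \<Rightarrow> vec) \<Rightarrow> bool" where
  "basis_mod K A X v \<longleftrightarrow> v ` X \<subseteq> A \<and> indep_mod K X v \<and> spans_mod K A X v"

definition qdim :: "vec set \<Rightarrow> vec set \<Rightarrow> nat" where
  "qdim K A = Sup {card G | G. finite G \<and> G \<subseteq> A \<and> indep_mod K G id}"

definition fin_dim_mod :: "vec set \<Rightarrow> vec set \<Rightarrow> bool" where
  "fin_dim_mod K A \<longleftrightarrow> (\<exists>G. finite G \<and> G \<subseteq> A \<and> spans_mod K A G id)"

definition gap2 :: "int list \<Rightarrow> bool" where
  "gap2 xs \<longleftrightarrow> (\<forall>k. Suc k < length xs \<longrightarrow> xs ! k \<ge> xs ! Suc k + 2)"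

definition basis_idx :: "int \<Rightarrow> int \<Rightarrow> nat \<Rightarrow> nat \<Rightarrow> (int list \<times> int list) set" where
  "basis_idx M N m n = {(is, js). length is = m \<and> length js = n \<and> gap2 is \<and> gap2 js
      \<and> (\<forall>i\<in>set is. 1 - int n \<le> i \<and> i < M) \<and> (\<forall>j\<in>set js. 0 < j \<and> j < N + int m)}"

definition basis_vec :: "int list \<times> int list \<Rightarrow> vec" where
  "basis_vec p = wvec (map E (fst p) @ map F (snd p))"

fun qbin_nat :: "nat \<Rightarrow> nat \<Rightarrow> int poly" where
  "qbin_nat n 0 = 1"
| "qbin_nat 0 (Suc k) = 0"
| "qbin_nat (Suc n) (Suc k) = qbin_nat n k + monom 1 (Suc k) * qbin_nat n (Suc k)"

definition qbinom :: "int \<Rightarrow> int \<Rightarrow> int poly" where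
  "qbinom a b = (if a < 0 \<or> b < 0 then 0 else qbin_nat (nat a) (nat b))"

end

theory Submission
  imports Defs "HOL-Library.Function_Algebras" "HOL-Library.List_Lexorder" "HOL-Library.Multiset"
begin

text \<open>The monomials span because \<open>h\<close> can be eliminated and because, inside
  \<open>\<Prod>k. (z - w\<^sub>k)\<close>, the currents \<open>e(z)\<close> and \<open>f(w\<^sub>k)\<close> commute: an index \<open>i \<le> -n\<close> of \<open>e\<close> or
  \<open>j \<ge> N + m\<close> of \<open>f\<close> is traded for terms with smaller total \<open>f\<close>-degree. They are independent
  because \<open>W\<close> acts on fermions: with anticommuting fields \<open>\<psi>\<close>, \<open>\<phi>\<close>, \<open>\<phi>\<^sup>*\<close>, \<open>\<chi>\<close> put
  \<open>e(z) = \<psi>(z) \<phi>\<^sup>*(z)\<close>, \<open>f(z) = \<chi>(z) \<phi>(z)\<close>, \<open>h(z) = - \<psi>(z) \<chi>(z)\<close>, where only \<open>\<phi>\<close> and \<open>\<phi>\<^sup>*\<close>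
  pair nontrivially; the quadratic relations hold since each product contains the square of a fermion.
  In degree \<open>(m, n)\<close>, the coefficient of a product of \<open>m\<close> modes \<open>\<psi>\<^sub>a\<close>, \<open>1 \<le> a \<le> M + n - m\<close>, and
  \<open>n\<close> modes \<open>\<chi>\<^sub>c\<close>, \<open>1 \<le> c \<le> N + m - n\<close>, over the \<open>\<phi>\<close>-vacuum of charge \<open>m - n\<close> vanishes on
  \<open>g(M, N) W\<close>, and these coefficients are lexicographically unitriangular on the monomials.\<close>

text \<open>In each bidegree, rewriting gives an upper bound, matrix coefficients give a lower
  bound, and both are indexed by the same lists. The truncations are read off from the target state.
  Its sea is filled below \<open>p = m - n\<close>, so an \<open>e_i\<close> contributing to the
  coefficient uses a mode \<open>i - a < p\<close> of \<phi>. With \<open>a <= A\<close> this means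
  \<open>i < A + p\<close>, and \<open>A = M - p\<close> makes it \<open>i < M\<close>. Likewise
  \<open>C = N + p\<close> gives \<open>j < N\<close> for \<open>f_j\<close>, and \<open>h_k\<close>
  needs \<open>k < A + C = M + N\<close>, the bound that the brackets impose on
  \<open>g(M, N)\<close>. The map \<open>i_k - p + k\<close> turns gaps of at least two into strict
  decrease and the range \<open>[1 - n, M)\<close> into \<open>{1..A}\<close>, so there are as many
  coefficients as monomials. The obstacle is that relations between currents are infinite sums.
  States are therefore arbitrary coefficient functions on sets of labels, and the quadratic
  relations are checked one coefficient at a time, where only finitely many terms survive.\<close>

section \<open>Linear algebra of coefficient functions\<close>

(* Pointwise evaluation of sums would take vectors apart before the linear-algebra rules apply. *)
declare plus_fun_apply [simp del] zero_fun_apply [simp del] minus_apply [simp del] uminus_apply [simp del]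

lemmas fun_ops = plus_fun_apply zero_fun_apply minus_apply uminus_apply

definition fscale :: "complex \<Rightarrow> ('a \<Rightarrow> complex) \<Rightarrow> 'a \<Rightarrow> complex" where
  "fscale c v = (\<lambda>x. c * v x)"

interpretation vs: vector_space fscale
  by unfold_locales (auto simp: fun_ops fscale_def fun_eq_iff algebra_simps)

lemma sum_fun_apply: "(\<Sum>i\<in>A. f i) x = (\<Sum>i\<in>A. f i x)"
  for f :: "'i \<Rightarrow> 'a \<Rightarrow> 'b::comm_monoid_add"
  by (induction A rule: infinite_finite_induct) (auto simp: fun_ops)

lemma vsum_eq: "vsum c v S = (\<Sum>s\<in>S. fscale (c s) (v s))"
  by (rule ext) (simp add: vsum_def sum_fun_apply fscale_def)

lemma vdiff_eq: "vdiff a b = a - b"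
  by (rule ext) (simp add: vdiff_def fun_ops)

lemma lspan_eq: "lspan S = vs.span S"
  unfolding lspan_def vs.span_explicit vsum_eq by auto

lemma span_imageI:
  assumes "x \<in> vs.span G" "\<And>g. g \<in> G \<Longrightarrow> T g \<in> vs.span H"
    "\<And>a b. T (a + b) = T a + T b" "\<And>c a. T (fscale c a) = fscale c (T a)"
  shows "T x \<in> vs.span H"
proof -
  have T0: "T 0 = 0" using assms(4)[of 0 0] by simp
  show ?thesis
    using assms(1)
  proof (induction rule: vs.span_induct_alt)
    case base
    show ?case by (simp add: T0 vs.span_zero)
  next
    case (step c g y)
    show ?case
      unfolding assms(3,4) by (intro vs.span_add vs.span_scale assms(2) step)
  qed
qed

lemma in_span_of_diff:
  assumes "a - b \<in> K" "K \<subseteq> vs.span H" "b \<in> vs.span H"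
  shows "a \<in> vs.span H"
proof -
  have "(a - b) + b \<in> vs.span H" by (rule vs.span_add) (use assms in auto)
  thus ?thesis by simp
qed

lemma span_bind:
  assumes "x \<in> vs.span G" "G \<subseteq> vs.span H"
  shows "x \<in> vs.span H"
  using assms vs.span_minimal vs.subspace_span by blast

section \<open>The tensor algebra and its ideals\<close>

lemma vmul_wvec: "vmul (wvec u) f = (\<lambda>w. if take (length u) w = u then f (drop (length u) w) else 0)"
proof
  fix w
  have "vmul (wvec u) f w = (\<Sum>k\<le>length w. if k = length u then
      (if take (length u) w = u then f (drop (length u) w) else 0) else 0)"
    unfolding vmul_def wvec_def by (intro sum.cong) auto
  also have "\<dots> = (if take (length u) w = u then f (drop (length u) w) else 0)"
    by (auto simp: sum.delta)
  finally show "vmul (wvec u) f w = (if take (length u) w = u then f (drop (length u) w) else 0)" .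
qed

lemma vmul_wvec_wvec [simp]: "vmul (wvec u) (wvec w) = wvec (u @ w)"
  unfolding vmul_wvec unfolding wvec_def
proof (rule ext)
  fix x
  show "(if take (length u) x = u then if drop (length u) x = w then 1 else 0 else (0::complex)) =
      (if x = u @ w then 1 else 0)"
    using append_take_drop_id[of "length u" x] by (cases "take (length u) x = u") auto
qed

lemma vmul_add_right: "vmul a (b + c) = vmul a b + vmul a c"
  by (rule ext) (simp add: vmul_def fun_ops sum.distrib algebra_simps)
lemma vmul_scale_right: "vmul a (fscale c b) = fscale c (vmul a b)"
  by (rule ext) (simp add: vmul_def fun_ops fscale_def sum_distrib_left algebra_simps)
lemma vmul_diff_right: "vmul a (b - c) = vmul a b - vmul a c"
  by (rule ext) (simp add: vmul_def fun_ops sum_subtractf algebra_simps)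
lemma vmul_diff_left: "vmul (a - b) c = vmul a c - vmul b c"
  by (rule ext) (simp add: vmul_def fun_ops sum_subtractf algebra_simps)
lemma vmul_uminus_left: "vmul (- a) c = - vmul a c"
  by (rule ext) (simp add: vmul_def fun_ops sum_negf)
lemma vmul_uminus_right: "vmul a (- c) = - vmul a c"
  by (rule ext) (simp add: vmul_def fun_ops sum_negf)
lemma vmul_zero [simp]: "vmul 0 c = 0" "vmul c 0 = 0"
  by (rule ext, simp add: vmul_def fun_ops)+
lemma vmul_sum_right: "vmul a (\<Sum>i\<in>S. f i) = (\<Sum>i\<in>S. vmul a (f i))"
  by (induction S rule: infinite_finite_induct) (auto simp: vmul_add_right)

text \<open>The element \<open>u [x, y] w\<close> of the tensor algebra; with it the generators of
  \<open>Iideal\<close> are explicit combinations of at most three words.\<close>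

fun bracket_word :: "word \<Rightarrow> gen \<Rightarrow> gen \<Rightarrow> word \<Rightarrow> vec" where
  "bracket_word u (E i) (F j) w = wvec (u @ Hh (i + j) # w)"
| "bracket_word u (F j) (E i) w = - wvec (u @ Hh (i + j) # w)"
| "bracket_word u x y w = 0"

lemma hbr_gvec: "hbr (gvec x) (gvec y) z = (case (x, y) of (E i, F j) \<Rightarrow> gvec (Hh (i + j)) z
    | (F j, E i) \<Rightarrow> - gvec (Hh (i + j)) z | _ \<Rightarrow> 0)"
proof -
  have *: "{i. P = i} = {P}" "{i. i = P} = {P}" for P :: int by auto
  show ?thesis
    by (cases x; cases y; cases z) (auto simp: hbr_def gvec_def *)
qed

lemma emb_hbr: "emb (hbr (gvec x) (gvec y)) = bracket_word [] x y []"
proof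
  fix w :: word
  show "emb (hbr (gvec x) (gvec y)) w = bracket_word [] x y [] w"
  proof (cases "\<exists>z. w = [z]")
    case True
    then obtain z where "w = [z]" by auto
    thus ?thesis
      by (cases x; cases y) (simp_all add: emb_def hbr_gvec wvec_def fun_ops, simp_all add: gvec_def)
  next
    case False
    hence "emb a w = 0" for a by (auto simp: emb_def split: list.splits)
    thus ?thesis using False by (cases x; cases y) (auto simp: wvec_def fun_ops)
  qed
qed

lemma comm_gen:
  "vmul (wvec u) (vmul (vdiff (vdiff (wvec [x, y]) (wvec [y, x])) (emb (hbr (gvec x) (gvec y)))) (wvec w))
   = wvec (u @ x # y # w) - wvec (u @ y # x # w) - bracket_word u x y w"
proof -
  have "vmul (wvec u) (vmul (bracket_word [] x y []) (wvec w)) = bracket_word u x y w"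
    by (cases x; cases y) (auto simp: vmul_uminus_left vmul_uminus_right)
  thus ?thesis
    by (simp add: vdiff_eq emb_hbr vmul_diff_left vmul_diff_right)
qed

lemma Iideal_eq:
  "Iideal = vs.span {wvec (u @ x # y # w) - wvec (u @ y # x # w) - bracket_word u x y w | u x y w. True}"
  unfolding Iideal_def lspan_eq comm_rel_def
proof (rule arg_cong[where f = vs.span], intro equalityI subsetI)
  fix v
  assume "v \<in> {vmul (wvec u) (vmul r (wvec w)) |u r w. r \<in> {vdiff (vdiff (wvec [x, y]) (wvec [y, x])) (emb (hbr (gvec x) (gvec y))) |x y. True}}"
  then obtain u w x y where "v = vmul (wvec u) (vmul (vdiff (vdiff (wvec [x, y]) (wvec [y, x])) (emb (hbr (gvec x) (gvec y)))) (wvec w))"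
    by blast
  thus "v \<in> {wvec (u @ x # y # w) - wvec (u @ y # x # w) - bracket_word u x y w |u x y w. True}"
    unfolding comm_gen by blast
next
  fix v assume "v \<in> {wvec (u @ x # y # w) - wvec (u @ y # x # w) - bracket_word u x y w |u x y w. True}"
  then obtain u w x y where "v = wvec (u @ x # y # w) - wvec (u @ y # x # w) - bracket_word u x y w" by blast
  thus "v \<in> {vmul (wvec u) (vmul r (wvec w)) |u r w. r \<in> {vdiff (vdiff (wvec [x, y]) (wvec [y, x])) (emb (hbr (gvec x) (gvec y))) |x y. True}}"
    unfolding comm_gen[symmetric] by blast
qed

lemma swap_K0: "wvec (u @ x # y # w) - wvec (u @ y # x # w) - bracket_word u x y w \<in> K0"
  unfolding K0_def lspan_eq Iideal_eq by (intro vs.span_base UnI1) blast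

lemma nonpos_K0: "mode x \<le> 0 \<Longrightarrow> wvec (u @ [x]) \<in> K0"
  unfolding K0_def lspan_eq Lideal_def by (intro vs.span_base UnI2) blast

lemma bracket_word_mult: "vmul (wvec v) (bracket_word u x y w) = bracket_word (v @ u) x y w"
  by (cases x; cases y) (auto simp: vmul_uminus_right)

lemma K0_subspace: "vs.subspace K0" unfolding K0_def lspan_eq by simp
lemma KW_subspace: "vs.subspace KW" unfolding KW_def lspan_eq by simp
lemma Kfull_subspace: "vs.subspace (Kfull M N)" unfolding Kfull_def lspan_eq by simp

lemma K0_sub_KW: "K0 \<subseteq> KW" unfolding KW_def lspan_eq by (rule order_trans[OF _ vs.span_superset]) auto
lemma KW_sub_Kfull: "KW \<subseteq> Kfull M N" unfolding Kfull_def lspan_eq by (rule order_trans[OF _ vs.span_superset]) auto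
lemma K0_sub_Kfull: "K0 \<subseteq> Kfull M N" using K0_sub_KW KW_sub_Kfull by blast

lemma K0_mult:
  assumes "x \<in> K0" shows "vmul (wvec u) x \<in> K0"
proof -
  have gI: "vmul (wvec u) g \<in> Iideal" if "g \<in> Iideal" for g
    using that unfolding Iideal_eq
  proof (rule span_imageI[where T = "vmul (wvec u)"])
    fix g assume "g \<in> {wvec (u @ x # y # w) - wvec (u @ y # x # w) - bracket_word u x y w |u x y w. True}"
    then obtain u' x y w where g: "g = wvec (u' @ x # y # w) - wvec (u' @ y # x # w) - bracket_word u' x y w" by auto
    have "vmul (wvec u) g = wvec ((u @ u') @ x # y # w) - wvec ((u @ u') @ y # x # w) - bracket_word (u @ u') x y w"
      by (simp add: g vmul_diff_right bracket_word_mult)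
    thus "vmul (wvec u) g \<in> vs.span {wvec (u @ x # y # w) - wvec (u @ y # x # w) - bracket_word u x y w |u x y w. True}"
      by (intro vs.span_base) blast
  qed (simp_all add: vmul_add_right vmul_scale_right)
  have gL: "vmul (wvec u) g \<in> Lideal" if "g \<in> Lideal" for g
    using that unfolding Lideal_def lspan_eq
  proof (rule span_imageI[where T = "vmul (wvec u)"])
    fix g assume "g \<in> {wvec (u @ [x]) |u x. mode x \<le> 0}"
    then obtain v x where "g = wvec (v @ [x])" "mode x \<le> 0" by auto
    hence "vmul (wvec u) g = wvec ((u @ v) @ [x])" "mode x \<le> 0" by auto
    thus "vmul (wvec u) g \<in> vs.span {wvec (u @ [x]) |u x. mode x \<le> 0}"
      by (intro vs.span_base) blast
  qed (simp_all add: vmul_add_right vmul_scale_right)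
  show ?thesis
    using assms unfolding K0_def lspan_eq
    by (rule span_imageI[where T = "vmul (wvec u)"])
       (auto simp: vmul_add_right vmul_scale_right intro: vs.span_base gI gL)
qed

lemma word_mult_K0: "wvec w \<in> K0 \<Longrightarrow> wvec (u @ w) \<in> K0"
  using K0_mult[of "wvec w" u] by simp

text \<open>Moving \<open>x\<close> past the first letter \<open>y\<close> leaves at most one
  bracket, an \<open>Hh\<close> of mode \<open>mode x + mode y\<close>. Lowering the bound by
  \<open>|mode y|\<close> keeps both terms below the old bound. This local vanishing is what makes
  coefficients of products of currents finite sums on \<open>M\<close>.\<close>

lemma low_mode_K0: "\<exists>L. \<forall>x. mode x \<le> L \<longrightarrow> wvec (x # w) \<in> K0"
proof (induction w)
  case Nil
  show ?case by (rule exI[of _ 0]) (use nonpos_K0[of _ "[]"] in auto)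
next
  case (Cons y w)
  then obtain L where L: "\<And>x. mode x \<le> L \<Longrightarrow> wvec (x # w) \<in> K0" by auto
  show ?case
  proof (rule exI[of _ "L - \<bar>mode y\<bar>"], intro allI impI)
    fix x assume x: "mode x \<le> L - \<bar>mode y\<bar>"
    have 1: "wvec (y # x # w) \<in> K0" using L[of x] x word_mult_K0[of _ "[y]"] by auto
    have "wvec (Hh (mode x + mode y) # w) \<in> K0" using L x by auto
    hence 2: "bracket_word [] x y w \<in> K0"
      by (cases x; cases y) (auto simp: add.commute intro: vs.subspace_neg[OF K0_subspace] vs.subspace_0[OF K0_subspace])
    have "wvec (x # y # w) = (wvec (x # y # w) - wvec (y # x # w) - bracket_word [] x y w) + wvec (y # x # w) + bracket_word [] x y w"
      by simp
    thus "wvec (x # y # w) \<in> K0"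
      using vs.subspace_add[OF K0_subspace] swap_K0[of "[]" x y w] 1 2 by (metis append_Nil)
  qed
qed

lemma rel_pairs_comm: "(X, Y) \<in> rel_pairs \<Longrightarrow> bracket_word u (X i) (Y j) w = 0"
  by (auto simp: rel_pairs_def)

lemma rel_pairs_mode: "(X, Y) \<in> rel_pairs \<Longrightarrow> mode (X i) = i \<and> mode (Y i) = i"
  by (auto simp: rel_pairs_def)

lemma coeff_rel_word:
  assumes "(X, Y) \<in> rel_pairs"
  shows "\<exists>S. finite S \<and> (\<forall>i. i \<notin> S \<longrightarrow> wvec (u @ X i # Y (k - i) # w) \<in> K0) \<and>
    (\<Sum>i\<in>S. wvec (u @ X i # Y (k - i) # w)) \<in> KW"
proof -
  obtain L where L: "\<And>x. mode x \<le> L \<Longrightarrow> wvec (x # w) \<in> K0" using low_mode_K0 by blast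
  \<comment> \<open>Outside this window one of the two modes is at most \<open>L\<close>. The right
    factor then kills \<open>w\<close> directly; the left one does so after an exchange, since the
    two factors commute.\<close>
  define S where "S = {L..k - L}"
  have out: "wvec (X i # Y (k - i) # w) \<in> K0" if "i \<notin> S" for i
  proof (cases "i \<le> L")
    case True
    hence "wvec (Y (k - i) # X i # w) \<in> K0"
      using L[of "X i"] rel_pairs_mode[OF assms] word_mult_K0[of _ "[Y (k - i)]"] by simp
    moreover have "wvec (X i # Y (k - i) # w) - wvec (Y (k - i) # X i # w) \<in> K0"
      using swap_K0[of "[]" "X i" "Y (k - i)" w] rel_pairs_comm[OF assms] by simp
    ultimately show ?thesis using vs.subspace_add[OF K0_subspace] by fastforce
  next
    case False
    hence "k - i \<le> L" using that by (auto simp: S_def)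
    thus ?thesis
      using L[of "Y (k - i)"] rel_pairs_mode[OF assms] word_mult_K0[of _ "[X i]"] by simp
  qed
  have "(\<Sum>i\<in>S. wvec (X i # Y (k - i) # w)) \<in> coeff_rel"
    unfolding coeff_rel_def mem_Collect_eq
  proof (intro exI conjI)
    show "(X, Y) \<in> rel_pairs" by fact
    show "fin_supp (wvec w)" by (simp add: fin_supp_def wvec_def)
    show "finite S" by (simp add: S_def)
    show "\<forall>i. i \<notin> S \<longrightarrow> vmul (wvec [X i, Y (k - i)]) (wvec w) \<in> K0" using out by simp
    show "vdiff (\<Sum>i\<in>S. wvec (X i # Y (k - i) # w)) (vsum (\<lambda>_. 1) (\<lambda>i. vmul (wvec [X i, Y (k - i)]) (wvec w)) S) \<in> K0"
      by (simp add: vdiff_eq vsum_eq fscale_def vs.subspace_0[OF K0_subspace])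
  qed
  hence "vmul (wvec u) (\<Sum>i\<in>S. wvec (X i # Y (k - i) # w)) \<in> KW"
    unfolding KW_def lspan_eq by (intro vs.span_base) auto
  moreover have "wvec (u @ X i # Y (k - i) # w) \<in> K0" if "i \<notin> S" for i
    using out[OF that] by (rule word_mult_K0)
  moreover have "finite S" by (simp add: S_def)
  ultimately show ?thesis by (intro exI[of _ S]) (simp add: vmul_sum_right)
qed

lemma span_Un_left: "vs.subspace K \<Longrightarrow> x \<in> K \<Longrightarrow> x \<in> vs.span (K \<union> B)"
  by (auto intro: vs.span_base)

text \<open>Among pairs with sum \<open>a + b\<close>, those at distance at most one minimise the
  sum of squares, so every other term of the relation has a larger one. If \<open>a\<close> and
  \<open>b\<close> differ, both orders occur and agree modulo \<open>K0\<close>, which explains the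
  factor \<open>1/2\<close>.\<close>

lemma spread:
  assumes X: "(X, X) \<in> rel_pairs" and ab: "\<bar>a - b\<bar> \<le> 1"
  shows "wvec (u @ X a # X b # w) \<in>
    vs.span (KW \<union> {wvec (u @ X i # X (a + b - i) # w) | i. i\<^sup>2 + (a + b - i)\<^sup>2 > a\<^sup>2 + b\<^sup>2})"
    (is "_ \<in> vs.span (KW \<union> ?B)")
proof -
  define t where "t i = wvec (u @ X i # X (a + b - i) # w)" for i
  obtain S where S: "finite S" "\<And>i. i \<notin> S \<Longrightarrow> t i \<in> K0" "(\<Sum>i\<in>S. t i) \<in> KW"
    unfolding t_def using coeff_rel_word[OF X, of u "a + b" w] by blast
  define S' where "S' = S \<union> {a, b}"
  have S': "finite S'" using S by (simp add: S'_def)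
  have "(\<Sum>i\<in>S'. t i) = (\<Sum>i\<in>S. t i) + (\<Sum>i\<in>S' - S. t i)"
    using S' by (metis S'_def Un_upper1 add.commute sum.subset_diff)
  moreover have "(\<Sum>i\<in>S' - S. t i) \<in> KW"
    using S(2) K0_sub_KW by (intro vs.subspace_sum[OF KW_subspace]) auto
  ultimately have tot: "(\<Sum>i\<in>S'. t i) \<in> KW" using S(3) vs.subspace_add[OF KW_subspace] by simp
  have rest: "(\<Sum>i\<in>S' - {a, b}. t i) \<in> vs.span (KW \<union> ?B)"
  proof (rule vs.span_sum)
    fix i assume i: "i \<in> S' - {a, b}"
    have "i\<^sup>2 + (a + b - i)\<^sup>2 - (a\<^sup>2 + b\<^sup>2) = 2 * ((i - a) * (i - b))"
      by (simp add: power2_eq_square algebra_simps)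
    moreover have "(i - a) * (i - b) > 0"
    proof (cases "i < a")
      case True thus ?thesis using i ab by (intro mult_neg_neg) auto
    next
      case False thus ?thesis using i ab by (intro mult_pos_pos) auto
    qed
    ultimately show "t i \<in> vs.span (KW \<union> ?B)"
      unfolding t_def by (intro vs.span_base UnI2) auto
  qed
  have "(\<Sum>i\<in>S'. t i) = (\<Sum>i\<in>{a, b}. t i) + (\<Sum>i\<in>S' - {a, b}. t i)"
    using S' by (metis S'_def Un_upper2 add.commute sum.subset_diff)
  hence "(\<Sum>i\<in>{a, b}. t i) = (\<Sum>i\<in>S'. t i) - (\<Sum>i\<in>S' - {a, b}. t i)" by simp
  hence *: "(\<Sum>i\<in>{a, b}. t i) \<in> vs.span (KW \<union> ?B)"
    using vs.span_diff[OF span_Un_left[OF KW_subspace tot] rest] by simp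
  have "t a \<in> vs.span (KW \<union> ?B)"
  proof (cases "a = b")
    case True thus ?thesis using * by simp
  next
    case False
    have "t a - t b \<in> K0"
      using swap_K0[of u "X a" "X b" w] rel_pairs_comm[OF X] by (simp add: t_def)
    hence "t a - t b \<in> vs.span (KW \<union> ?B)"
      using K0_sub_KW by (intro span_Un_left[OF KW_subspace]) auto
    hence "(t a - t b) + (\<Sum>i\<in>{a, b}. t i) \<in> vs.span (KW \<union> ?B)" using * by (intro vs.span_add)
    hence "fscale (1/2) ((t a - t b) + (\<Sum>i\<in>{a, b}. t i)) \<in> vs.span (KW \<union> ?B)" by (rule vs.span_scale)
    moreover have "fscale (1/2) ((t a - t b) + (\<Sum>i\<in>{a, b}. t i)) = t a"
      using False by (auto simp: fscale_def fun_eq_iff fun_ops)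
    ultimately show ?thesis by simp
  qed
  thus ?thesis by (simp add: t_def)
qed

section \<open>Spanning\<close>

text \<open>The coefficient extraction of \<open>G\<close> against \<open>\<Prod>k. (z - w\<^sub>k)\<close>, \<open>z\<close> dual to \<open>i\<close> and \<open>w\<^sub>k\<close> to the
  entries of \<open>J\<close>. The two-term relation \<open>[e\<^sub>i, f\<^sub>j] = [e\<^sub>i\<^sub>+\<^sub>1, f\<^sub>j\<^sub>-\<^sub>1]\<close> lets a generator pass through
  all generators of the other kind inside such an alternating sum.\<close>

fun altsum :: "int \<Rightarrow> (int \<Rightarrow> int list \<Rightarrow> vec) \<Rightarrow> int \<Rightarrow> int list \<Rightarrow> vec" where
  "altsum s G i [] = G i []"
| "altsum s G i (j # J) = altsum s (\<lambda>i' J'. G i' (j # J')) i J - altsum s (\<lambda>i' J'. G i' ((j - s) # J')) (i + s) J"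

lemma altsum_diff: "altsum s (\<lambda>i J. G i J - H i J) i J = altsum s G i J - altsum s H i J"
  by (induction J arbitrary: i G H) (auto simp: algebra_simps)

lemma altsum_shift: "altsum s G (i + s) J = altsum s (\<lambda>i' J'. G (i' + s) J') i J"
proof (induction J arbitrary: i G)
  case (Cons j J)
  show ?case by (simp only: altsum.simps Cons.IH)
qed simp

lemma altsum_mem:
  assumes "vs.subspace K" "\<And>i J. G i J \<in> K"
  shows "altsum s G i J \<in> K"
  using assms(2) by (induction J arbitrary: i G) (auto intro: vs.subspace_diff[OF assms(1)])

text \<open>\<open>altsum\<close> expands a product of factors \<open>1 - shift\<close>: each entry
  of \<open>J\<close> either stays or hands \<open>s\<close> over to \<open>i\<close>. The total is
  conserved, and \<open>i\<close> moves by at most \<open>length J\<close> in the direction of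
  \<open>s\<close>, which is 1 or -1.\<close>

lemma altsum_in_span:
  assumes s: "s * s = 1"
  shows "altsum s G i J \<in> vs.span {G i' J' | i' J'. length J' = length J \<and> i' + sum_list J' = i + sum_list J
     \<and> s * sum_list J' \<le> s * sum_list J \<and> s * i' \<le> s * i + int (length J)}"
proof (induction J arbitrary: i G)
  case Nil
  show ?case by (auto intro!: vs.span_base)
next
  case (Cons j J)
  let ?T = "{G i' J' | i' J'. length J' = length (j # J) \<and> i' + sum_list J' = i + sum_list (j # J)
     \<and> s * sum_list J' \<le> s * sum_list (j # J) \<and> s * i' \<le> s * i + int (length (j # J))}"
  have 1: "altsum s (\<lambda>i' J'. G i' (j # J')) i J \<in> vs.span ?T"
    by (rule span_bind[OF Cons.IH])
       (rule order_trans[OF _ vs.span_superset], fastforce simp: algebra_simps)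
  have mem: "G i' ((j - s) # J') \<in> ?T"
    if "length J' = length J" "i' + sum_list J' = i + s + sum_list J"
      "s * sum_list J' \<le> s * sum_list J" "s * i' \<le> s * (i + s) + int (length J)" for i' J'
    unfolding mem_Collect_eq
    by (rule exI[of _ i'], rule exI[of _ "(j - s) # J'"]) (use that s in \<open>auto simp: algebra_simps\<close>)
  have 2: "altsum s (\<lambda>i' J'. G i' ((j - s) # J')) (i + s) J \<in> vs.span ?T"
    by (intro span_bind[OF Cons.IH] order_trans[OF _ vs.span_superset] subsetI,
        elim CollectE exE conjE, hypsubst, rule mem)
  show ?case using vs.span_diff[OF 1 2] by simp
qed

text \<open>The expansion contains \<open>G i J\<close> once, from choosing no shift; all other
  terms have moved at least one unit. As soon as the alternating sum vanishes, the leading word is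
  thus expressed by words with smaller \<open>s * sum_list J\<close>.\<close>

lemma altsum_lead:
  assumes s: "s * s = 1"
  shows "G i J - altsum s G i J \<in> vs.span {G i' J' | i' J'. length J' = length J \<and> i' + sum_list J' = i + sum_list J
     \<and> s * sum_list J' < s * sum_list J}"
proof (induction J arbitrary: i G)
  case Nil
  show ?case by (auto intro!: vs.span_zero)
next
  case (Cons j J)
  let ?T = "{G i' J' | i' J'. length J' = length (j # J) \<and> i' + sum_list J' = i + sum_list (j # J)
     \<and> s * sum_list J' < s * sum_list (j # J)}"
  have 1: "G i (j # J) - altsum s (\<lambda>i' J'. G i' (j # J')) i J \<in> vs.span ?T"
    by (rule span_bind[OF Cons.IH[of "\<lambda>i' J'. G i' (j # J')"]])
       (rule order_trans[OF _ vs.span_superset], fastforce simp: algebra_simps)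
  have mem: "G i' ((j - s) # J') \<in> ?T"
    if "length J' = length J" "i' + sum_list J' = i + s + sum_list J"
      "s * sum_list J' \<le> s * sum_list J" for i' J'
    unfolding mem_Collect_eq
    by (rule exI[of _ i'], rule exI[of _ "(j - s) # J'"]) (use that s in \<open>auto simp: algebra_simps\<close>)
  have 2: "altsum s (\<lambda>i' J'. G i' ((j - s) # J')) (i + s) J \<in> vs.span ?T"
    by (intro span_bind[OF altsum_in_span[OF s]] order_trans[OF _ vs.span_superset] subsetI,
        elim CollectE exE conjE, hypsubst, rule mem)
  have "G i (j # J) - altsum s G i (j # J) =
      (G i (j # J) - altsum s (\<lambda>i' J'. G i' (j # J')) i J) + altsum s (\<lambda>i' J'. G i' ((j - s) # J')) (i + s) J"
    by simp
  thus ?case using vs.span_add[OF 1 2] by (simp only:)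
qed

text \<open>The commutator depends only on \<open>i + j\<close> and so cancels between
  \<open>(i, j)\<close> and \<open>(i + s, j - s)\<close>. This is applied to one letter of
  \<open>J\<close> after the other. The scalar \<open>c\<close> allows for both orders of
  \<open>E\<close> and \<open>F\<close>.\<close>

lemma altsum_swap:
  assumes XY: "\<And>u w i j. wvec (u @ X i # Y j # w) - wvec (u @ Y j # X i # w) - fscale c (wvec (u @ Hh (i + j) # w)) \<in> K0"
  shows "altsum s (\<lambda>i J. wvec (u @ X i # map Y J @ w)) i J - altsum s (\<lambda>i J. wvec (u @ map Y J @ X i # w)) i J \<in> K0"
proof (induction J arbitrary: i u)
  case Nil
  show ?case by (simp add: vs.subspace_0[OF K0_subspace])
next
  case (Cons j J)
  let ?a = "\<lambda>i' J'. wvec (u @ X i' # Y j # map Y J' @ w)"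
  let ?b = "\<lambda>i' J'. wvec (u @ X i' # Y (j - s) # map Y J' @ w)"
  let ?c = "\<lambda>i' J'. wvec (u @ Y j # X i' # map Y J' @ w)"
  let ?d = "\<lambda>i' J'. wvec (u @ Y (j - s) # X i' # map Y J' @ w)"
  let ?e = "\<lambda>i' J'. wvec (u @ Y j # map Y J' @ X i' # w)"
  let ?f = "\<lambda>i' J'. wvec (u @ Y (j - s) # map Y J' @ X i' # w)"
  have "?a i' J' - ?b (i' + s) J' - (?c i' J' - ?d (i' + s) J') \<in> K0" for i' J'
    using vs.subspace_diff[OF K0_subspace XY[of u i' j "map Y J' @ w"] XY[of u "i' + s" "j - s" "map Y J' @ w"]]
    by (simp add: algebra_simps)
  from altsum_mem[OF K0_subspace this, where s = s and i = i and J = J]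
  have 1: "(altsum s ?a i J - altsum s ?b (i + s) J) - (altsum s ?c i J - altsum s ?d (i + s) J) \<in> K0"
    unfolding altsum_diff altsum_shift .
  have 2: "altsum s ?c i J - altsum s ?e i J \<in> K0" using Cons.IH[of "u @ [Y j]" i] by simp
  have 3: "altsum s ?d (i + s) J - altsum s ?f (i + s) J \<in> K0" using Cons.IH[of "u @ [Y (j - s)]" "i + s"] by simp
  show ?case
    using vs.subspace_add[OF K0_subspace 1 vs.subspace_diff[OF K0_subspace 2 3]] by (simp add: algebra_simps)
qed

lemma swap_EF: "wvec (u @ E i # F j # w) - wvec (u @ F j # E i # w) - fscale 1 (wvec (u @ Hh (i + j) # w)) \<in> K0"
  using swap_K0[of u "E i" "F j" w] by simp

lemma swap_FE: "wvec (u @ F i # E j # w) - wvec (u @ E j # F i # w) - fscale (-1) (wvec (u @ Hh (i + j) # w)) \<in> K0"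
  using swap_K0[of u "F i" "E j" w] by (simp add: add.commute)

text \<open>In the alternating sum with \<open>s = 1\<close> the letter \<open>E\<close> can be
  moved next to \<open>v\<close>. Its mode never exceeds \<open>i + length J\<close>, hence is
  nonpositive and kills \<open>v\<close>. The sum is zero in \<open>M\<close> and can be solved for
  its leading word.\<close>

lemma low_E_reduce:
  assumes "i + int (length J) \<le> 0"
  shows "wvec (u @ E i # map F J) \<in> vs.span (K0 \<union> {wvec (u @ E i' # map F J') | i' J'.
     length J' = length J \<and> i' + sum_list J' = i + sum_list J \<and> sum_list J' < sum_list J})"
    (is "_ \<in> vs.span (K0 \<union> ?B)")
proof -
  let ?G = "\<lambda>i J. wvec (u @ E i # map F J @ [])"
  let ?H = "\<lambda>i J. wvec (u @ map F J @ E i # [])"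
  have "altsum 1 ?H i J \<in> K0"
  proof (rule subsetD[OF vs.span_minimal[OF _ K0_subspace] altsum_in_span])
    show "{?H i' J' |i' J'. length J' = length J \<and> i' + sum_list J' = i + sum_list J \<and>
           1 * sum_list J' \<le> 1 * sum_list J \<and> 1 * i' \<le> 1 * i + int (length J)} \<subseteq> K0"
      using assms nonpos_K0[of "E _" "u @ map F _"] by fastforce
  qed simp
  hence "altsum 1 ?G i J \<in> K0"
    using vs.subspace_add[OF K0_subspace altsum_swap[of E F 1 1 u "[]" i J, OF swap_EF]] by fastforce
  hence 1: "altsum 1 ?G i J \<in> vs.span (K0 \<union> ?B)" by (simp add: vs.span_base)
  have 2: "?G i J - altsum 1 ?G i J \<in> vs.span (K0 \<union> ?B)"
    by (rule span_bind[OF altsum_lead[of 1 ?G i J]]) (auto intro: vs.span_base)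
  show ?thesis using vs.span_add[OF 2 1] by simp
qed

lemma gsub_gens: "i \<ge> M \<Longrightarrow> gvec (E i) \<in> gsub M N" "j \<ge> N \<Longrightarrow> gvec (F j) \<in> gsub M N"
  unfolding gsub_def by auto

lemma emb_gvec: "emb (gvec x) = wvec [x]"
  by (auto simp: emb_def gvec_def wvec_def fun_eq_iff split: list.splits)

lemma E_Kfull: "i \<ge> M \<Longrightarrow> wvec (E i # w) \<in> Kfull M N"
proof -
  assume "i \<ge> M"
  hence "vmul (emb (gvec (E i))) (wvec w) \<in> Kfull M N"
    unfolding Kfull_def lspan_eq using gsub_gens by (intro vs.span_base) blast
  thus ?thesis by (simp add: emb_gvec)
qed

lemma F_Kfull: "j \<ge> N \<Longrightarrow> wvec (F j # w) \<in> Kfull M N"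
proof -
  assume "j \<ge> N"
  hence "vmul (emb (gvec (F j))) (wvec w) \<in> Kfull M N"
    unfolding Kfull_def lspan_eq using gsub_gens by (intro vs.span_base) blast
  thus ?thesis by (simp add: emb_gvec)
qed

text \<open>The mirror image of \<open>low_E_reduce\<close>: with \<open>s = -1\<close> the letter
  \<open>F\<close> moves to the far left, its mode stays at least \<open>j - length I >= N\<close>,
  and the sum lies in \<open>g(M, N) W\<close>. The sum of \<open>I\<close> grows, so the
  \<open>f\<close>-degree drops here as well, and one measure serves both reductions.\<close>

lemma high_F_reduce:
  assumes "N \<le> j - int (length I)"
  shows "wvec (map E I @ F j # w) \<in> vs.span (Kfull M N \<union> {wvec (map E I' @ F j' # w) | j' I'.
     length I' = length I \<and> j' + sum_list I' = j + sum_list I \<and> sum_list I' > sum_list I})"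
    (is "_ \<in> vs.span (?K \<union> ?B)")
proof -
  let ?G = "\<lambda>j I. wvec ([] @ F j # map E I @ w)"
  let ?H = "\<lambda>j I. wvec ([] @ map E I @ F j # w)"
  have "altsum (-1) ?G j I \<in> ?K"
  proof (rule subsetD[OF vs.span_minimal[OF _ Kfull_subspace] altsum_in_span])
    show "{?G i' J' |i' J'. length J' = length I \<and> i' + sum_list J' = j + sum_list I \<and>
           -1 * sum_list J' \<le> -1 * sum_list I \<and> -1 * i' \<le> -1 * j + int (length I)} \<subseteq> ?K"
      using assms F_Kfull by fastforce
  qed simp
  moreover have "altsum (-1) ?G j I - altsum (-1) ?H j I \<in> ?K"
    using altsum_swap[of F E "-1" "-1" "[]" w j I, OF swap_FE] K0_sub_Kfull by blast
  ultimately have "altsum (-1) ?G j I - (altsum (-1) ?G j I - altsum (-1) ?H j I) \<in> ?K"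
    by (rule vs.subspace_diff[OF Kfull_subspace])
  hence 1: "altsum (-1) ?H j I \<in> vs.span (?K \<union> ?B)" by (simp add: vs.span_base)
  have 2: "?H j I - altsum (-1) ?H j I \<in> vs.span (?K \<union> ?B)"
    by (rule span_bind[OF altsum_lead[of "-1" ?H j I]]) (auto intro: vs.span_base)
  show ?thesis using vs.span_add[OF 2 1] by simp
qed

section \<open>Elimination of h and normal ordering of words\<close>

definition ef :: "int list \<Rightarrow> int list \<Rightarrow> vec" where
  "ef I J = wvec (map E I @ map F J)"

definition ef_words :: "nat \<Rightarrow> nat \<Rightarrow> int \<Rightarrow> vec set" where
  "ef_words m n d = {ef I J | I J. length I = m \<and> length J = n \<and> sum_list I + sum_list J = d}"

lemma E_mult_ef_words:
  assumes "x \<in> vs.span (K0 \<union> ef_words m n d)"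
  shows "vmul (wvec [E i]) x \<in> vs.span (K0 \<union> ef_words (Suc m) n (i + d))"
  using assms
proof (rule span_imageI[where T = "vmul (wvec [E i])"])
  fix g assume "g \<in> K0 \<union> ef_words m n d"
  thus "vmul (wvec [E i]) g \<in> vs.span (K0 \<union> ef_words (Suc m) n (i + d))"
  proof
    assume "g \<in> ef_words m n d"
    then obtain I J where g: "g = ef I J" "length I = m" "length J = n" "sum_list I + sum_list J = d"
      by (auto simp: ef_words_def)
    have "vmul (wvec [E i]) g = ef (i # I) J" by (simp add: g ef_def)
    moreover have "ef (i # I) J \<in> ef_words (Suc m) n (i + d)"
      unfolding ef_words_def using g by (intro CollectI exI[of _ "i # I"] exI[of _ J]) auto
    ultimately show ?thesis by (simp add: vs.span_base)
  qed (auto intro: vs.span_base K0_mult)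
qed (simp_all add: vmul_add_right vmul_scale_right)

lemma in_span_K0:
  assumes "a - b \<in> K0" "b \<in> vs.span (K0 \<union> B)"
  shows "a \<in> vs.span (K0 \<union> B)"
  by (rule in_span_of_diff[OF assms(1) _ assms(2)]) (auto intro: vs.span_base)

text \<open>For \<open>i\<close> small enough \<open>e\<^sub>i\<close> kills \<open>f\<^sub>J v\<close>, hence \<open>h\<^sub>k f\<^sub>J v = e\<^sub>i f\<^sub>k\<^sub>-\<^sub>i f\<^sub>J v\<close>.\<close>

lemma H_ef: "wvec (Hh k # map E I @ map F J) \<in> vs.span (K0 \<union> ef_words (Suc (length I)) (Suc (length J)) (k + (sum_list I + sum_list J)))"
proof (induction I)
  case Nil
  obtain L where L: "\<And>x. mode x \<le> L \<Longrightarrow> wvec (x # map F J) \<in> K0" using low_mode_K0 by blast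
  have "wvec ([F (k - L)] @ E L # map F J) \<in> K0" by (rule word_mult_K0) (simp add: L)
  hence "wvec (E L # F (k - L) # map F J) - wvec (Hh k # map F J) \<in> K0"
    using vs.subspace_add[OF K0_subspace swap_EF[of "[]" L "k - L" "map F J"]] by fastforce
  hence "wvec (Hh k # map F J) - ef [L] ((k - L) # J) \<in> K0"
    using vs.subspace_neg[OF K0_subspace] by (fastforce simp: ef_def)
  moreover have "ef [L] ((k - L) # J) \<in> ef_words 1 (Suc (length J)) (k + sum_list J)"
    unfolding ef_words_def by (intro CollectI exI[of _ "[L]"] exI[of _ "(k - L) # J"]) auto
  ultimately show ?case by (auto intro: in_span_K0 vs.span_base)
next
  case (Cons i I)
  have "wvec (Hh k # map E (i # I) @ map F J) - vmul (wvec [E i]) (wvec (Hh k # map E I @ map F J)) \<in> K0"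
    using swap_K0[of "[]" "Hh k" "E i" "map E I @ map F J"] by simp
  from in_span_K0[OF this E_mult_ef_words[OF Cons.IH, of i]] show ?case by (simp add: algebra_simps)
qed

lemma F_ef: "wvec (F j # map E I @ map F J) \<in> vs.span (K0 \<union> ef_words (length I) (Suc (length J)) (j + (sum_list I + sum_list J)))"
proof (induction I)
  case Nil
  have "wvec (F j # map F J) \<in> ef_words 0 (Suc (length J)) (j + sum_list J)"
    unfolding ef_words_def ef_def by (intro CollectI exI[of _ "[]"] exI[of _ "j # J"]) auto
  thus ?case by (simp add: vs.span_base)
next
  case (Cons i I)
  let ?w = "map E I @ map F J"
  have "wvec (F j # E i # ?w) - (vmul (wvec [E i]) (wvec (F j # ?w)) - wvec (Hh (i + j) # ?w)) \<in> K0"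
    using swap_K0[of "[]" "F j" "E i" ?w] by (simp add: algebra_simps)
  moreover have "vmul (wvec [E i]) (wvec (F j # ?w)) \<in> vs.span (K0 \<union> ef_words (length (i # I)) (Suc (length J)) (j + (sum_list (i # I) + sum_list J)))"
    using E_mult_ef_words[OF Cons.IH, of i] by (simp add: algebra_simps)
  moreover have "wvec (Hh (i + j) # ?w) \<in> vs.span (K0 \<union> ef_words (length (i # I)) (Suc (length J)) (j + (sum_list (i # I) + sum_list J)))"
    using H_ef[of "i + j" I J] by (simp add: algebra_simps)
  ultimately have "wvec (F j # E i # ?w) \<in> vs.span (K0 \<union> ef_words (length (i # I)) (Suc (length J)) (j + (sum_list (i # I) + sum_list J)))"
    by (blast intro: in_span_K0 vs.span_diff)
  thus ?case by simp
qed

text \<open>This takes place in \<open>M\<close>, modulo \<open>K0\<close>: letters are added on the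
  left, and each is brought into place by brackets and by the vanishing of low modes. All three
  degrees are preserved.\<close>

lemma word_in_ef_words: "wvec w \<in> vs.span (K0 \<union> ef_words (wH1 w) (wH2 w) (wdeg w))"
proof (induction w)
  case Nil
  have "wvec [] = ef [] []" by (simp add: ef_def)
  hence "wvec [] \<in> ef_words 0 0 0" unfolding ef_words_def by auto
  thus ?case by (simp add: vs.span_base wH1_def wH2_def wdeg_def)
next
  case (Cons x w)
  have "vmul (wvec [x]) (wvec w) \<in> vs.span (K0 \<union> ef_words (wH1 (x # w)) (wH2 (x # w)) (wdeg (x # w)))"
    using Cons.IH
  proof (rule span_imageI[where T = "vmul (wvec [x])"])
    fix g assume "g \<in> K0 \<union> ef_words (wH1 w) (wH2 w) (wdeg w)"
    thus "vmul (wvec [x]) g \<in> vs.span (K0 \<union> ef_words (wH1 (x # w)) (wH2 (x # w)) (wdeg (x # w)))"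
    proof
      assume "g \<in> ef_words (wH1 w) (wH2 w) (wdeg w)"
      then obtain I J where g: "g = ef I J" "length I = wH1 w" "length J = wH2 w"
        "sum_list I + sum_list J = wdeg w" by (auto simp: ef_words_def)
      have eq: "vmul (wvec [x]) g = wvec (x # map E I @ map F J)" by (simp add: g ef_def)
      show ?thesis
      proof (cases x)
        case (E i)
        have "g \<in> ef_words (wH1 w) (wH2 w) (wdeg w)" by fact
        from E_mult_ef_words[OF vs.span_base[OF UnI2[OF this]], of i] E show ?thesis
          by (simp add: wH1_def wH2_def wdeg_def)
      next
        case (Hh k)
        thus ?thesis unfolding eq using H_ef[of k I J] g by (simp add: wH1_def wH2_def wdeg_def)
      next
        case (F j)
        thus ?thesis unfolding eq using F_ef[of j I J] g by (simp add: wH1_def wH2_def wdeg_def)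
      qed
    qed (auto intro: vs.span_base K0_mult)
  qed (simp_all add: vmul_add_right vmul_scale_right)
  thus ?case by simp
qed

section \<open>Reordering and straightening of monomials\<close>

lemma move_front:
  assumes X: "(X, X) \<in> rel_pairs"
  shows "wvec (u @ map X A @ X a # w) - wvec (u @ X a # map X A @ w) \<in> K0"
proof (induction A arbitrary: u)
  case Nil
  show ?case by (simp add: vs.subspace_0[OF K0_subspace])
next
  case (Cons b A)
  have "wvec (u @ X b # X a # map X A @ w) - wvec (u @ X a # X b # map X A @ w) \<in> K0"
    using swap_K0[of u "X b" "X a" "map X A @ w"] by (simp add: rel_pairs_comm[OF X])
  from vs.subspace_add[OF K0_subspace Cons.IH[of "u @ [X b]"], simplified, OF this]
  show ?case by simp
qed

lemma perm_K0:
  assumes X: "(X, X) \<in> rel_pairs" and "mset I = mset I'"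
  shows "wvec (u @ map X I @ w) - wvec (u @ map X I' @ w) \<in> K0"
  using assms(2)
proof (induction I arbitrary: I' u)
  case Nil
  thus ?case by (simp add: vs.subspace_0[OF K0_subspace])
next
  case (Cons i I)
  hence "i \<in> set I'" by (metis list.set_intros(1) mset_eq_setD)
  then obtain A B where I': "I' = A @ i # B" by (meson split_list)
  have "wvec ((u @ [X i]) @ map X I @ w) - wvec ((u @ [X i]) @ map X (A @ B) @ w) \<in> K0"
    by (rule Cons.IH) (use Cons.prems I' in auto)
  from vs.subspace_diff[OF K0_subspace this move_front[OF X, of u A i "map X B @ w"]]
  show ?case by (simp add: I')
qed

lemma EE_rel: "(E, E) \<in> rel_pairs" and FF_rel: "(F, F) \<in> rel_pairs"
  by (auto simp: rel_pairs_def)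

lemma ef_perm:
  assumes "mset I = mset I'" "mset J = mset J'"
  shows "ef I J - ef I' J' \<in> K0"
  using vs.subspace_add[OF K0_subspace perm_K0[OF EE_rel assms(1), of "[]" "map F J"]
      perm_K0[OF FF_rel assms(2), of "map E I'" "[]"]]
  by (simp add: ef_def)

lemma not_gap2_split:
  assumes "sorted (rev I)" "\<not> gap2 I"
  obtains A a b C where "I = A @ a # b # C" "\<bar>a - b\<bar> \<le> 1"
proof -
  obtain k where k: "Suc k < length I" "I ! k < I ! Suc k + 2" using assms(2) by (auto simp: gap2_def)
  have "I ! Suc k \<le> I ! k" using sorted_rev_nth_mono[OF assms(1), of k "Suc k"] k by simp
  moreover have "I = take k I @ I ! k # I ! Suc k # drop (Suc (Suc k)) I"
    using k by (simp add: Cons_nth_drop_Suc)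
  ultimately show ?thesis using k by (intro that[of "take k I" "I ! k" "I ! Suc k" "drop (Suc (Suc k)) I"]) auto
qed

definition basis_deg :: "int \<Rightarrow> int \<Rightarrow> nat \<Rightarrow> nat \<Rightarrow> int \<Rightarrow> (int list \<times> int list) set" where
  "basis_deg M N m n d = {p \<in> basis_idx M N m n. sum_list (fst p) + sum_list (snd p) = d}"

lemma sum_list_sq_le:
  assumes "\<And>x. x \<in> set I \<Longrightarrow> \<bar>x\<bar> \<le> R"
  shows "(\<Sum>x\<leftarrow>I. x\<^sup>2) \<le> int (length I) * R\<^sup>2"
  using assms
proof (induction I)
  case (Cons a I)
  have "a\<^sup>2 \<le> R\<^sup>2" using Cons.prems[of a] by (simp add: abs_le_square_iff[symmetric])
  thus ?case using Cons by (simp add: algebra_simps)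
qed simp

text \<open>Induction on the sum of \<open>J\<close>, which drops when an index outside the allowed range is removed;
  for a fixed sum, on the sum of squares of all indices, which grows when two indices at distance
  at most one are spread by \<open>e(z)\<^sup>2 = 0\<close> or \<open>f(z)\<^sup>2 = 0\<close>.\<close>

lemma ef_in_span_basis:
  fixes M N :: int
  assumes "length I = m" "length J = n" "sum_list I + sum_list J = d"
  shows "ef I J \<in> vs.span (Kfull M N \<union> basis_vec ` basis_deg M N m n d)"
  using assms
proof (induction "nat (sum_list J)" arbitrary: I J rule: less_induct)
  case less
  note IH1 = less.hyps
  \<comment> \<open>\<open>R\<close> bounds every index in the allowed ranges, and \<open>B\<close>
    exceeds the sum of squares of every pair of lists with such indices, so
    \<open>nat (B - Q I J)\<close> decreases when \<open>Q\<close> grows.\<close>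
  define R :: int where "R = int n + int m + \<bar>M\<bar> + \<bar>N\<bar> + 1"
  define B :: int where "B = (int m + int n) * R\<^sup>2 + 1"
  define s where "s = sum_list J"
  define Q :: "int list \<Rightarrow> int list \<Rightarrow> int" where "Q I J = (\<Sum>x\<leftarrow>I. x\<^sup>2) + (\<Sum>x\<leftarrow>J. x\<^sup>2)" for I J
  let ?K = "Kfull M N" and ?S = "vs.span (Kfull M N \<union> basis_vec ` basis_deg M N m n d)"
  have KS: "?K \<subseteq> ?S" by (auto intro: vs.span_base)
  have K0S: "K0 \<subseteq> ?S" and KWS: "KW \<subseteq> ?S" using KS K0_sub_Kfull KW_sub_Kfull by blast+
  have trans: "x \<in> ?S" if "x - y \<in> K0" "y \<in> ?S" for x y
    using in_span_of_diff[OF that(1) K0S that(2)] .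
  from less.prems s_def[symmetric] show ?case
  proof (induction "nat (B - Q I J)" arbitrary: I J rule: less_induct)
    case less
    note IH2 = less.hyps and prems = less.prems
    have mv: "ef I J \<in> ?S" if "ef I' J' \<in> ?S" "mset I = mset I'" "mset J = mset J'" for I' J'
      using trans[OF ef_perm[OF that(2,3)] that(1)] .
    show ?case
    \<comment> \<open>Nonpositive \<open>f\<close>-modes are disposed of before all else: afterwards
      \<open>s\<close> is positive or \<open>J\<close> is empty, so \<open>nat\<close> does not hide
      a decrease of the sum of \<open>J\<close>.\<close>
    proof (cases "\<exists>j\<in>set J. j \<le> 0")
      case True
      then obtain j A C where j: "j \<le> 0" "J = A @ j # C" by (meson split_list)
      have "wvec ((map E I @ map F (A @ C)) @ [F j]) \<in> K0" using j by (intro nonpos_K0) auto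
      hence "ef I (A @ C @ [j]) \<in> ?S" using K0S by (auto simp: ef_def)
      thus ?thesis by (rule mv) (auto simp: j)
    next
      case Jpos: False
      have s0: "s > 0 \<or> J = []"
      proof (cases J)
        case (Cons j J')
        have "sum_list J' \<ge> 0" using Jpos Cons by (intro sum_list_nonneg) force
        thus ?thesis using Jpos Cons prems by force
      qed auto
      have IH1': "ef I' J' \<in> ?S" if "length I' = m" "length J' = n"
        "sum_list I' + sum_list J' = d" "sum_list J' < s" for I' J'
      proof -
        have "s > 0" using s0 that prems by auto
        hence "nat (sum_list J') < nat s" using that by simp
        thus ?thesis using IH1[of J' I'] that prems s_def by simp
      qed
      show ?thesis
      proof (cases "\<exists>i\<in>set I. i \<le> - int n")
        case True
        then obtain i A C where i: "i \<le> - int n" "I = A @ i # C" by (meson split_list)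
        have "wvec (map E (A @ C) @ E i # map F J) \<in> ?S"
        proof (rule span_bind[OF low_E_reduce])
          show "i + int (length J) \<le> 0" using i prems by simp
          have "wvec (map E (A @ C) @ E i' # map F J') \<in> ?S"
            if "length J' = length J" "i' + sum_list J' = i + sum_list J" "sum_list J' < sum_list J" for i' J'
            using IH1'[of "(A @ C) @ [i']" J'] that prems i by (simp add: ef_def)
          thus "K0 \<union> {wvec (map E (A @ C) @ E i' # map F J') |i' J'. length J' = length J \<and>
             i' + sum_list J' = i + sum_list J \<and> sum_list J' < sum_list J} \<subseteq> ?S"
            using K0S by blast
        qed
        hence "ef (A @ C @ [i]) J \<in> ?S" by (simp add: ef_def)
        thus ?thesis by (rule mv) (auto simp: i)
      next
        case Ilow: False
        show ?thesis
        proof (cases "\<exists>i\<in>set I. i \<ge> M")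
          case True
          then obtain i A C where i: "i \<ge> M" "I = A @ i # C" by (meson split_list)
          have "ef (i # A @ C) J \<in> ?S" using E_Kfull[OF i(1)] KS by (auto simp: ef_def)
          thus ?thesis by (rule mv) (auto simp: i)
        next
          case Ihigh: False
          show ?thesis
          proof (cases "\<exists>j\<in>set J. j \<ge> N + int m")
            case True
            then obtain j A C where j: "j \<ge> N + int m" "J = A @ j # C" by (meson split_list)
            have "wvec (map E I @ F j # map F (A @ C)) \<in> ?S"
            proof (rule span_bind[OF high_F_reduce])
              show "N \<le> j - int (length I)" using j prems by simp
              have "wvec (map E I' @ F j' # map F (A @ C)) \<in> ?S"
                if "length I' = length I" "j' + sum_list I' = j + sum_list I" "sum_list I' > sum_list I" for j' I'
                using IH1'[of I' "j' # A @ C"] that prems j by (simp add: ef_def)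
              thus "?K \<union> {wvec (map E I' @ F j' # map F (A @ C)) |j' I'. length I' = length I \<and>
                 j' + sum_list I' = j + sum_list I \<and> sum_list I' > sum_list I} \<subseteq> ?S"
                using KS by blast
            qed
            hence "ef I (j # A @ C) \<in> ?S" by (simp add: ef_def)
            thus ?thesis by (rule mv) (auto simp: j)
          next
            case Jhigh: False
            have "\<bar>x\<bar> \<le> R" if "x \<in> set I" for x
              using Ilow Ihigh that unfolding R_def by force
            hence "(\<Sum>x\<leftarrow>I. x\<^sup>2) \<le> int m * R\<^sup>2" using sum_list_sq_le[of I R] prems by simp
            moreover have "\<bar>x\<bar> \<le> R" if "x \<in> set J" for x
              using Jpos Jhigh that unfolding R_def by force
            hence "(\<Sum>x\<leftarrow>J. x\<^sup>2) \<le> int n * R\<^sup>2" using sum_list_sq_le[of J R] prems by simp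
            ultimately have QB: "Q I J < B" by (simp add: Q_def B_def algebra_simps)
            define I' where "I' = rev (sort I)"
            define J' where "J' = rev (sort J)"
            have ms: "mset I = mset I'" "mset J = mset J'" by (auto simp: I'_def J'_def)
            have QI: "(\<Sum>x\<leftarrow>I. x\<^sup>2) = (\<Sum>x\<leftarrow>I'. x\<^sup>2)"
              by (metis ms(1) mset_map sum_mset_sum_list)
            have QJ: "(\<Sum>x\<leftarrow>J. x\<^sup>2) = (\<Sum>x\<leftarrow>J'. x\<^sup>2)"
              by (metis ms(2) mset_map sum_mset_sum_list)
            have sI: "sum_list I' = sum_list I" "sum_list J' = sum_list J"
              by (metis ms sum_mset_sum_list)+
            have lI: "length I' = m" "length J' = n" using prems by (auto simp: I'_def J'_def)
            have srt: "sorted (rev I')" "sorted (rev J')" by (auto simp: I'_def J'_def)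
            have IH2': "ef I'' J'' \<in> ?S" if "length I'' = m" "length J'' = n"
              "sum_list I'' + sum_list J'' = d" "sum_list J'' = s" "Q I'' J'' > Q I J" for I'' J''
              using IH2[of I'' J''] that QB by simp
            have "ef I' J' \<in> ?S"
            proof (cases "gap2 I'")
              case gI: False
              obtain A a b C where I': "I' = A @ a # b # C" and ab: "\<bar>a - b\<bar> \<le> 1"
                using not_gap2_split[OF srt(1) gI] .
              have "wvec (map E A @ E a # E b # map E C @ map F J') \<in> ?S"
              proof (rule span_bind[OF spread[OF EE_rel ab]])
                have "wvec (map E A @ E i # E (a + b - i) # map E C @ map F J') \<in> ?S"
                  if "i\<^sup>2 + (a + b - i)\<^sup>2 > a\<^sup>2 + b\<^sup>2" for i
                  using IH2'[of "A @ i # (a + b - i) # C" J'] that prems lI sI QI QJ I'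
                  by (simp add: ef_def Q_def)
                thus "KW \<union> {wvec (map E A @ E i # E (a + b - i) # map E C @ map F J') |i.
                    i\<^sup>2 + (a + b - i)\<^sup>2 > a\<^sup>2 + b\<^sup>2} \<subseteq> ?S"
                  using KWS by blast
              qed
              thus ?thesis by (simp add: ef_def I')
            next
              case gI: True
              show ?thesis
              proof (cases "gap2 J'")
                case gJ: False
                obtain A a b C where J': "J' = A @ a # b # C" and ab: "\<bar>a - b\<bar> \<le> 1"
                  using not_gap2_split[OF srt(2) gJ] .
                have "wvec ((map E I' @ map F A) @ F a # F b # map F C) \<in> ?S"
                proof (rule span_bind[OF spread[OF FF_rel ab]])
                  have "wvec ((map E I' @ map F A) @ F i # F (a + b - i) # map F C) \<in> ?S"
                    if "i\<^sup>2 + (a + b - i)\<^sup>2 > a\<^sup>2 + b\<^sup>2" for i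
                    using IH2'[of I' "A @ i # (a + b - i) # C"] that prems lI sI QI QJ J'
                    by (simp add: ef_def Q_def)
                  thus "KW \<union> {wvec ((map E I' @ map F A) @ F i # F (a + b - i) # map F C) |i.
                      i\<^sup>2 + (a + b - i)\<^sup>2 > a\<^sup>2 + b\<^sup>2} \<subseteq> ?S"
                    using KWS by blast
                qed
                thus ?thesis by (simp add: ef_def J')
              next
                case gJ: True
                have "set I' = set I" "set J' = set J" by (auto simp: I'_def J'_def)
                hence "(I', J') \<in> basis_deg M N m n d"
                  using gI gJ lI sI prems Ilow Ihigh Jpos Jhigh
                  by (fastforce simp: basis_deg_def basis_idx_def)
                moreover have "ef I' J' = basis_vec (I', J')" by (simp add: ef_def basis_vec_def)
                ultimately show ?thesis by (auto intro: vs.span_base)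
              qed
            qed
            thus ?thesis by (rule mv) (use ms in auto)
          qed
        qed
      qed
    qed
  qed
qed

lemma word_in_span_basis:
  "wvec w \<in> vs.span (Kfull M N \<union> basis_vec ` basis_deg M N (wH1 w) (wH2 w) (wdeg w))"
  by (rule span_bind[OF word_in_ef_words])
     (auto simp: ef_words_def intro: vs.span_base ef_in_span_basis subsetD[OF K0_sub_Kfull])

section \<open>A fermionic representation\<close>

text \<open>States are sets of occupied integer labels. The label \<open>3 b\<close> carries the \<open>b\<close>-th mode of a
  charged fermion with filled negative sea; the labels \<open>3 a + 1\<close> and \<open>3 c + 2\<close> carry two further
  fermions that are only ever created.\<close>

definition maya :: "int set \<Rightarrow> bool" where
  "maya S \<longleftrightarrow> (\<exists>L. (\<forall>x\<in>S. x \<le> L) \<and> (\<forall>b. b \<le> - L \<longrightarrow> 3 * b \<in> S))"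

text \<open>The usual fermionic sign, counted over occupied labels above \<open>x\<close>, because
  below \<open>x\<close> the sea is infinite. The value 0 outside Maya states makes the
  anticommutation relations hold for arbitrary functions of states, with \<open>maya_part\<close> in
  the place of the identity.\<close>

definition fsign :: "int \<Rightarrow> int set \<Rightarrow> complex" where
  "fsign x S = (if maya S then (-1) ^ card {y\<in>S. y > x} else 0)"

definition creat :: "int \<Rightarrow> (int set \<Rightarrow> complex) \<Rightarrow> int set \<Rightarrow> complex" where
  "creat x g = (\<lambda>S. if x \<in> S then fsign x S * g (S - {x}) else 0)"

definition annih :: "int \<Rightarrow> (int set \<Rightarrow> complex) \<Rightarrow> int set \<Rightarrow> complex" where
  "annih x g = (\<lambda>S. if x \<notin> S then fsign x S * g (insert x S) else 0)"

definition maya_part :: "(int set \<Rightarrow> complex) \<Rightarrow> int set \<Rightarrow> complex" where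
  "maya_part g = (\<lambda>S. if maya S then g S else 0)"

lemma maya_insert [simp]: "maya (insert x S) = maya S"
proof
  assume "maya S"
  then obtain L where L: "\<forall>y\<in>S. y \<le> L" "\<forall>b. b \<le> - L \<longrightarrow> 3 * b \<in> S" by (auto simp: maya_def)
  show "maya (insert x S)"
    unfolding maya_def by (rule exI[of _ "max L x"]) (use L in force)
next
  assume "maya (insert x S)"
  then obtain L where L: "\<forall>y\<in>insert x S. y \<le> L" "\<forall>b. b \<le> - L \<longrightarrow> 3 * b \<in> insert x S" by (auto simp: maya_def)
  show "maya S"
    unfolding maya_def
  proof (rule exI[of _ "max L (\<bar>x\<bar> + 1)"], intro conjI ballI allI impI)
    fix b assume b: "b \<le> - max L (\<bar>x\<bar> + 1)"
    hence "3 * b \<in> insert x S" using L by auto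
    moreover have "3 * b \<noteq> x" using b by linarith
    ultimately show "3 * b \<in> S" by simp
  qed (use L in auto)
qed

lemma maya_remove [simp]: "maya (S - {x}) = maya S"
  using maya_insert[of x S] maya_insert[of x "S - {x}"] by simp

lemma maya_finite: "maya S \<Longrightarrow> finite {y\<in>S. y > x}"
proof -
  assume "maya S"
  then obtain L where "\<forall>y\<in>S. y \<le> L" by (auto simp: maya_def)
  hence "{y\<in>S. y > x} \<subseteq> {x..L}" by auto
  thus ?thesis using finite_subset by blast
qed

lemma fsign_insert: "y \<notin> S \<Longrightarrow> fsign x (insert y S) = (if y > x then - fsign x S else fsign x S)"
proof -
  assume y: "y \<notin> S"
  have "{z \<in> insert y S. z > x} = (if y > x then insert y {z\<in>S. z > x} else {z\<in>S. z > x})" by auto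
  thus ?thesis using y maya_finite[of S x] by (auto simp: fsign_def)
qed

lemma fsign_remove: "y \<in> S \<Longrightarrow> fsign x (S - {y}) = (if y > x then - fsign x S else fsign x S)"
  using fsign_insert[of y "S - {y}" x] by (auto simp: insert_absorb)

lemma fsign_sq: "fsign x S * fsign x S = (if maya S then 1 else 0)"
  by (simp add: fsign_def flip: power_add power_mult_distrib)

section \<open>Anticommutation relations of the modes\<close>

definition anti :: "(('a \<Rightarrow> complex) \<Rightarrow> 'a \<Rightarrow> complex) \<Rightarrow> (('a \<Rightarrow> complex) \<Rightarrow> 'a \<Rightarrow> complex) \<Rightarrow> bool" where
  "anti P Q \<longleftrightarrow> (\<forall>g. P (Q g) = - Q (P g))"

definition lin :: "(('a \<Rightarrow> complex) \<Rightarrow> 'b \<Rightarrow> complex) \<Rightarrow> bool" where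
  "lin P \<longleftrightarrow> (\<forall>a b. P (a + b) = P a + P b) \<and> (\<forall>c a. P (fscale c a) = fscale c (P a))"

lemma antiD: "anti P Q \<Longrightarrow> P (Q g) = - Q (P g)" by (simp add: anti_def)
lemma anti_sym: "anti P Q \<Longrightarrow> anti Q P" by (simp add: anti_def)

lemma linD: "lin P \<Longrightarrow> P (a + b) = P a + P b" "lin P \<Longrightarrow> P (fscale c a) = fscale c (P a)"
  by (auto simp: lin_def)
lemma lin_zero: "lin P \<Longrightarrow> P 0 = 0" using linD(2)[of P 0 0] by simp
lemma lin_neg: "lin P \<Longrightarrow> P (- a) = - P a" using linD(2)[of P "-1" a] by simp
lemma lin_diff: "lin P \<Longrightarrow> P (a - b) = P a - P b"
  using linD(1)[of P a "- b"] lin_neg[of P b] by simp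
lemma lin_sum: "lin P \<Longrightarrow> P (\<Sum>i\<in>I. f i) = (\<Sum>i\<in>I. P (f i))"
  by (induction I rule: infinite_finite_induct) (auto simp: lin_zero linD)
lemma lin_comp: "lin P \<Longrightarrow> lin Q \<Longrightarrow> lin (\<lambda>g. P (Q g))" by (simp add: lin_def)
lemma lin_sumI: "(\<And>i. i \<in> I \<Longrightarrow> lin (P i)) \<Longrightarrow> lin (\<lambda>g. \<Sum>i\<in>I. P i g)"
  unfolding lin_def by (auto simp: sum.distrib vs.scale_sum_right)

lemma lin_creat: "lin (creat x)" and lin_annih: "lin (annih x)"
  by (auto simp: lin_def creat_def annih_def fscale_def fun_eq_iff fun_ops algebra_simps)

lemma anti_creat_creat: "anti (creat x) (creat y)"
proof -
  have "creat x (creat y g) S = - creat y (creat x g) S" for g S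
  proof (cases "x \<in> S \<and> y \<in> S \<and> x \<noteq> y")
    case True
    moreover have "S - {x} - {y} = S - {y} - {x}" by auto
    ultimately show ?thesis by (auto simp: creat_def fsign_remove)
  qed (auto simp: creat_def)
  thus ?thesis by (auto simp: anti_def fun_eq_iff fun_ops)
qed

lemma anti_annih_annih: "anti (annih x) (annih y)"
proof -
  have "annih x (annih y g) S = - annih y (annih x g) S" for g S
    by (cases "x \<notin> S \<and> y \<notin> S \<and> x \<noteq> y") (auto simp: annih_def fsign_insert insert_commute)
  thus ?thesis by (auto simp: anti_def fun_eq_iff fun_ops)
qed

lemma anti_creat_annih: assumes "x \<noteq> y" shows "anti (creat x) (annih y)"
proof -
  have "creat x (annih y g) S = - annih y (creat x g) S" for g S
  proof (cases "x \<in> S \<and> y \<notin> S")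
    case True
    moreover have "insert y (S - {x}) = insert y S - {x}" using assms by auto
    ultimately show ?thesis using assms by (auto simp: creat_def annih_def fsign_insert fsign_remove)
  qed (use assms in \<open>auto simp: creat_def annih_def\<close>)
  thus ?thesis by (auto simp: anti_def fun_eq_iff fun_ops)
qed

text \<open>The canonical anticommutator. The projection \<open>maya_part\<close> on the right
  disappears as soon as a creator acts after it, by \<open>creat_maya_part\<close>.\<close>

lemma creat_annih_same: "creat x (annih x g) + annih x (creat x g) = maya_part g"
proof
  fix S
  have 1: "fsign x S * (fsign x S * z) = (if maya S then z else 0)" for z
    using fsign_sq[of x S] by (simp flip: mult.assoc)
  show "(creat x (annih x g) + annih x (creat x g)) S = maya_part g S"
    by (cases "x \<in> S") (auto simp: creat_def annih_def maya_part_def fsign_remove fsign_insert insert_absorb 1 fun_ops)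
qed

lemma creat_maya_part: "creat x (maya_part g) = creat x g"
  by (auto simp: creat_def maya_part_def fun_eq_iff fsign_def)

text \<open>The two factors that turn \<open>h\<^sub>k = - \<Sum> a + c = k + 1. \<psi>\<^sub>a \<chi>\<^sub>c\<close> into the same shape
  \<open>\<Sum> a. P a (B (i - a))\<close> as \<open>e\<^sub>i\<close> and \<open>f\<^sub>j\<close>, with either creator in front.\<close>

definition central :: "int \<Rightarrow> int \<Rightarrow> (int set \<Rightarrow> complex) \<Rightarrow> int set \<Rightarrow> complex" where
  "central C b g = (if 0 \<le> b \<and> b < C then - creat (3 * (b + 1) + 2) g else 0)"

definition central' :: "int \<Rightarrow> int \<Rightarrow> (int set \<Rightarrow> complex) \<Rightarrow> int set \<Rightarrow> complex" where
  "central' A b g = (if 0 \<le> b \<and> b < A then creat (3 * (b + 1) + 1) g else 0)"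

text \<open>\<open>A\<close> and \<open>C\<close> truncate the creating fermions. The truncation is compatible with all relations and
  makes the operators of \<open>g(M, N)\<close> vanish on suitable coefficients.\<close>

fun rep :: "int \<Rightarrow> int \<Rightarrow> gen \<Rightarrow> (int set \<Rightarrow> complex) \<Rightarrow> int set \<Rightarrow> complex" where
  "rep A C (E i) g = (\<Sum>a=1..A. creat (3 * a + 1) (creat (3 * (i - a)) g))"
| "rep A C (F j) g = (\<Sum>c=1..C. creat (3 * c + 2) (annih (3 * (- 1 - (j - c))) g))"
| "rep A C (Hh k) g = (\<Sum>a=1..A. creat (3 * a + 1) (central C (k - a) g))"

lemma lin_uminus: "lin P \<Longrightarrow> lin (\<lambda>g. - P g)"
  by (auto simp: lin_def)

lemma lin_central: "lin (central C b)" "lin (central' A b)"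
  unfolding central_def[abs_def] central'_def[abs_def]
  using lin_uminus[OF lin_creat] lin_creat by (auto simp: lin_def)

lemma lin_rep: "lin (rep A C x)"
  by (cases x) (auto simp: rep.simps[abs_def] intro!: lin_sumI lin_comp[OF lin_creat] lin_creat lin_annih lin_central)

lemma anti_central:
  assumes "anti P (creat (3 * (b + 1) + 2))" "lin P" shows "anti P (central C b)"
  using assms by (auto simp: anti_def central_def lin_zero lin_neg)

lemma anti_central':
  assumes "anti P (creat (3 * (b + 1) + 1))" "lin P" shows "anti P (central' A b)"
  using assms by (auto simp: anti_def central'_def lin_zero)

lemma sum_int_delta: "(\<Sum>c=1..C. if c = x then f c else 0) = (if 1 \<le> x \<and> x \<le> C then f x else 0)"
  for x C :: int and f :: "int \<Rightarrow> 'a::comm_monoid_add"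
  by (simp add: sum.delta)

section \<open>Bracket relations and quadratic relations in the representation\<close>

lemma rep_Hh_sum: "rep A C (Hh k) g =
  (\<Sum>a=1..A. \<Sum>c=1..C. if c = k - a + 1 then - creat (3 * a + 1) (creat (3 * c + 2) g) else 0)"
  unfolding sum_int_delta
  by (auto simp: central_def lin_zero[OF lin_creat] lin_neg[OF lin_creat] intro!: sum.cong)

lemma rep_Hh': "rep A C (Hh k) g = (\<Sum>c=1..C. creat (3 * c + 2) (central' A (k - c) g))"
proof -
  let ?t = "\<lambda>a c. - creat (3 * a + 1) (creat (3 * c + 2) g)"
  have "rep A C (Hh k) g = (\<Sum>c=1..C. \<Sum>a=1..A. if c = k - a + 1 then ?t a c else 0)"
    unfolding rep_Hh_sum by (rule sum.swap)
  also have "\<dots> = (\<Sum>c=1..C. \<Sum>a=1..A. if a = k - c + 1 then ?t a c else 0)"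
    by (intro sum.cong) auto
  also have "\<dots> = (\<Sum>c=1..C. creat (3 * c + 2) (central' A (k - c) g))"
    unfolding sum_int_delta
    by (auto simp: central'_def lin_zero[OF lin_creat] antiD[OF anti_creat_creat, of "3 * _ + 2"] intro!: sum.cong)
  finally show ?thesis .
qed

lemma pair_commute:
  assumes "anti P1 Q1" "anti P1 Q2" "anti P2 Q1" "anti P2 Q2" "lin P1" "lin P2" "lin Q1" "lin Q2"
  shows "P1 (P2 (Q1 (Q2 g))) = Q1 (Q2 (P1 (P2 g)))"
  by (simp add: antiD[OF assms(1)] antiD[OF assms(2)] antiD[OF assms(3)] antiD[OF assms(4)]
      lin_neg[OF assms(5)] lin_neg[OF assms(7)])

lemma sum_pair_commute:
  assumes "\<And>a b. anti (P1 a) (Q1 b)" "\<And>a b. anti (P1 a) (Q2 b)" "\<And>a b. anti (P2 a) (Q1 b)" "\<And>a b. anti (P2 a) (Q2 b)"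
    "\<And>a. lin (P1 a)" "\<And>a. lin (P2 a)" "\<And>a. lin (Q1 a)" "\<And>a. lin (Q2 a)"
  shows "(\<Sum>a\<in>I. P1 a (P2 a (\<Sum>b\<in>J. Q1 b (Q2 b g)))) = (\<Sum>b\<in>J. Q1 b (Q2 b (\<Sum>a\<in>I. P1 a (P2 a g))))"
proof -
  have "(\<Sum>a\<in>I. P1 a (P2 a (\<Sum>b\<in>J. Q1 b (Q2 b g)))) = (\<Sum>a\<in>I. \<Sum>b\<in>J. P1 a (P2 a (Q1 b (Q2 b g))))"
    by (simp add: lin_sum assms)
  also have "\<dots> = (\<Sum>a\<in>I. \<Sum>b\<in>J. Q1 b (Q2 b (P1 a (P2 a g))))"
    by (intro sum.cong refl pair_commute assms)
  also have "\<dots> = (\<Sum>b\<in>J. \<Sum>a\<in>I. Q1 b (Q2 b (P1 a (P2 a g))))" by (rule sum.swap)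
  finally show ?thesis by (simp add: lin_sum assms)
qed

lemma label_neq: "3 * a + 1 \<noteq> 3 * (b::int)" "3 * a + 2 \<noteq> 3 * (b::int)" "3 * b \<noteq> 3 * a + 1" "3 * b \<noteq> 3 * a + 2"
  by presburger+

lemmas anti_labels = anti_creat_creat anti_annih_annih anti_creat_annih[OF label_neq(1)] anti_creat_annih[OF label_neq(2)]
  anti_sym[OF anti_creat_annih[OF label_neq(1)]] anti_sym[OF anti_creat_annih[OF label_neq(2)]]

lemmas anti_rules = anti_labels anti_central[OF _ lin_creat] anti_central[OF _ lin_annih] anti_central[OF _ lin_central(1)]
  anti_sym[OF anti_central[OF _ lin_creat]] anti_sym[OF anti_central[OF _ lin_annih]]

text \<open>All fermions involved anticommute except the \<phi>-creator of mode \<open>i - a\<close>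
  and the annihilator of mode \<open>- 1 - (j - c)\<close>. They pair when these modes agree, that
  is for \<open>a + c = i + j + 1\<close>, and what is left is the term of \<open>h\<close> at mode
  \<open>i + j\<close>.\<close>

lemma rep_EF: "rep A C (E i) (rep A C (F j) g) - rep A C (F j) (rep A C (E i) g) = rep A C (Hh (i + j)) g"
proof -
  have t: "creat (3 * a + 1) (creat (3 * b) (creat (3 * c + 2) (annih (3 * d) g)))
      - creat (3 * c + 2) (annih (3 * d) (creat (3 * a + 1) (creat (3 * b) g)))
      = (if d = b then - creat (3 * a + 1) (creat (3 * c + 2) g) else 0)" for a b c d
  proof -
    have "creat (3 * c + 2) (annih (3 * d) (creat (3 * a + 1) (creat (3 * b) g)))
        = creat (3 * a + 1) (creat (3 * c + 2) (annih (3 * d) (creat (3 * b) g)))"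
      by (simp add: antiD[OF anti_sym[OF anti_creat_annih[OF label_neq(1)]]] lin_neg[OF lin_creat]
          antiD[OF anti_creat_creat, of "3 * c + 2"])
    moreover have "creat (3 * b) (creat (3 * c + 2) (annih (3 * d) g)) = - creat (3 * c + 2) (creat (3 * b) (annih (3 * d) g))"
      by (rule antiD[OF anti_creat_creat])
    ultimately have "creat (3 * a + 1) (creat (3 * b) (creat (3 * c + 2) (annih (3 * d) g)))
      - creat (3 * c + 2) (annih (3 * d) (creat (3 * a + 1) (creat (3 * b) g)))
      = - creat (3 * a + 1) (creat (3 * c + 2) (creat (3 * b) (annih (3 * d) g) + annih (3 * d) (creat (3 * b) g)))"
      by (simp add: lin_neg[OF lin_creat] linD(1)[OF lin_creat])
    moreover have "creat (3 * b) (annih (3 * d) g) + annih (3 * d) (creat (3 * b) g) = (if d = b then maya_part g else 0)"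
      using creat_annih_same[of "3 * b" g] antiD[OF anti_creat_annih[of "3 * b" "3 * d"], of g] by auto
    ultimately show ?thesis by (auto simp: creat_maya_part lin_zero[OF lin_creat])
  qed
  have "rep A C (E i) (rep A C (F j) g) - rep A C (F j) (rep A C (E i) g) =
    (\<Sum>a=1..A. \<Sum>c=1..C. creat (3 * a + 1) (creat (3 * (i - a)) (creat (3 * c + 2) (annih (3 * (- 1 - (j - c))) g)))
      - creat (3 * c + 2) (annih (3 * (- 1 - (j - c))) (creat (3 * a + 1) (creat (3 * (i - a)) g))))"
    using sum.swap[of "\<lambda>a c. creat (3 * c + 2) (annih (3 * (- 1 - (j - c))) (creat (3 * a + 1) (creat (3 * (i - a)) g)))"
        "{1..C}" "{1..A}"]
    by (simp add: lin_sum[OF lin_creat] lin_sum[OF lin_annih] sum_subtractf)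
  also have "\<dots> = (\<Sum>a=1..A. \<Sum>c=1..C. if c = i + j - a + 1 then - creat (3 * a + 1) (creat (3 * c + 2) g) else 0)"
    unfolding t by (intro sum.cong refl) auto
  also have "\<dots> = rep A C (Hh (i + j)) g" by (rule rep_Hh_sum[symmetric])
  finally show ?thesis .
qed

lemma rep_commute:
  "rep A C (E i) (rep A C (E j) g) = rep A C (E j) (rep A C (E i) g)"
  "rep A C (E i) (rep A C (Hh j) g) = rep A C (Hh j) (rep A C (E i) g)"
  "rep A C (Hh i) (rep A C (Hh j) g) = rep A C (Hh j) (rep A C (Hh i) g)"
  "rep A C (F i) (rep A C (F j) g) = rep A C (F j) (rep A C (F i) g)"
  "rep A C (F i) (rep A C (Hh j) g) = rep A C (Hh j) (rep A C (F i) g)"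
  unfolding rep.simps by (rule sum_pair_commute; intro anti_rules lin_creat lin_annih lin_central)+

text \<open>\<open>X(z) = P(z) B(z)\<close> and \<open>Y(z) = P(z) B'(z)\<close>, so \<open>X(z) Y(z)\<close> contains \<open>P(z)\<^sup>2 = 0\<close>.\<close>

lemma quad_zero:
  fixes P :: "int \<Rightarrow> (int set \<Rightarrow> complex) \<Rightarrow> int set \<Rightarrow> complex"
  assumes lin: "\<And>a. lin (P a)" "\<And>b. lin (B b)" "\<And>b. lin (B' b)"
    and anti: "\<And>a a'. anti (P a) (P a')" "\<And>a b. anti (P a) (B b)" "\<And>a b. anti (P a) (B' b)"
      "\<And>b b'. anti (B b) (B' b')"
    and fin: "\<And>S k. finite {b. (\<exists>h. B b h S \<noteq> 0) \<and> (\<exists>h. B' (k - b) h S \<noteq> 0)}"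
    and X: "\<And>i g. X i g = (\<Sum>a=1..A. P a (B (i - a) g))"
    and Y: "\<And>i g. Y i g = (\<Sum>a=1..A. P a (B' (i - a) g))"
    and T: "finite T" "\<And>i. i \<notin> T \<Longrightarrow> X i (Y (k - i) g) = 0"
  shows "(\<Sum>i\<in>T. X i (Y (k - i) g)) = 0"
proof
  fix S
  \<comment> \<open>\<open>b\<close> is the mode of the second factor of \<open>X\<close>. In the
    variables \<open>a\<close>, \<open>a'\<close>, \<open>b\<close> the term is antisymmetric in
    \<open>a\<close> and \<open>a'\<close>.\<close>
  define t where "t a a' b = P a (P a' (B b (B' (k - a - a' - b) g))) S" for a a' b
  define D where "D a a' = {b. t a a' b \<noteq> 0}" for a a'
  have XY: "X i (Y (k - i) g) S = - (\<Sum>a=1..A. \<Sum>a'=1..A. t a a' (i - a))" for i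
  proof -
    have "P a (B (i - a) (P a' (B' (k - i - a') g))) = - P a (P a' (B (i - a) (B' (k - i - a') g)))" for a a'
      by (simp add: antiD[OF anti_sym[OF anti(2)]] lin_neg[OF lin(1)])
    hence "X i (Y (k - i) g) = (\<Sum>a=1..A. \<Sum>a'=1..A. - P a (P a' (B (i - a) (B' (k - i - a') g))))"
      by (simp add: X Y lin_sum lin)
    moreover have "k - a - a' - (i - a) = k - i - a'" for a a' by simp
    ultimately show ?thesis unfolding t_def by (simp only: sum_fun_apply fun_ops sum_negf)
  qed
  \<comment> \<open>Each of the two second factors can be moved to the outside up to sign, so a
    nonzero term requires both to act nontrivially at \<open>S\<close>.\<close>
  have finD: "finite (D a a')" for a a'
  proof (rule finite_subset[OF _ fin[of S "k - a - a'"]])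
    show "D a a' \<subseteq> {b. (\<exists>h. B b h S \<noteq> 0) \<and> (\<exists>h. B' (k - a - a' - b) h S \<noteq> 0)}"
    proof safe
      fix b assume "b \<in> D a a'"
      hence nz: "t a a' b \<noteq> 0" by (simp add: D_def)
      have "t a a' b = B b (P a (P a' (B' (k - a - a' - b) g))) S"
        by (simp add: t_def antiD[OF anti(2)] lin_neg lin)
      thus "\<exists>h. B b h S \<noteq> 0" using nz by auto
      have "t a a' b = - B' (k - a - a' - b) (P a (P a' (B b g))) S"
        by (simp add: t_def antiD[OF anti(4)] antiD[OF anti(3)] lin_neg lin fun_ops)
      thus "\<exists>h. B' (k - a - a' - b) h S \<noteq> 0" using nz by auto
    qed
  qed
  \<comment> \<open>The substitution \<open>i = b + a\<close> depends on \<open>a\<close>.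
    \<open>U\<close> holds the relevant \<open>b\<close> of all pairs and \<open>T'\<close> all
    translates of \<open>U\<close>, so one index set works for every \<open>a\<close>; the terms
    added to \<open>T\<close> vanish by hypothesis.\<close>
  define U where "U = (\<Union>a\<in>{1..A}. \<Union>a'\<in>{1..A}. D a a')"
  have U: "finite U" by (simp add: U_def finD)
  define T' where "T' = T \<union> (\<Union>a\<in>{1..A}. (\<lambda>b. b + a) ` U)"
  have T': "finite T'" "T \<subseteq> T'" using T U by (auto simp: T'_def)
  have shift: "(\<Sum>i\<in>T'. t a a' (i - a)) = (\<Sum>b\<in>U. t a a' b)" if "a \<in> {1..A}" "a' \<in> {1..A}" for a a'
  proof -
    have "(\<Sum>b\<in>U. t a a' b) = (\<Sum>i\<in>(\<lambda>b. b + a) ` U. t a a' (i - a))"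
      by (subst sum.reindex) (auto simp: inj_on_def)
    also have "\<dots> = (\<Sum>i\<in>T'. t a a' (i - a))"
    proof (rule sum.mono_neutral_left)
      show "(\<lambda>b. b + a) ` U \<subseteq> T'" using that by (auto simp: T'_def)
      show "\<forall>i\<in>T' - (\<lambda>b. b + a) ` U. t a a' (i - a) = 0"
      proof (intro ballI, rule ccontr)
        fix i assume i: "i \<in> T' - (\<lambda>b. b + a) ` U" "t a a' (i - a) \<noteq> 0"
        hence "i - a \<in> U" using that by (auto simp: U_def D_def)
        hence "(i - a) + a \<in> (\<lambda>b. b + a) ` U" by blast
        thus False using i by simp
      qed
    qed (fact T'(1))
    finally show ?thesis by simp
  qed
  define Z where "Z = (\<Sum>a=1..A. \<Sum>a'=1..A. \<Sum>b\<in>U. t a a' b)"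
  have tsw: "t a a' b = - t a' a b" for a a' b
  proof -
    have e: "k - a - a' - b = k - a' - a - b" by simp
    show ?thesis unfolding t_def e by (subst antiD[OF anti(1)]) (simp add: fun_ops)
  qed
  have "Z = (\<Sum>a=1..A. \<Sum>a'=1..A. \<Sum>b\<in>U. - t a' a b)" unfolding Z_def by (intro sum.cong refl tsw)
  also have "\<dots> = - (\<Sum>a=1..A. \<Sum>a'=1..A. \<Sum>b\<in>U. t a' a b)" by (simp add: sum_negf)
  also have "\<dots> = - Z" unfolding Z_def by (subst sum.swap) simp
  finally have Z: "Z = 0" by simp
  have "(\<Sum>i\<in>T. X i (Y (k - i) g)) S = (\<Sum>i\<in>T. X i (Y (k - i) g) S)" by (rule sum_fun_apply)
  also have "\<dots> = (\<Sum>i\<in>T'. X i (Y (k - i) g) S)"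
    using T T' by (intro sum.mono_neutral_left) (auto simp: fun_ops)
  also have "\<dots> = - (\<Sum>a=1..A. \<Sum>a'=1..A. \<Sum>i\<in>T'. t a a' (i - a))"
  proof -
    have "(\<Sum>i\<in>T'. \<Sum>a=1..A. \<Sum>a'=1..A. t a a' (i - a)) = (\<Sum>a=1..A. \<Sum>i\<in>T'. \<Sum>a'=1..A. t a a' (i - a))"
      by (rule sum.swap)
    also have "\<dots> = (\<Sum>a=1..A. \<Sum>a'=1..A. \<Sum>i\<in>T'. t a a' (i - a))"
      by (intro sum.cong refl sum.swap)
    finally show ?thesis by (simp add: XY sum_negf)
  qed
  also have "\<dots> = - Z" by (simp add: Z_def shift)
  finally show "(\<Sum>i\<in>T. X i (Y (k - i) g)) S = 0 S" by (simp add: Z fun_ops)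
qed

text \<open>Both modes must be occupied in \<open>S\<close>; they are bounded above and have the
  fixed sum \<open>k\<close>. In \<open>fin_annih\<close> both must be empty, and the filled sea
  bounds them below.\<close>

lemma fin_creat: "finite {b. (\<exists>h. creat (3 * b) h S \<noteq> 0) \<and> (\<exists>h. creat (3 * (k - b)) h S \<noteq> 0)}"
proof (cases "maya S")
  case True
  then obtain L where L: "\<forall>x\<in>S. x \<le> L" by (auto simp: maya_def)
  have "{b. (\<exists>h. creat (3 * b) h S \<noteq> 0) \<and> (\<exists>h. creat (3 * (k - b)) h S \<noteq> 0)} \<subseteq> {- \<bar>L\<bar> - \<bar>k\<bar>..\<bar>L\<bar>}"
  proof safe
    fix b h h' assume "creat (3 * b) h S \<noteq> 0" "creat (3 * (k - b)) h' S \<noteq> 0"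
    hence "3 * b \<in> S" "3 * (k - b) \<in> S" by (auto simp: creat_def split: if_splits)
    thus "b \<in> {- \<bar>L\<bar> - \<bar>k\<bar>..\<bar>L\<bar>}" using L by force
  qed
  thus ?thesis using finite_subset by blast
qed (simp add: creat_def fsign_def)

lemma fin_annih: "finite {b. (\<exists>h. annih (3 * (- 1 - b)) h S \<noteq> 0) \<and> (\<exists>h. annih (3 * (- 1 - (k - b))) h S \<noteq> 0)}"
proof (cases "maya S")
  case True
  then obtain L where L: "\<forall>b. b \<le> - L \<longrightarrow> 3 * b \<in> S" by (auto simp: maya_def)
  have "{b. (\<exists>h. annih (3 * (- 1 - b)) h S \<noteq> 0) \<and> (\<exists>h. annih (3 * (- 1 - (k - b))) h S \<noteq> 0)} \<subseteq> {k - \<bar>L\<bar>..\<bar>L\<bar>}"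
  proof safe
    fix b h h' assume "annih (3 * (- 1 - b)) h S \<noteq> 0" "annih (3 * (- 1 - (k - b))) h' S \<noteq> 0"
    hence "3 * (- 1 - b) \<notin> S" "3 * (- 1 - (k - b)) \<notin> S" by (auto simp: annih_def split: if_splits)
    hence "\<not> (- 1 - b \<le> - L)" "\<not> (- 1 - (k - b) \<le> - L)" using L by blast+
    thus "b \<in> {k - \<bar>L\<bar>..\<bar>L\<bar>}" by auto
  qed
  thus ?thesis using finite_subset by blast
qed (simp add: annih_def fsign_def)

lemma fin_central:
  "finite {b. Q b \<and> (\<exists>h. central C (k - b) h S \<noteq> 0)}"
  "finite {b. Q b \<and> (\<exists>h. central' A (k - b) h S \<noteq> 0)}"
proof -
  have "{b. Q b \<and> (\<exists>h. central C (k - b) h S \<noteq> 0)} \<subseteq> {k - C..k}"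
    by (auto simp: central_def fun_ops split: if_splits)
  thus "finite {b. Q b \<and> (\<exists>h. central C (k - b) h S \<noteq> 0)}" using finite_subset by blast
  have "{b. Q b \<and> (\<exists>h. central' A (k - b) h S \<noteq> 0)} \<subseteq> {k - A..k}"
    by (auto simp: central'_def fun_ops split: if_splits)
  thus "finite {b. Q b \<and> (\<exists>h. central' A (k - b) h S \<noteq> 0)}" using finite_subset by blast
qed

text \<open>The pairs \<open>ee\<close>, \<open>eh\<close> and \<open>hh\<close> share the fermion
  \<psi>, the pairs \<open>ff\<close> and \<open>fh\<close> share \<chi>; for \<open>fh\<close> the
  current \<open>h\<close> is therefore taken with \<chi> in front, as in
  \<open>rep_Hh'\<close>.\<close>

lemma rep_quad:
  assumes XY: "(X, Y) \<in> rel_pairs" and T: "finite T" "\<And>i. i \<notin> T \<Longrightarrow> rep A C (X i) (rep A C (Y (k - i)) g) = 0"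
  shows "(\<Sum>i\<in>T. rep A C (X i) (rep A C (Y (k - i)) g)) = 0"
proof -
  note r = lin_creat lin_annih lin_central anti_rules anti_central'[OF _ lin_creat] anti_central'[OF _ lin_annih]
    fin_creat fin_annih fin_central
  consider "X = E" "Y = E" | "X = F" "Y = F" | "X = E" "Y = Hh" | "X = F" "Y = Hh" | "X = Hh" "Y = Hh"
    using XY by (auto simp: rel_pairs_def)
  thus ?thesis
  proof cases
    case 1
    show ?thesis
    proof (rule quad_zero[where X = "\<lambda>i. rep A C (X i)" and Y = "\<lambda>i. rep A C (Y i)" and P = "\<lambda>a. creat (3 * a + 1)"
          and B = "\<lambda>b. creat (3 * b)" and B' = "\<lambda>b. creat (3 * b)" and A = A])
      show "rep A C (X i) (rep A C (Y (k - i)) g) = 0" if "i \<notin> T" for i by (rule T(2)[OF that])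
    qed (simp_all only: 1 r T(1) rep.simps(1,2) rep.simps(3))
  next
    case 2
    show ?thesis
    proof (rule quad_zero[where X = "\<lambda>i. rep A C (X i)" and Y = "\<lambda>i. rep A C (Y i)" and P = "\<lambda>a. creat (3 * a + 2)"
          and B = "\<lambda>b. annih (3 * (- 1 - b))" and B' = "\<lambda>b. annih (3 * (- 1 - b))" and A = C])
      show "rep A C (X i) (rep A C (Y (k - i)) g) = 0" if "i \<notin> T" for i by (rule T(2)[OF that])
    qed (simp_all only: 2 r T(1) rep.simps(1,2) rep.simps(3))
  next
    case 3
    show ?thesis
    proof (rule quad_zero[where X = "\<lambda>i. rep A C (X i)" and Y = "\<lambda>i. rep A C (Y i)" and P = "\<lambda>a. creat (3 * a + 1)"
          and B = "\<lambda>b. creat (3 * b)" and B' = "central C" and A = A])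
      show "rep A C (X i) (rep A C (Y (k - i)) g) = 0" if "i \<notin> T" for i by (rule T(2)[OF that])
    qed (simp_all only: 3 r T(1) rep.simps(1,2) rep.simps(3))
  next
    case 4
    show ?thesis
    proof (rule quad_zero[where X = "\<lambda>i. rep A C (X i)" and Y = "\<lambda>i. rep A C (Y i)" and P = "\<lambda>a. creat (3 * a + 2)"
          and B = "\<lambda>b. annih (3 * (- 1 - b))" and B' = "central' A" and A = C])
      show "rep A C (X i) (rep A C (Y (k - i)) g) = 0" if "i \<notin> T" for i by (rule T(2)[OF that])
    qed (simp_all only: 4 r T(1) rep.simps(1,2) rep_Hh')
  next
    case 5
    show ?thesis
    proof (rule quad_zero[where X = "\<lambda>i. rep A C (X i)" and Y = "\<lambda>i. rep A C (Y i)" and P = "\<lambda>a. creat (3 * a + 1)"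
          and B = "central C" and B' = "central C" and A = A])
      show "rep A C (X i) (rep A C (Y (k - i)) g) = 0" if "i \<notin> T" for i by (rule T(2)[OF that])
    qed (simp_all only: 5 r T(1) rep.simps(1,2) rep.simps(3))
  qed
qed

section \<open>Matrix coefficients of the action on the vacuum\<close>

definition core :: "int \<Rightarrow> int set" where
  "core p = (\<lambda>b. 3 * b) ` {..<p}"

definition target :: "int set \<Rightarrow> int \<Rightarrow> int set \<Rightarrow> int set" where
  "target As p Cs = (\<lambda>a. 3 * a + 1) ` As \<union> core p \<union> (\<lambda>c. 3 * c + 2) ` Cs"

definition vac :: "int set \<Rightarrow> complex" where
  "vac S = (if S = core 0 then 1 else 0)"

definition repw :: "int \<Rightarrow> int \<Rightarrow> word \<Rightarrow> (int set \<Rightarrow> complex) \<Rightarrow> int set \<Rightarrow> complex" where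
  "repw A C w g = foldr (rep A C) w g"

lemma repw_simps [simp]: "repw A C [] g = g" "repw A C (x # w) g = rep A C x (repw A C w g)"
  "repw A C (u @ w) g = repw A C u (repw A C w g)"
  by (auto simp: repw_def)

lemma lin_repw: "lin (repw A C w)"
proof (induction w)
  case Nil
  show ?case by (simp add: lin_def)
next
  case (Cons x w)
  thus ?case using lin_comp[OF lin_rep Cons] by (simp add: lin_def)
qed

lemma core_iff [simp]: "3 * b \<in> core p \<longleftrightarrow> b < p"
  by (auto simp: core_def)

text \<open>Since \<open>a\<close> and \<open>c\<close> are at least 1, a nonpositive mode of
  \<open>e\<close> creates a negative mode of \<phi>, already occupied in the vacuum. The offset -1
  in the definition for \<open>f\<close> makes the annihilated mode nonnegative, hence empty. The
  same offset produces the condition \<open>a + c = k + 1\<close> for \<open>h_k\<close>, which has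
  no solution for \<open>k <= 0\<close>.\<close>

lemma rep_vac: "mode x \<le> 0 \<Longrightarrow> rep A C x vac = 0"
proof -
  assume m: "mode x \<le> 0"
  have 1: "creat (3 * b) vac = 0" if "b < 0" for b
  proof
    fix S
    have "S - {3 * b} \<noteq> core 0" using core_iff[of b 0] that by blast
    thus "creat (3 * b) vac S = 0 S" by (simp add: creat_def vac_def fun_ops)
  qed
  have 2: "annih (3 * b) vac = 0" if "b \<ge> 0" for b
  proof
    fix S
    have "insert (3 * b) S \<noteq> core 0" using core_iff[of b 0] that by force
    thus "annih (3 * b) vac S = 0 S" by (simp add: annih_def vac_def fun_ops)
  qed
  show ?thesis
  proof (cases x)
    case (E i)
    show ?thesis unfolding E rep.simps
    proof (intro sum.neutral ballI)
      fix a assume "a \<in> {1..A}"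
      thus "creat (3 * a + 1) (creat (3 * (i - a)) vac) = 0"
        using m E by (subst 1) (auto simp: lin_zero[OF lin_creat])
    qed
  next
    case (F j)
    show ?thesis unfolding F rep.simps
    proof (intro sum.neutral ballI)
      fix c assume "c \<in> {1..C}"
      thus "creat (3 * c + 2) (annih (3 * (- 1 - (j - c))) vac) = 0"
        using m F by (subst 2) (auto simp: lin_zero[OF lin_creat])
    qed
  next
    case (Hh k)
    thus ?thesis using m by (auto simp: central_def lin_zero[OF lin_creat])
  qed
qed

text \<open>The value at \<open>S\<close> is the matrix coefficient that serves as a functional on
  the tensor algebra. A sum over an infinite set is 0 by convention, so linearity is proved for
  finitely supported functions; hence the condition \<open>fin_supp\<close> in
  \<open>rep_ker\<close>.\<close>

definition Phi :: "int \<Rightarrow> int \<Rightarrow> vec \<Rightarrow> int set \<Rightarrow> complex" where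
  "Phi A C f = (\<Sum>w\<in>{w. f w \<noteq> 0}. fscale (f w) (repw A C w vac))"

lemma Phi_superset:
  assumes "finite W" "{w. f w \<noteq> 0} \<subseteq> W"
  shows "Phi A C f = (\<Sum>w\<in>W. fscale (f w) (repw A C w vac))"
  unfolding Phi_def using assms by (intro sum.mono_neutral_left) auto

lemma fin_supp_add: "fin_supp f \<Longrightarrow> fin_supp g \<Longrightarrow> fin_supp (f + g)"
  unfolding fin_supp_def
  by (rule finite_subset[of _ "{x. f x \<noteq> 0} \<union> {x. g x \<noteq> 0}"]) (auto simp: fun_ops)

lemma fin_supp_scale: "fin_supp f \<Longrightarrow> fin_supp (fscale c f)"
  unfolding fin_supp_def fscale_def by (rule finite_subset[of _ "{x. f x \<noteq> 0}"]) auto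

lemma fin_supp_zero: "fin_supp 0" by (simp add: fin_supp_def fun_ops)

lemma fin_supp_wvec: "fin_supp (wvec w)" by (simp add: fin_supp_def wvec_def)

lemma Phi_add:
  assumes "fin_supp f" "fin_supp g" shows "Phi A C (f + g) = Phi A C f + Phi A C g"
proof -
  let ?W = "{x. f x \<noteq> 0} \<union> {x. g x \<noteq> 0}"
  have W: "finite ?W" using assms by (simp add: fin_supp_def)
  show ?thesis
    by (subst (1 2 3) Phi_superset[OF W]) (auto simp: fun_ops vs.scale_left_distrib sum.distrib)
qed

lemma Phi_scale:
  assumes "fin_supp f" shows "Phi A C (fscale c f) = fscale c (Phi A C f)"
proof -
  let ?W = "{x. f x \<noteq> 0}"
  have W: "finite ?W" using assms by (simp add: fin_supp_def)
  have "Phi A C (fscale c f) = (\<Sum>w\<in>?W. fscale (fscale c f w) (repw A C w vac))"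
    by (rule Phi_superset[OF W]) (auto simp: fscale_def)
  also have "\<dots> = fscale c (Phi A C f)"
    unfolding Phi_def vs.scale_sum_right by (intro sum.cong) (auto simp: fscale_def)
  finally show ?thesis .
qed

lemma Phi_zero: "Phi A C 0 = 0" by (simp add: Phi_def fun_ops)

lemma Phi_wvec: "Phi A C (wvec w) = repw A C w vac"
proof -
  have "{x. wvec w x \<noteq> 0} = {w}" by (auto simp: wvec_def)
  thus ?thesis by (simp add: Phi_def) (simp add: wvec_def)
qed

lemma Phi_diff:
  assumes "fin_supp f" "fin_supp g"
  shows "Phi A C (f - g) = Phi A C f - Phi A C g" "fin_supp (f - g)"
proof -
  have eq: "f - g = f + fscale (-1) g" by simp
  show "fin_supp (f - g)" unfolding eq by (intro fin_supp_add fin_supp_scale assms)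
  have "Phi A C (f - g) = Phi A C f + Phi A C (fscale (-1) g)"
    unfolding eq by (intro Phi_add fin_supp_scale assms)
  from this[unfolded Phi_scale[OF assms(2)]] show "Phi A C (f - g) = Phi A C f - Phi A C g" by simp
qed

lemma Phi_sum:
  assumes "\<And>i. i \<in> I \<Longrightarrow> fin_supp (f i)"
  shows "Phi A C (\<Sum>i\<in>I. f i) = (\<Sum>i\<in>I. Phi A C (f i)) \<and> fin_supp (\<Sum>i\<in>I. f i)"
  using assms
  by (induction I rule: infinite_finite_induct)
     (auto simp: Phi_zero fin_supp_zero Phi_add fin_supp_add)

lemma Phi_mult:
  assumes "fin_supp f"
  shows "Phi A C (vmul (wvec u) f) = repw A C u (Phi A C f)" "fin_supp (vmul (wvec u) f)"
proof -
  let ?W = "{w. f w \<noteq> 0}"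
  have W: "finite ?W" using assms by (simp add: fin_supp_def)
  have f: "f = (\<Sum>w\<in>?W. fscale (f w) (wvec w))"
  proof
    fix x
    have "(\<Sum>w\<in>?W. fscale (f w) (wvec w)) x = (\<Sum>w\<in>?W. if x = w then f w else 0)"
      by (auto simp: sum_fun_apply fscale_def wvec_def intro!: sum.cong)
    thus "f x = (\<Sum>w\<in>?W. fscale (f w) (wvec w)) x" using W by (simp add: sum.delta)
  qed
  have eq: "vmul (wvec u) f = (\<Sum>w\<in>?W. fscale (f w) (wvec (u @ w)))"
    by (subst f) (simp add: vmul_sum_right vmul_scale_right)
  have *: "Phi A C (\<Sum>w\<in>?W. fscale (f w) (wvec (u @ w))) = (\<Sum>w\<in>?W. Phi A C (fscale (f w) (wvec (u @ w))))
      \<and> fin_supp (\<Sum>w\<in>?W. fscale (f w) (wvec (u @ w)))"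
    by (rule Phi_sum) (intro fin_supp_scale fin_supp_wvec)
  thus "fin_supp (vmul (wvec u) f)" by (simp add: eq)
  show "Phi A C (vmul (wvec u) f) = repw A C u (Phi A C f)"
    using * unfolding eq Phi_def[of A C f]
    by (simp add: Phi_scale[OF fin_supp_wvec] Phi_wvec lin_sum[OF lin_repw] linD(2)[OF lin_repw])
qed

definition rep_ker :: "int \<Rightarrow> int \<Rightarrow> vec set" where
  "rep_ker A C = {f. fin_supp f \<and> Phi A C f = 0}"

lemma rep_ker_subspace: "vs.subspace (rep_ker A C)"
  unfolding rep_ker_def by (rule vs.subspaceI) (auto simp: fin_supp_zero Phi_zero Phi_add fin_supp_add Phi_scale fin_supp_scale)

lemma rep_comm:
  "repw A C u (rep A C x (rep A C y g)) - repw A C u (rep A C y (rep A C x g)) =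
    (case (x, y) of (E i, F j) \<Rightarrow> repw A C u (rep A C (Hh (i + j)) g)
      | (F j, E i) \<Rightarrow> - repw A C u (rep A C (Hh (i + j)) g) | _ \<Rightarrow> 0)"
proof -
  have 1: "rep A C (F j) (rep A C (E i) g) - rep A C (E i) (rep A C (F j) g) = - rep A C (Hh (i + j)) g" for i j
    using rep_EF[of A C i j g] by (metis minus_diff_eq)
  have "rep A C x (rep A C y g) - rep A C y (rep A C x g) =
    (case (x, y) of (E i, F j) \<Rightarrow> rep A C (Hh (i + j)) g
      | (F j, E i) \<Rightarrow> - rep A C (Hh (i + j)) g | _ \<Rightarrow> 0)"
    by (cases x; cases y) (simp_all only: rep_EF 1 rep_commute prod.case gen.case diff_self)
  from arg_cong[OF this, of "repw A C u"] show ?thesis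
    by (cases x; cases y) (simp_all only: prod.case gen.case lin_diff[OF lin_repw] lin_neg[OF lin_repw] lin_zero[OF lin_repw])
qed

lemma K0_rep_ker: "K0 \<subseteq> rep_ker A C"
proof -
  have "wvec (u @ x # y # w) - wvec (u @ y # x # w) - bracket_word u x y w \<in> rep_ker A C" for u x y w
  proof -
    have b: "fin_supp (bracket_word u x y w) \<and> Phi A C (bracket_word u x y w) =
      (case (x, y) of (E i, F j) \<Rightarrow> repw A C u (rep A C (Hh (i + j)) (repw A C w vac))
      | (F j, E i) \<Rightarrow> - repw A C u (rep A C (Hh (i + j)) (repw A C w vac)) | _ \<Rightarrow> 0)"
      using Phi_diff[OF fin_supp_zero fin_supp_wvec]
      by (cases x; cases y) (simp_all add: Phi_wvec fin_supp_wvec fin_supp_zero Phi_zero del: rep.simps)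
    have "Phi A C (wvec (u @ x # y # w) - wvec (u @ y # x # w)) =
       repw A C u (rep A C x (rep A C y (repw A C w vac))) - repw A C u (rep A C y (rep A C x (repw A C w vac)))"
      by (simp add: Phi_diff(1)[OF fin_supp_wvec fin_supp_wvec] Phi_wvec del: rep.simps)
    hence "Phi A C (wvec (u @ x # y # w) - wvec (u @ y # x # w)) = Phi A C (bracket_word u x y w)"
      using b rep_comm by simp
    thus ?thesis
      unfolding rep_ker_def using Phi_diff[OF Phi_diff(2)[OF fin_supp_wvec fin_supp_wvec] conjunct1[OF b]] by simp
  qed
  hence I: "Iideal \<subseteq> rep_ker A C"
    unfolding Iideal_eq by (intro vs.span_minimal rep_ker_subspace) auto
  have "wvec (u @ [x]) \<in> rep_ker A C" if "mode x \<le> 0" for u x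
    using rep_vac[OF that] by (simp add: rep_ker_def fin_supp_wvec Phi_wvec lin_zero[OF lin_repw])
  hence L: "Lideal \<subseteq> rep_ker A C"
    unfolding Lideal_def lspan_eq by (intro vs.span_minimal rep_ker_subspace) auto
  show ?thesis unfolding K0_def lspan_eq by (intro vs.span_minimal rep_ker_subspace) (use I L in auto)
qed

lemma coeff_rel_rep_ker: "coeff_rel \<subseteq> rep_ker A C"
proof
  fix x assume "x \<in> coeff_rel"
  then obtain X Y f k S where XY: "(X, Y) \<in> rel_pairs" and f: "fin_supp f" and S: "finite S"
    "\<And>i. i \<notin> S \<Longrightarrow> vmul (wvec [X i, Y (k - i)]) f \<in> K0"
    "vdiff x (vsum (\<lambda>_. 1) (\<lambda>i. vmul (wvec [X i, Y (k - i)]) f) S) \<in> K0"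
    unfolding coeff_rel_def by blast
  let ?s = "\<Sum>i\<in>S. vmul (wvec [X i, Y (k - i)]) f"
  have P: "Phi A C (vmul (wvec [X i, Y (k - i)]) f) = rep A C (X i) (rep A C (Y (k - i)) (Phi A C f))" for i
    by (simp add: Phi_mult(1)[OF f] del: rep.simps)
  have s: "Phi A C ?s = (\<Sum>i\<in>S. rep A C (X i) (rep A C (Y (k - i)) (Phi A C f))) \<and> fin_supp ?s"
    using Phi_sum[of S "\<lambda>i. vmul (wvec [X i, Y (k - i)]) f" A C] Phi_mult(2)[OF f] by (simp add: P)
  have "(\<Sum>i\<in>S. rep A C (X i) (rep A C (Y (k - i)) (Phi A C f))) = 0"
  \<comment> \<open>Terms outside \<open>S\<close> lie in \<open>K0\<close> and so act as zero: this
    is the finiteness that \<open>rep_quad\<close> asks for.\<close>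
  proof (rule rep_quad[OF XY S(1)])
    fix i assume "i \<notin> S"
    hence "vmul (wvec [X i, Y (k - i)]) f \<in> rep_ker A C" using S(2) K0_rep_ker by blast
    thus "rep A C (X i) (rep A C (Y (k - i)) (Phi A C f)) = 0" using P by (simp add: rep_ker_def)
  qed
  hence "?s \<in> rep_ker A C" using s by (simp add: rep_ker_def)
  moreover have "x - ?s \<in> rep_ker A C"
    using S(3) K0_rep_ker by (auto simp: vdiff_eq vsum_eq)
  ultimately show "x \<in> rep_ker A C" using vs.subspace_add[OF rep_ker_subspace] by fastforce
qed

lemma KW_rep_ker: "KW \<subseteq> rep_ker A C"
  unfolding KW_def lspan_eq
proof (intro vs.span_minimal rep_ker_subspace Un_least K0_rep_ker, safe)
  fix u x assume "x \<in> coeff_rel"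
  hence "fin_supp x" "Phi A C x = 0" using coeff_rel_rep_ker[of A C] by (auto simp: rep_ker_def)
  thus "vmul (wvec u) x \<in> rep_ker A C" by (simp add: rep_ker_def Phi_mult lin_zero[OF lin_repw])
qed

section \<open>Vanishing of coefficients on g(M, N) W\<close>

text \<open>An explicit subalgebra containing \<open>gsub M N\<close>; the bound
  \<open>M + N\<close> for \<open>h\<close> is forced by the brackets. A functional that vanishes on
  the larger space vanishes on the smaller one.\<close>

definition gbound :: "int \<Rightarrow> int \<Rightarrow> hvec set" where
  "gbound M N = {a. fin_supp a \<and> (\<forall>i<M. a (E i) = 0) \<and> (\<forall>j<N. a (F j) = 0) \<and> (\<forall>k<M + N. a (Hh k) = 0)}"

lemma hbr_gbound:
  assumes "a \<in> gbound M N" "b \<in> gbound M N"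
  shows "hbr a b \<in> gbound M N"
proof -
  let ?P = "\<lambda>a::hvec. {i. a (E i) \<noteq> 0 \<or> a (F i) \<noteq> 0}"
  have fin: "finite (?P a)" if "a \<in> gbound M N" for a
  proof -
    have "?P a \<subseteq> mode ` {x. a x \<noteq> 0}" by (auto intro: rev_image_eqI)
    thus ?thesis using that finite_subset[OF _ finite_imageI] unfolding gbound_def fin_supp_def by blast
  qed
  have key: "\<exists>i. (a (E i) \<noteq> 0 \<and> b (F (k - i)) \<noteq> 0) \<or> (a (F i) \<noteq> 0 \<and> b (E (k - i)) \<noteq> 0)" if nz: "hbr a b (Hh k) \<noteq> 0" for k
  proof (rule ccontr)
    assume "\<not> ?thesis"
    hence "hbr a b (Hh k) = 0" unfolding hbr_def by (auto intro!: sum.neutral)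
    thus False using nz by simp
  qed
  have "{x. hbr a b x \<noteq> 0} \<subseteq> (\<lambda>(i, j). Hh (i + j)) ` (?P a \<times> ?P b)"
  proof
    fix x assume x: "x \<in> {x. hbr a b x \<noteq> 0}"
    then obtain k where k: "x = Hh k" by (cases x) (auto simp: hbr_def)
    then obtain i where "i \<in> ?P a" "k - i \<in> ?P b" using key[of k] x by auto
    thus "x \<in> (\<lambda>(i, j). Hh (i + j)) ` (?P a \<times> ?P b)"
      using k by (intro rev_image_eqI[of "(i, k - i)"]) auto
  qed
  hence "fin_supp (hbr a b)"
    unfolding fin_supp_def using fin[OF assms(1)] fin[OF assms(2)] by (meson finite_SigmaI finite_imageI finite_subset)
  moreover have "hbr a b (Hh k) = 0" if "k < M + N" for k
  proof (rule ccontr)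
    assume "hbr a b (Hh k) \<noteq> 0"
    then obtain i where "(a (E i) \<noteq> 0 \<and> b (F (k - i)) \<noteq> 0) \<or> (a (F i) \<noteq> 0 \<and> b (E (k - i)) \<noteq> 0)" using key by blast
    hence "(i \<ge> M \<and> k - i \<ge> N) \<or> (i \<ge> N \<and> k - i \<ge> M)"
      using assms unfolding gbound_def by (metis (mono_tags, lifting) mem_Collect_eq not_le_imp_less)
    thus False using that by auto
  qed
  moreover have "hbr a b (E i) = 0" "hbr a b (F i) = 0" for i by (simp_all add: hbr_def)
  ultimately show ?thesis by (simp add: gbound_def)
qed

lemma gsub_gbound: "gsub M N \<subseteq> gbound M N"
proof -
  have 1: "gbound M N \<subseteq> {a. fin_supp a}" by (auto simp: gbound_def)
  have 2: "(\<lambda>x. 0) \<in> gbound M N" by (auto simp: gbound_def fin_supp_def)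
  have 3: "(\<lambda>x. a x + b x) \<in> gbound M N" if "a \<in> gbound M N" "b \<in> gbound M N" for a b
    using that fin_supp_add[of a b] by (auto simp: gbound_def plus_fun_def)
  have 4: "(\<lambda>x. c * a x) \<in> gbound M N" if "a \<in> gbound M N" for a c
    using that fin_supp_scale[of a c] by (auto simp: gbound_def fscale_def)
  have 5: "{gvec (E i) | i. i \<ge> M} \<subseteq> gbound M N" "{gvec (F j) | j. j \<ge> N} \<subseteq> gbound M N"
    by (auto simp: gbound_def gvec_def fin_supp_def)
  show ?thesis
    unfolding gsub_def by (intro Inter_lower CollectI conjI ballI allI 1 2 3 4 5 hbr_gbound)
qed

text \<open>For \<open>a <= A\<close> and \<open>i >= M\<close> the mode \<open>i - a\<close> is at
  least \<open>M - A = p\<close>, above the sea of \<open>S\<close>, so no state leads to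
  \<open>S\<close>. For \<open>c <= C\<close> and \<open>j >= N\<close> the annihilated mode is
  below \<open>p\<close>, but it is occupied in \<open>S\<close>. For \<open>h_k\<close> one gets
  \<open>k - a >= C\<close>, outside the range of \<open>central\<close>.\<close>

lemma rep_target_zero:
  assumes "A = M - p" "C = N + p" "S = target As p Cs"
  shows "i \<ge> M \<Longrightarrow> rep A C (E i) g S = 0" "j \<ge> N \<Longrightarrow> rep A C (F j) g S = 0" "k \<ge> M + N \<Longrightarrow> rep A C (Hh k) g S = 0"
proof -
  have mem: "3 * b \<in> S \<longleftrightarrow> b < p" for b using core_iff[of b p] unfolding assms target_def by (auto; presburger)
  show "rep A C (E i) g S = 0" if "i \<ge> M"
    unfolding rep.simps sum_fun_apply
  proof (rule sum.neutral, intro ballI)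
    fix a assume "a \<in> {1..A}"
    hence "3 * (i - a) \<notin> S" unfolding mem using that assms by auto
    thus "creat (3 * a + 1) (creat (3 * (i - a)) g) S = 0"
      by (subst antiD[OF anti_creat_creat]) (simp add: creat_def fun_ops)
  qed
  show "rep A C (F j) g S = 0" if "j \<ge> N"
    unfolding rep.simps sum_fun_apply
  proof (rule sum.neutral, intro ballI)
    fix c assume "c \<in> {1..C}"
    hence "3 * (- 1 - (j - c)) \<in> S" unfolding mem using that assms by auto
    thus "creat (3 * c + 2) (annih (3 * (- 1 - (j - c))) g) S = 0"
      by (subst antiD[OF anti_creat_annih[OF label_neq(2)]]) (simp add: annih_def fun_ops)
  qed
  show "rep A C (Hh k) g S = 0" if "k \<ge> M + N"
    unfolding rep.simps sum_fun_apply
  proof (rule sum.neutral, intro ballI)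
    fix a assume "a \<in> {1..A}"
    hence "central C (k - a) g = 0" using that assms by (simp add: central_def)
    thus "creat (3 * a + 1) (central C (k - a) g) S = 0" by (simp add: lin_zero[OF lin_creat] fun_ops)
  qed
qed

lemma Phi_Kfull_zero:
  assumes "A = M - p" "C = N + p" "S = target As p Cs" "M = -1 \<or> N = -1 \<Longrightarrow> S \<noteq> core 0" "f \<in> Kfull M N"
  shows "fin_supp f \<and> Phi A C f S = 0"
proof -
  let ?Z = "{f. fin_supp f \<and> Phi A C f S = 0}"
  have sub: "vs.subspace ?Z"
    by (rule vs.subspaceI)
       (auto simp: fin_supp_zero Phi_zero Phi_add fin_supp_add Phi_scale fin_supp_scale fun_ops, simp add: fscale_def)
  have 1: "KW \<subseteq> ?Z" using KW_rep_ker[of A C] by (auto simp: rep_ker_def fun_ops)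
  have 2: "vmul (emb a) (wvec u) \<in> ?Z" if "a \<in> gsub M N" for a u
  proof -
    have a: "a \<in> gbound M N" using that gsub_gbound by blast
    let ?W = "{x. a x \<noteq> 0}"
    have W: "finite ?W" using a by (simp add: gbound_def fin_supp_def)
    have eq: "vmul (emb a) (wvec u) = (\<Sum>x\<in>?W. fscale (a x) (wvec (x # u)))"
    proof
      fix w
      have "vmul (emb a) (wvec u) w = (case w of [] \<Rightarrow> 0 | x # w' \<Rightarrow> a x * wvec u w')"
      proof (cases w)
        case Nil
        thus ?thesis by (simp add: vmul_def emb_def)
      next
        case (Cons x w')
        have "vmul (emb a) (wvec u) w = (\<Sum>k\<le>length w. if k = 1 then a x * wvec u w' else 0)"
          unfolding vmul_def
        proof (rule sum.cong)
          fix k assume "k \<in> {..length w}"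
          thus "emb a (take k w) * wvec u (drop k w) = (if k = 1 then a x * wvec u w' else 0)"
            using Cons by (cases k; cases "k - 1"; cases w') (auto simp: emb_def)
        qed simp
        thus ?thesis using Cons unfolding sum.delta[OF finite_atMost] by simp
      qed
      also have "\<dots> = (\<Sum>x\<in>?W. fscale (a x) (wvec (x # u))) w"
      proof (cases w)
        case Nil
        thus ?thesis by (simp add: sum_fun_apply fscale_def wvec_def)
      next
        case (Cons x w')
        have "(\<Sum>x\<in>?W. fscale (a x) (wvec (x # u))) w = (\<Sum>y\<in>?W. if x = y then a y * wvec u w' else 0)"
          unfolding sum_fun_apply by (intro sum.cong) (auto simp: fscale_def wvec_def Cons)
        thus ?thesis using W Cons by (auto simp: sum.delta)
      qed
      finally show "vmul (emb a) (wvec u) w = (\<Sum>x\<in>?W. fscale (a x) (wvec (x # u))) w" .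
    qed
    \<comment> \<open>The letter from \<open>g(M, N)\<close> is leftmost and acts last, so its
      coefficient at the state \<open>S\<close> decides.\<close>
    have "wvec (x # u) \<in> ?Z" if "x \<in> ?W" for x
    proof -
      have "rep A C x (repw A C u vac) S = 0"
      proof (cases x)
        case (E i)
        hence "i \<ge> M" using a that unfolding gbound_def by force
        thus ?thesis unfolding E by (rule rep_target_zero[OF assms(1-3)])
      next
        case (F j)
        hence "j \<ge> N" using a that unfolding gbound_def by force
        thus ?thesis unfolding F by (rule rep_target_zero[OF assms(1-3)])
      next
        case (Hh k)
        hence "k \<ge> M + N" using a that unfolding gbound_def by force
        thus ?thesis unfolding Hh by (rule rep_target_zero[OF assms(1-3)])
      qed
      thus ?thesis by (simp add: fin_supp_wvec Phi_wvec del: rep.simps)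
    qed
    thus ?thesis unfolding eq by (intro vs.subspace_sum[OF sub] vs.subspace_scale[OF sub])
  qed
  have 3: "wvec [] \<in> ?Z" if "M = -1 \<or> N = -1" using assms(4)[OF that] by (simp add: fin_supp_wvec Phi_wvec vac_def)
  have "Kfull M N \<subseteq> ?Z"
    unfolding Kfull_def lspan_eq by (intro vs.span_minimal sub) (use 1 2 3 in auto)
  thus ?thesis using assms(5) by auto
qed

section \<open>Linear independence\<close>

lemma gap2_Nil [simp]: "gap2 []" by (simp add: gap2_def)
lemma gap2_single [simp]: "gap2 [x]" by (simp add: gap2_def)
lemma gap2_Cons2 [simp]: "gap2 (x # y # zs) \<longleftrightarrow> y + 2 \<le> x \<and> gap2 (y # zs)"
proof
  assume a: "gap2 (x # y # zs)"
  have "gap2 (y # zs)"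
    unfolding gap2_def
  proof (intro allI impI)
    fix k assume "Suc k < length (y # zs)"
    thus "(y # zs) ! Suc k + 2 \<le> (y # zs) ! k" using a[unfolded gap2_def, rule_format, of "Suc k"] by simp
  qed
  thus "y + 2 \<le> x \<and> gap2 (y # zs)" using a[unfolded gap2_def, rule_format, of 0] by simp
next
  assume a: "y + 2 \<le> x \<and> gap2 (y # zs)"
  show "gap2 (x # y # zs)"
    unfolding gap2_def
  proof (intro allI impI)
    fix k assume "Suc k < length (x # y # zs)"
    thus "(x # y # zs) ! Suc k + 2 \<le> (x # y # zs) ! k"
      using a by (cases k) (auto simp: gap2_def)
  qed
qed

lemma gap2_ConsD: "gap2 (x # xs) \<Longrightarrow> gap2 xs" by (cases xs) auto

lemma gap2_head: "gap2 (x # xs) \<Longrightarrow> (\<And>y. y \<in> set (x # xs) \<Longrightarrow> lo \<le> y) \<Longrightarrow> lo + 2 * int (length xs) \<le> x"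
proof (induction xs arbitrary: x)
  case (Cons y ys)
  have "lo + 2 * int (length ys) \<le> y" by (rule Cons.IH) (use Cons.prems in auto)
  thus ?case using Cons.prems(1) by simp
qed simp

text \<open>The labels \<open>a\<close> for which the coefficient of \<open>target (set (labels p is)) p Cs\<close> has the monomial
  with indices \<open>is\<close> as its lexicographically largest one: \<open>a\<^sub>k = i\<^sub>k - p + k\<close>.\<close>

fun labels :: "int \<Rightarrow> int list \<Rightarrow> int list" where
  "labels p [] = []"
| "labels p (i # is) = (i - p + 1) # labels (p - 1) is"

text \<open>A gap of at least two, less the step of one in the shift, makes the labels strictly
  decreasing. The last one is the last index minus \<open>p\<close> plus the length, which gives the
  bound. For the ranges of the basis the lower bound is exactly 1.\<close>

lemma labels_bounds:
  assumes "gap2 is" "\<And>i. i \<in> set is \<Longrightarrow> lo \<le> i" "a \<in> set (labels p is)"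
  shows "lo - p + int (length is) \<le> a"
  using assms
proof (induction "is" arbitrary: p)
  case (Cons i "is")
  show ?case
  proof (cases "a = i - p + 1")
    case True
    have "lo + 2 * int (length is) \<le> i" using Cons.prems by (intro gap2_head) auto
    thus ?thesis using True by simp
  next
    case False
    hence "lo - (p - 1) + int (length is) \<le> a"
      using Cons.prems by (intro Cons.IH gap2_ConsD[OF Cons.prems(1)]) auto
    thus ?thesis by simp
  qed
qed simp

lemma labels_less:
  assumes "gap2 (i # is)" "a \<in> set (labels (p - 1) is)" shows "a < i - p + 1"
  using assms
proof (induction "is" arbitrary: i p)
  case (Cons i' "is")
  show ?case
  proof (cases "a = i' - (p - 1) + 1")
    case False
    hence "a < i' - (p - 1) + 1" using Cons.prems by (intro Cons.IH) auto
    thus ?thesis using Cons.prems by simp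
  qed (use Cons.prems in auto)
qed simp

lemma labels_upper:
  assumes "gap2 is" "\<And>i. i \<in> set is \<Longrightarrow> i < hi" "a \<in> set (labels p is)"
  shows "a \<le> hi - p"
proof (cases "is")
  case (Cons i is')
  have "a \<le> i - p + 1" using labels_less[of i is' a p] assms Cons by auto
  thus ?thesis using assms(2)[of i] Cons by simp
qed (use assms in simp)

section \<open>Target states and leading monomials\<close>

lemma maya_core: "maya (core p)"
  unfolding maya_def by (rule exI[of _ "max (3 * p) (1 - p)"]) (auto simp: core_def)

lemma maya_union: "finite U \<Longrightarrow> maya (U \<union> S) = maya S"
  by (induction U rule: finite_induct) auto

lemma maya_target: "finite As \<Longrightarrow> finite Cs \<Longrightarrow> maya (target As p Cs)"
proof -
  assume "finite As" "finite Cs"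
  hence "maya (((\<lambda>a. 3 * a + 1) ` As \<union> (\<lambda>c. 3 * c + 2) ` Cs) \<union> core p)"
    by (subst maya_union) (auto simp: maya_core)
  moreover have "((\<lambda>a. 3 * a + 1) ` As \<union> (\<lambda>c. 3 * c + 2) ` Cs) \<union> core p = target As p Cs" by (auto simp: target_def)
  ultimately show ?thesis by simp
qed

lemma fsign_cases: "maya S \<Longrightarrow> fsign x S = 1 \<or> fsign x S = -1"
  unfolding fsign_def by (cases "even (card {y \<in> S. x < y})") auto

lemma target_mem:
  "3 * b \<in> target As p Cs \<longleftrightarrow> b < p" "3 * a + 1 \<in> target As p Cs \<longleftrightarrow> a \<in> As" "3 * c + 2 \<in> target As p Cs \<longleftrightarrow> c \<in> Cs"
  unfolding target_def core_def by (auto; presburger)+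

lemma set_by_residue:
  "(\<And>b. 3 * b \<in> S \<longleftrightarrow> 3 * b \<in> T) \<Longrightarrow> (\<And>b. 3 * b + 1 \<in> S \<longleftrightarrow> 3 * b + 1 \<in> T) \<Longrightarrow> (\<And>b. 3 * b + 2 \<in> S \<longleftrightarrow> 3 * b + 2 \<in> T) \<Longrightarrow> S = T"
  for S T :: "int set"
proof (rule set_eqI)
  fix x :: int
  assume a: "\<And>b. 3 * b \<in> S \<longleftrightarrow> 3 * b \<in> T" "\<And>b. 3 * b + 1 \<in> S \<longleftrightarrow> 3 * b + 1 \<in> T" "\<And>b. 3 * b + 2 \<in> S \<longleftrightarrow> 3 * b + 2 \<in> T"
  have "x = 3 * (x div 3) \<or> x = 3 * (x div 3) + 1 \<or> x = 3 * (x div 3) + 2" by presburger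
  thus "x \<in> S \<longleftrightarrow> x \<in> T" using a by metis
qed

lemma label_eqs:
  "(3 * a + 1 = 3 * b) = False" "(3 * a + 2 = 3 * b) = False" "(3 * b = 3 * a + 1) = False" "(3 * b = 3 * a + 2) = False"
  "(3 * a + 1 = 3 * b + 2) = False" "(3 * a + 2 = 3 * b + 1) = False" for a b :: int
  by presburger+

lemma target_remove:
  "target As p Cs - {3 * a + 1} - {3 * (p - 1)} = target (As - {a}) (p - 1) Cs"
  "insert (3 * p) (target As p Cs - {3 * c + 2}) = target As (p + 1) (Cs - {c})"
proof -
  show "target As p Cs - {3 * a + 1} - {3 * (p - 1)} = target (As - {a}) (p - 1) Cs"
    by (rule set_by_residue; unfold Diff_iff singleton_iff target_mem label_eqs) auto
  show "insert (3 * p) (target As p Cs - {3 * c + 2}) = target As (p + 1) (Cs - {c})"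
    by (rule set_by_residue; unfold insert_iff Diff_iff singleton_iff target_mem label_eqs) auto
qed

text \<open>Reading off the coefficient from the left, the largest admissible index removes the largest label
  and the top of the sea, so the coefficient keeps its shape.\<close>

lemma peel_E:
  assumes fin: "finite As" "finite Cs" and a0: "a0 \<in> As" "\<And>a. a \<in> As \<Longrightarrow> a \<le> a0" "a0 \<in> {1..A}"
  shows "i > a0 + p - 1 \<Longrightarrow> rep A C (E i) g (target As p Cs) = 0"
    and "\<exists>\<epsilon>\<in>{1, -1}. rep A C (E (a0 + p - 1)) g (target As p Cs) = \<epsilon> * g (target (As - {a0}) (p - 1) Cs)"
proof -
  let ?S = "target As p Cs"
  have z: "creat (3 * a + 1) (creat (3 * (i - a)) g) ?S = 0" if "a \<notin> As \<or> i - a \<ge> p" for a i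
  proof (cases "a \<in> As")
    case False
    thus ?thesis by (simp add: creat_def target_mem)
  next
    case True
    hence "3 * (i - a) \<notin> ?S" using that by (simp only: target_mem) auto
    thus ?thesis by (subst antiD[OF anti_creat_creat]) (simp add: creat_def fun_ops)
  qed
  show "rep A C (E i) g ?S = 0" if "i > a0 + p - 1"
    unfolding rep.simps sum_fun_apply
    by (intro sum.neutral ballI z) (use a0 that in force)
  have "rep A C (E (a0 + p - 1)) g ?S = (\<Sum>a=1..A. if a = a0 then creat (3 * a0 + 1) (creat (3 * (p - 1)) g) ?S else 0)"
    unfolding rep.simps sum_fun_apply
  proof (intro sum.cong refl)
    fix a
    show "creat (3 * a + 1) (creat (3 * (a0 + p - 1 - a)) g) ?S = (if a = a0 then creat (3 * a0 + 1) (creat (3 * (p - 1)) g) ?S else 0)"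
    proof (cases "a = a0")
      case False
      hence "a \<notin> As \<or> a0 + p - 1 - a \<ge> p" using a0(2)[of a] by force
      from z[OF this] show ?thesis by (simp only: False if_False)
    next
      case True
      have "a0 + p - 1 - a0 = p - 1" by simp
      thus ?thesis using True by (simp only: if_True simp_thms)
    qed
  qed
  also have "\<dots> = creat (3 * a0 + 1) (creat (3 * (p - 1)) g) ?S" using a0(3) by (simp add: sum.delta)
  also have "\<dots> = fsign (3 * a0 + 1) ?S * fsign (3 * (p - 1)) (?S - {3 * a0 + 1}) * g (target (As - {a0}) (p - 1) Cs)"
  proof -
    have "3 * a0 + 1 \<in> ?S" "3 * (p - 1) \<in> ?S - {3 * a0 + 1}"
      unfolding Diff_iff singleton_iff target_mem label_eqs using a0(1) by auto
    thus ?thesis unfolding creat_def target_remove(1)[symmetric] by simp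
  qed
  finally show "\<exists>\<epsilon>\<in>{1, -1}. rep A C (E (a0 + p - 1)) g ?S = \<epsilon> * g (target (As - {a0}) (p - 1) Cs)"
    using fsign_cases[OF maya_target[OF fin, of p], of "3 * a0 + 1"]
      fsign_cases[of "?S - {3 * a0 + 1}" "3 * (p - 1)"] maya_target[OF fin, of p] by (auto simp del: rep.simps)
qed

text \<open>Dual to \<open>peel_E\<close>: reading backwards past an annihilator fills a hole of the
  sea. The mode is \<open>j = c - 1 - b\<close> with \<open>b >= p\<close> empty, so the largest one
  comes from the largest label and the lowest hole, and the charge rises by one.\<close>

lemma peel_F:
  assumes fin: "finite As" "finite Cs" and c0: "c0 \<in> Cs" "\<And>c. c \<in> Cs \<Longrightarrow> c \<le> c0" "c0 \<in> {1..C}"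
  shows "j > c0 - 1 - p \<Longrightarrow> rep A C (F j) g (target As p Cs) = 0"
    and "\<exists>\<epsilon>\<in>{1, -1}. rep A C (F (c0 - 1 - p)) g (target As p Cs) = \<epsilon> * g (target As (p + 1) (Cs - {c0}))"
proof -
  let ?S = "target As p Cs"
  have z: "creat (3 * c + 2) (annih (3 * (- 1 - (j - c))) g) ?S = 0" if "c \<notin> Cs \<or> - 1 - (j - c) < p" for c j
  proof (cases "c \<in> Cs")
    case False
    thus ?thesis by (simp add: creat_def target_mem)
  next
    case True
    hence "3 * (- 1 - (j - c)) \<in> ?S" using that by (simp only: target_mem) auto
    thus ?thesis by (subst antiD[OF anti_creat_annih[OF label_neq(2)]]) (simp add: annih_def fun_ops)
  qed
  show "rep A C (F j) g ?S = 0" if "j > c0 - 1 - p"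
    unfolding rep.simps sum_fun_apply
    by (intro sum.neutral ballI z) (use c0 that in force)
  have "rep A C (F (c0 - 1 - p)) g ?S = (\<Sum>c=1..C. if c = c0 then creat (3 * c0 + 2) (annih (3 * p) g) ?S else 0)"
    unfolding rep.simps sum_fun_apply
  proof (intro sum.cong refl)
    fix c
    show "creat (3 * c + 2) (annih (3 * (- 1 - (c0 - 1 - p - c))) g) ?S = (if c = c0 then creat (3 * c0 + 2) (annih (3 * p) g) ?S else 0)"
    proof (cases "c = c0")
      case False
      hence "c \<notin> Cs \<or> - 1 - (c0 - 1 - p - c) < p" using c0(2)[of c] by force
      from z[OF this] show ?thesis by (simp only: False if_False)
    next
      case True
      have "- 1 - (c0 - 1 - p - c0) = p" by simp
      thus ?thesis using True by (simp only: if_True simp_thms)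
    qed
  qed
  also have "\<dots> = creat (3 * c0 + 2) (annih (3 * p) g) ?S" using c0(3) by (simp add: sum.delta)
  also have "\<dots> = fsign (3 * c0 + 2) ?S * fsign (3 * p) (?S - {3 * c0 + 2}) * g (target As (p + 1) (Cs - {c0}))"
  proof -
    have "3 * c0 + 2 \<in> ?S" "3 * p \<notin> ?S - {3 * c0 + 2}"
      unfolding Diff_iff singleton_iff target_mem label_eqs using c0(1) by auto
    thus ?thesis unfolding creat_def annih_def target_remove(2)[symmetric] by simp
  qed
  finally show "\<exists>\<epsilon>\<in>{1, -1}. rep A C (F (c0 - 1 - p)) g ?S = \<epsilon> * g (target As (p + 1) (Cs - {c0}))"
    using fsign_cases[OF maya_target[OF fin, of p], of "3 * c0 + 2"]
      fsign_cases[of "?S - {3 * c0 + 2}" "3 * p"] maya_target[OF fin, of p] by (auto simp del: rep.simps)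
qed

lemma labels_Cons_set:
  assumes "gap2 (i # is)"
  shows "set (labels p (i # is)) - {i - p + 1} = set (labels (p - 1) is)"
    "\<And>a. a \<in> set (labels p (i # is)) \<Longrightarrow> a \<le> i - p + 1"
  using labels_less[OF assms] by fastforce+

text \<open>Peeling from the left compares the first indices; if they agree, the label and the top
  of the sea are removed, and the problem recurs with charge \<open>p - 1\<close>, as in the
  recursion of \<open>labels\<close>. The arbitrary state \<open>h\<close> leaves room for the
  \<open>f\<close>-part.\<close>

lemma tri_E:
  assumes "gap2 is" "set (labels p is) \<subseteq> {1..A}" "length is' = length is" "finite Cs"
  shows "repw A C (map E is') h (target (set (labels p is)) p Cs) \<noteq> 0 \<Longrightarrow> is' \<le> is"
    and "\<exists>\<epsilon>\<in>{1, -1}. repw A C (map E is) h (target (set (labels p is)) p Cs) = \<epsilon> * h (target {} (p - int (length is)) Cs)"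
proof -
  have "(repw A C (map E is') h (target (set (labels p is)) p Cs) \<noteq> 0 \<longrightarrow> is' \<le> is) \<and>
    (\<exists>\<epsilon>\<in>{1, -1}. repw A C (map E is) h (target (set (labels p is)) p Cs) = \<epsilon> * h (target {} (p - int (length is)) Cs))"
    using assms
  proof (induction "is" arbitrary: is' p)
    case Nil
    thus ?case by auto
  next
    case (Cons i "is")
    obtain i' is'' where is': "is' = i' # is''" using Cons.prems(3) by (cases is') auto
    let ?S = "target (set (labels p (i # is))) p Cs"
    let ?S' = "target (set (labels (p - 1) is)) (p - 1) Cs"
    have IH: "(repw A C (map E is'') h ?S' \<noteq> 0 \<longrightarrow> is'' \<le> is) \<and>
      (\<exists>\<epsilon>\<in>{1, -1}. repw A C (map E is) h ?S' = \<epsilon> * h (target {} (p - 1 - int (length is)) Cs))"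
      by (rule Cons.IH) (use Cons.prems is' gap2_ConsD in auto)
    have mem: "i - p + 1 \<in> set (labels p (i # is))" "i - p + 1 \<in> {1..A}" using Cons.prems(2) by auto
    have zero: "rep A C (E x) g ?S = 0" if "x > i" for x g
      using peel_E(1)[OF finite_set Cons.prems(4) mem(1) labels_Cons_set(2)[OF Cons.prems(1)] mem(2)] that by simp
    have eq: "\<exists>\<epsilon>\<in>{1, -1}. rep A C (E i) g ?S = \<epsilon> * g ?S'" for g
      using peel_E(2)[OF finite_set Cons.prems(4) mem(1) labels_Cons_set(2)[OF Cons.prems(1)] mem(2), where p = p and C = C and g = g]
      unfolding labels_Cons_set(1)[OF Cons.prems(1)] by simp
    have "is' \<le> i # is" if nz: "repw A C (map E is') h ?S \<noteq> 0"
    proof -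
      have "i' \<le> i" using zero[of i'] nz is' by (force simp del: rep.simps)
      moreover have "is'' \<le> is" if "i' = i"
      proof -
        obtain \<epsilon> where "rep A C (E i) (repw A C (map E is'') h) ?S = \<epsilon> * repw A C (map E is'') h ?S'" using eq by blast
        hence "repw A C (map E is'') h ?S' \<noteq> 0" using nz is' that by (auto simp del: rep.simps)
        thus ?thesis using IH by blast
      qed
      ultimately show ?thesis using is' by auto
    qed
    moreover have "\<exists>\<epsilon>\<in>{1, -1}. repw A C (map E (i # is)) h ?S = \<epsilon> * h (target {} (p - int (length (i # is))) Cs)"
    proof -
      obtain \<epsilon> where 1: "\<epsilon> \<in> {1, -1}" "rep A C (E i) (repw A C (map E is) h) ?S = \<epsilon> * repw A C (map E is) h ?S'" using eq by blast
      obtain \<delta> where 2: "\<delta> \<in> {1, -1}" "repw A C (map E is) h ?S' = \<delta> * h (target {} (p - 1 - int (length is)) Cs)" using IH by blast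
      have "\<epsilon> * \<delta> \<in> {1, -1}" using 1(1) 2(1) by auto
      moreover have e: "p - 1 - int (length is) = p - int (length (i # is))" by simp
      ultimately show ?thesis using 1(2) 2(2)[unfolded e] by (intro bexI[of _ "\<epsilon> * \<delta>"]) (simp_all del: rep.simps)
    qed
    ultimately show ?case by blast
  qed
  thus "repw A C (map E is') h (target (set (labels p is)) p Cs) \<noteq> 0 \<Longrightarrow> is' \<le> is"
    and "\<exists>\<epsilon>\<in>{1, -1}. repw A C (map E is) h (target (set (labels p is)) p Cs) = \<epsilon> * h (target {} (p - int (length is)) Cs)"
    by blast+
qed

text \<open>Writing the charge as \<open>- q\<close> gives the labels of \<open>f\<close> the same
  formula as those of \<open>e\<close>. For \<open>q = length js\<close> the charge returns to 0 and
  the vacuum itself remains.\<close>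

lemma tri_F:
  assumes "gap2 js" "set (labels q js) \<subseteq> {1..C}" "length js' = length js"
  shows "repw A C (map F js') h (target {} (- q) (set (labels q js))) \<noteq> 0 \<Longrightarrow> js' \<le> js"
    and "\<exists>\<epsilon>\<in>{1, -1}. repw A C (map F js) h (target {} (- q) (set (labels q js))) = \<epsilon> * h (target {} (- q + int (length js)) {})"
proof -
  have "(repw A C (map F js') h (target {} (- q) (set (labels q js))) \<noteq> 0 \<longrightarrow> js' \<le> js) \<and>
    (\<exists>\<epsilon>\<in>{1, -1}. repw A C (map F js) h (target {} (- q) (set (labels q js))) = \<epsilon> * h (target {} (- q + int (length js)) {}))"
    using assms
  proof (induction js arbitrary: js' q)
    case Nil
    thus ?case by auto
  next
    case (Cons j js)
    obtain j' js'' where js': "js' = j' # js''" using Cons.prems(3) by (cases js') auto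
    let ?S = "target {} (- q) (set (labels q (j # js)))"
    let ?S' = "target {} (- q + 1) (set (labels (q - 1) js))"
    have IH0: "(repw A C (map F js'') h (target {} (- (q - 1)) (set (labels (q - 1) js))) \<noteq> 0 \<longrightarrow> js'' \<le> js) \<and>
      (\<exists>\<epsilon>\<in>{1, -1}. repw A C (map F js) h (target {} (- (q - 1)) (set (labels (q - 1) js))) = \<epsilon> * h (target {} (- (q - 1) + int (length js)) {}))"
      by (rule Cons.IH) (use Cons.prems js' gap2_ConsD in auto)
    have e: "- (q - 1) = - q + 1" by simp
    note IH = IH0[unfolded e]
    have mem: "j - q + 1 \<in> set (labels q (j # js))" "j - q + 1 \<in> {1..C}" using Cons.prems(2) by auto
    have zero: "rep A C (F x) g ?S = 0" if "x > j" for x g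
      using peel_F(1)[OF _ finite_set mem(1) labels_Cons_set(2)[OF Cons.prems(1)] mem(2)] that by simp
    have "j - q + 1 - 1 - (- q) = j" by simp
    hence eq: "\<exists>\<epsilon>\<in>{1, -1}. rep A C (F j) g ?S = \<epsilon> * g ?S'" for g
      using peel_F(2)[OF finite.emptyI finite_set mem(1) labels_Cons_set(2)[OF Cons.prems(1)] mem(2), where p = "- q" and A = A and g = g]
      unfolding labels_Cons_set(1)[OF Cons.prems(1)] by (simp only:)
    have "js' \<le> j # js" if nz: "repw A C (map F js') h ?S \<noteq> 0"
    proof -
      have "j' \<le> j" using zero[of j'] nz js' by (force simp del: rep.simps)
      moreover have "js'' \<le> js" if "j' = j"
      proof -
        obtain \<epsilon> where "rep A C (F j) (repw A C (map F js'') h) ?S = \<epsilon> * repw A C (map F js'') h ?S'" using eq by blast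
        hence "repw A C (map F js'') h ?S' \<noteq> 0" using nz js' that by (auto simp del: rep.simps)
        thus ?thesis using IH by blast
      qed
      ultimately show ?thesis using js' by auto
    qed
    moreover have "\<exists>\<epsilon>\<in>{1, -1}. repw A C (map F (j # js)) h ?S = \<epsilon> * h (target {} (- q + int (length (j # js))) {})"
    proof -
      obtain \<epsilon> where 1: "\<epsilon> \<in> {1, -1}" "rep A C (F j) (repw A C (map F js) h) ?S = \<epsilon> * repw A C (map F js) h ?S'" using eq by blast
      obtain \<delta> where 2: "\<delta> \<in> {1, -1}" "repw A C (map F js) h ?S' = \<delta> * h (target {} (- q + 1 + int (length js)) {})" using IH by blast
      have "\<epsilon> * \<delta> \<in> {1, -1}" using 1(1) 2(1) by auto
      moreover have e: "- q + 1 + int (length js) = - q + int (length (j # js))" by simp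
      ultimately show ?thesis using 1(2) 2(2)[unfolded e] by (intro bexI[of _ "\<epsilon> * \<delta>"]) (simp_all del: rep.simps)
    qed
    ultimately show ?case by blast
  qed
  thus "repw A C (map F js') h (target {} (- q) (set (labels q js))) \<noteq> 0 \<Longrightarrow> js' \<le> js"
    and "\<exists>\<epsilon>\<in>{1, -1}. repw A C (map F js) h (target {} (- q) (set (labels q js))) = \<epsilon> * h (target {} (- q + int (length js)) {})"
    by blast+
qed

lemma lex_append:
  fixes xs ys :: "int list"
  assumes "length xs = length ys" "xs \<le> ys" "xs = ys \<Longrightarrow> us \<le> vs"
  shows "xs @ us \<le> ys @ vs"
  using assms by (induction xs ys rule: list_induct2) auto

text \<open>In a relation modulo \<open>Kfull M N\<close>, take the lexicographically smallest
  monomial with nonzero coefficient. Its target state sees only monomials that are not larger, hence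
  just this one, with value 1 or -1.\<close>

lemma indep_basis:
  assumes mn: "(m, n) \<noteq> (0, 0) \<or> (M \<noteq> -1 \<and> N \<noteq> -1)"
  shows "indep_mod (Kfull M N) (basis_idx M N m n) basis_vec"
  unfolding indep_mod_def
proof (intro allI impI, rule ccontr)
  fix G c assume G: "finite G \<and> G \<subseteq> basis_idx M N m n \<and> vsum c basis_vec G \<in> Kfull M N"
    and nz: "\<not> (\<forall>i\<in>G. c i = 0)"
  define key :: "int list \<times> int list \<Rightarrow> int list" where "key p = fst p @ snd p" for p
  define G' where "G' = {p\<in>G. c p \<noteq> 0}"
  have G': "finite G'" "G' \<noteq> {}" using G nz by (auto simp: G'_def)
  define k where "k = Min (key ` G')"
  have "k \<in> key ` G'" using G' by (simp add: k_def)
  then obtain "is" js where p: "(is, js) \<in> G'" "key (is, js) = k" by auto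
  have pb: "length is = m" "length js = n" "gap2 is" "gap2 js"
    "\<And>i. i \<in> set is \<Longrightarrow> 1 - int n \<le> i \<and> i < M" "\<And>j. j \<in> set js \<Longrightarrow> 0 < j \<and> j < N + int m"
    using p G by (auto simp: G'_def basis_idx_def)
  \<comment> \<open>The charge after \<open>m\<close> factors \<open>e\<close> and \<open>n\<close>
    factors \<open>f\<close>. With the resulting \<open>A\<close> and \<open>C\<close>, both
    \<open>rep_target_zero\<close> applies and the labels of admissible indices lie in
    \<open>{1..A}\<close> and \<open>{1..C}\<close>.\<close>
  define P where "P = int m - int n"
  define A where "A = M - P"
  define C where "C = N + P"
  define S where "S = target (set (labels P is)) P (set (labels (int n) js))"
  have A: "set (labels P is) \<subseteq> {1..A}"
    using labels_bounds[OF pb(3), of "1 - int n" _ P] labels_upper[OF pb(3), of M _ P] pb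
    by (auto simp: A_def P_def)
  have C: "set (labels (int n) js) \<subseteq> {1..C}"
  proof
    fix c assume c: "c \<in> set (labels (int n) js)"
    have "1 - int n + int (length js) \<le> c" by (rule labels_bounds[OF pb(4) _ c]) (use pb(6) in force)
    moreover have "c \<le> N + int m - int n" by (rule labels_upper[OF pb(4) _ c]) (use pb(6) in force)
    ultimately show "c \<in> {1..C}" using pb by (simp add: C_def P_def)
  qed
  have tri1: "q = (is, js)" if "q \<in> G'" "Phi A C (basis_vec q) S \<noteq> 0" for q
  proof -
    obtain is' js' where q: "q = (is', js')" by (cases q)
    have qb: "length is' = m" "length js' = n" using that q G by (auto simp: G'_def basis_idx_def)
    have v: "repw A C (map E is') (repw A C (map F js') vac) S \<noteq> 0"
      using that(2) by (simp add: q basis_vec_def Phi_wvec)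
    have 1: "is' \<le> is" using tri_E(1)[OF pb(3) A _ finite_set] v pb qb unfolding S_def by metis
    have 2: "js' \<le> js" if "is' = is"
    proof -
      obtain \<epsilon> where "repw A C (map E is) (repw A C (map F js') vac) S = \<epsilon> * repw A C (map F js') vac (target {} (P - int (length is)) (set (labels (int n) js)))"
        using tri_E(2)[OF pb(3) A refl finite_set] unfolding S_def by blast
      hence "repw A C (map F js') vac (target {} (- int n) (set (labels (int n) js))) \<noteq> 0"
        using v that pb by (auto simp: P_def)
      thus ?thesis using tri_F(1)[OF pb(4) C] pb qb by metis
    qed
    have "key q \<le> k" unfolding p(2)[symmetric] key_def q using lex_append[of is' "is" js' js] 1 2 pb qb by simp
    moreover have "k \<le> key q" using that(1) G' by (simp add: k_def)
    ultimately have "is' @ js' = is @ js" using p(2) by (simp add: key_def q)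
    thus ?thesis using pb qb q by simp
  qed
  have val: "Phi A C (basis_vec (is, js)) S \<in> {1, -1}"
  proof -
    obtain \<epsilon> where 1: "\<epsilon> \<in> {1, -1}" "repw A C (map E is) (repw A C (map F js) vac) S = \<epsilon> * repw A C (map F js) vac (target {} (P - int (length is)) (set (labels (int n) js)))"
      using tri_E(2)[OF pb(3) A refl finite_set] unfolding S_def by blast
    obtain \<delta> where 2: "\<delta> \<in> {1, -1}" "repw A C (map F js) vac (target {} (- int n) (set (labels (int n) js))) = \<delta> * vac (target {} (- int n + int (length js)) {})"
      using tri_F(2)[OF pb(4) C refl] by blast
    have "vac (target {} 0 {}) = 1" by (simp add: vac_def target_def)
    thus ?thesis using 1 2 pb by (auto simp: basis_vec_def Phi_wvec P_def)
  qed
  \<comment> \<open>The target must not see \<open>v\<close> when \<open>v\<close> is divided out.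
    Charge 0 forces \<open>m = n\<close>, which is positive here, so \<open>S\<close> contains a
    label of \<psi>.\<close>
  have "S \<noteq> core 0" if MN: "M = -1 \<or> N = -1"
  proof
    assume S0: "S = core 0"
    have "b < P \<longleftrightarrow> b < 0" for b using target_mem(1)[of b] core_iff[of b 0] S0 unfolding S_def by metis
    from this[of "min P 0"] this[of "max P 0 - 1"] have "P = 0" by linarith
    hence "m = n" by (simp add: P_def)
    then obtain i is1 where "is = i # is1" using mn MN pb by (cases "is") auto
    moreover define a where "a = i - P + 1"
    ultimately have "a \<in> set (labels P is)" by simp
    hence "3 * a + 1 \<in> core 0" using target_mem(2)[of a] S0 unfolding S_def by metis
    thus False by (auto simp: core_def; presburger)
  qed
  hence "Phi A C (vsum c basis_vec G) S = 0"
    using Phi_Kfull_zero[OF A_def C_def S_def] G by blast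
  moreover have "Phi A C (vsum c basis_vec G) S = (\<Sum>q\<in>G. c q * Phi A C (basis_vec q) S)"
  proof -
    have fs: "fin_supp (basis_vec q)" for q by (simp add: basis_vec_def fin_supp_wvec)
    show ?thesis
      unfolding vsum_eq using Phi_sum[of G "\<lambda>q. fscale (c q) (basis_vec q)" A C] fs
      by (simp add: fin_supp_scale Phi_scale sum_fun_apply) (simp add: fscale_def)
  qed
  moreover have "(\<Sum>q\<in>G. c q * Phi A C (basis_vec q) S) = (\<Sum>q\<in>{(is, js)}. c q * Phi A C (basis_vec q) S)"
    by (rule sum.mono_neutral_right) (use G p tri1 in \<open>auto simp: G'_def\<close>)
  ultimately have "c (is, js) * Phi A C (basis_vec (is, js)) S = 0" by simp
  thus False using val p by (auto simp: G'_def)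
qed

section \<open>Dimensions and characters\<close>

lemma span_mod_obtain:
  assumes K: "vs.subspace K" and a: "a \<in> vs.span (K \<union> v ` X)"
  shows "\<exists>G c. finite G \<and> G \<subseteq> X \<and> vdiff a (vsum c v G) \<in> K"
proof -
  obtain x y where xy: "a = x + y" "x \<in> vs.span K" "y \<in> vs.span (v ` X)"
    using a unfolding vs.span_Un by auto
  obtain t r where t: "finite t" "t \<subseteq> v ` X" "y = (\<Sum>b\<in>t. fscale (r b) b)"
    using xy(3) unfolding vs.span_explicit by auto
  obtain G where G: "G \<subseteq> X" "inj_on v G" "t = v ` G" using t(2) by (auto simp: subset_image_inj)
  have "finite G" using t(1) G by (simp add: finite_image_iff)
  moreover have "vsum (r \<circ> v) v G = y" by (simp add: vsum_eq t(3) G(3) sum.reindex[OF G(2)])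
  moreover have "x \<in> K" using xy(2) K by (simp add: vs.span_eq_iff[THEN iffD2])
  ultimately show ?thesis using G(1) xy(1) by (intro exI[of _ G] exI[of _ "r \<circ> v"]) (simp add: vdiff_eq)
qed

text \<open>The exchange bound for a quotient that is not a type: each \<open>g\<close> is replaced
  by its coordinate function \<open>u g\<close> on \<open>X\<close>. Independence modulo
  \<open>K\<close> passes to these functions, and they lie in the span of the delta functions of
  \<open>X\<close>.\<close>

lemma indep_mod_card_le:
  fixes v :: "'i \<Rightarrow> vec"
  assumes K: "vs.subspace K" and X: "finite X" and G: "finite G" "G \<subseteq> vs.span (K \<union> v ` X)" "indep_mod K G id"
  shows "card G \<le> card X"
proof -
  have "\<exists>c. (\<forall>x. x \<notin> X \<longrightarrow> c x = 0) \<and> g - (\<Sum>x\<in>X. fscale (c x) (v x)) \<in> K" if "g \<in> G" for g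
  proof -
    have "g \<in> vs.span (K \<union> v ` X)" using G(2) that by (rule subsetD)
    from span_mod_obtain[OF K this]
    obtain H c where H: "finite H" "H \<subseteq> X" "vdiff g (vsum c v H) \<in> K" by (elim exE conjE)
    let ?c = "\<lambda>x. if x \<in> H then c x else 0"
    have "(\<Sum>x\<in>X. fscale (?c x) (v x)) = (\<Sum>x\<in>H. fscale (c x) (v x))"
      using H X by (intro sum.mono_neutral_cong_right) auto
    thus ?thesis using H by (intro exI[of _ ?c]) (auto simp: vdiff_eq vsum_eq)
  qed
  then obtain u where u: "\<And>g x. g \<in> G \<Longrightarrow> x \<notin> X \<Longrightarrow> u g x = 0"
    "\<And>g. g \<in> G \<Longrightarrow> g - (\<Sum>x\<in>X. fscale (u g x) (v x)) \<in> K" by metis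
  have ind: "\<And>H c g. finite H \<Longrightarrow> H \<subseteq> G \<Longrightarrow> (\<Sum>g\<in>H. fscale (c g) g) \<in> K \<Longrightarrow> g \<in> H \<Longrightarrow> c g = 0"
    using G(3) unfolding indep_mod_def vsum_eq by auto
  have inj: "inj_on u G"
  proof (rule inj_onI, rule ccontr)
    fix g g' assume g: "g \<in> G" "g' \<in> G" "u g = u g'" "g \<noteq> g'"
    have "(g - (\<Sum>x\<in>X. fscale (u g x) (v x))) - (g' - (\<Sum>x\<in>X. fscale (u g' x) (v x))) \<in> K"
      by (rule vs.subspace_diff[OF K u(2)[OF g(1)] u(2)[OF g(2)]])
    hence "(\<Sum>h\<in>{g, g'}. fscale (if h = g then 1 else -1) h) \<in> K" using g by simp
    from ind[OF _ _ this, of g] g show False by simp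
  qed
  let ?\<delta> = "\<lambda>x y. if y = x then 1 else 0 :: complex"
  have "vs.independent (u ` G)"
  proof (rule vs.independent_if_scalars_zero)
    fix f y assume f: "(\<Sum>x\<in>u ` G. fscale (f x) x) = 0" and y: "y \<in> u ` G"
    have f': "(\<Sum>g\<in>G. fscale (f (u g)) (u g)) = 0" using f by (simp add: sum.reindex[OF inj])
    have co: "(\<Sum>g\<in>G. f (u g) * u g x) = 0" for x
      using fun_cong[OF f', of x] by (simp add: sum_fun_apply fun_ops) (simp add: fscale_def)
    have "(\<Sum>g\<in>G. fscale (f (u g)) (\<Sum>x\<in>X. fscale (u g x) (v x))) = (\<Sum>g\<in>G. \<Sum>x\<in>X. fscale (f (u g) * u g x) (v x))"
      by (simp add: vs.scale_sum_right)
    also have "\<dots> = (\<Sum>x\<in>X. \<Sum>g\<in>G. fscale (f (u g) * u g x) (v x))" by (rule sum.swap)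
    also have "\<dots> = 0" by (simp add: co vs.scale_sum_left[symmetric])
    finally have z: "(\<Sum>g\<in>G. fscale (f (u g)) (\<Sum>x\<in>X. fscale (u g x) (v x))) = 0" .
    have "(\<Sum>g\<in>G. fscale (f (u g)) (g - (\<Sum>x\<in>X. fscale (u g x) (v x)))) \<in> K"
      by (intro vs.subspace_sum[OF K] vs.subspace_scale[OF K] u(2))
    hence "(\<Sum>g\<in>G. fscale (f (u g)) g) \<in> K" by (simp add: vs.scale_right_diff_distrib sum_subtractf z)
    thus "f y = 0" using ind[OF G(1) order_refl, of "\<lambda>g. f (u g)"] y by auto
  qed (use G in simp)
  moreover have "u ` G \<subseteq> vs.span (?\<delta> ` X)"
  proof
    fix w assume "w \<in> u ` G"
    then obtain g where g: "g \<in> G" "w = u g" by auto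
    have "w = (\<Sum>x\<in>X. fscale (w x) (?\<delta> x))"
    proof
      fix y
      have "(\<Sum>x\<in>X. fscale (w x) (?\<delta> x)) y = (\<Sum>x\<in>X. if y = x then w x else 0)"
        unfolding sum_fun_apply by (intro sum.cong) (auto simp: fscale_def)
      thus "w y = (\<Sum>x\<in>X. fscale (w x) (?\<delta> x)) y" using X u(1)[OF g(1), of y] g(2) by (simp add: sum.delta)
    qed
    moreover have "(\<Sum>x\<in>X. fscale (w x) (?\<delta> x)) \<in> vs.span (?\<delta> ` X)"
      by (intro vs.span_sum vs.span_scale vs.span_base) auto
    ultimately show "w \<in> vs.span (?\<delta> ` X)" by simp
  qed
  ultimately have "card (u ` G) \<le> card (?\<delta> ` X)"
    using vs.independent_span_bound[of "?\<delta> ` X" "u ` G"] X by blast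
  also have "\<dots> \<le> card X" using X by (rule card_image_le)
  finally show ?thesis by (simp add: card_image[OF inj])
qed

lemma qdim_eq:
  fixes v :: "'i \<Rightarrow> vec"
  assumes K: "vs.subspace K" and X: "finite X" "v ` X \<subseteq> A" "indep_mod K X v" "A \<subseteq> vs.span (K \<union> v ` X)"
  shows "qdim K A = card X"
proof -
  have ind: "\<And>H c x. H \<subseteq> X \<Longrightarrow> (\<Sum>x\<in>H. fscale (c x) (v x)) \<in> K \<Longrightarrow> x \<in> H \<Longrightarrow> c x = 0"
    using X(3) finite_subset[OF _ X(1)] unfolding indep_mod_def vsum_eq by auto
  have inj: "inj_on v X"
  proof (rule inj_onI, rule ccontr)
    fix x y assume xy: "x \<in> X" "y \<in> X" "v x = v y" "x \<noteq> y"
    have "(\<Sum>h\<in>{x, y}. fscale (if h = x then 1 else -1) (v h)) \<in> K" using xy by (simp add: vs.subspace_0[OF K])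
    from ind[OF _ this, of x] xy show False by simp
  qed
  have "indep_mod K (v ` X) id"
    unfolding indep_mod_def
  proof (intro allI impI ballI)
    fix G c g assume G: "finite G \<and> G \<subseteq> v ` X \<and> vsum c id G \<in> K" and g: "g \<in> G"
    then obtain H where H: "H \<subseteq> X" "inj_on v H" "G = v ` H" by (auto simp: subset_image_inj)
    hence "(\<Sum>x\<in>H. fscale (c (v x)) (v x)) \<in> K" using G by (simp add: vsum_eq sum.reindex)
    from ind[OF H(1) this] show "c g = 0" using g H by auto
  qed
  hence "card X \<in> {card G | G. finite G \<and> G \<subseteq> A \<and> indep_mod K G id}"
    using X card_image[OF inj] by (intro CollectI exI[of _ "v ` X"]) auto
  moreover have "n \<le> card X" if "n \<in> {card G | G. finite G \<and> G \<subseteq> A \<and> indep_mod K G id}" for n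
    using that indep_mod_card_le[OF K X(1), of _ v] X(4) by auto
  ultimately show ?thesis unfolding qdim_def by (rule cSup_eq_maximum)
qed

lemma indep_mod_subset:
  assumes "indep_mod K X v" "Y \<subseteq> X"
  shows "indep_mod K Y v"
  unfolding indep_mod_def
proof (intro allI impI)
  fix G c assume "finite G \<and> G \<subseteq> Y \<and> vsum c v G \<in> K"
  hence "finite G \<and> G \<subseteq> X \<and> vsum c v G \<in> K" using assms(2) by auto
  thus "\<forall>i\<in>G. c i = 0" using assms(1)[unfolded indep_mod_def, rule_format, of G c] by simp
qed

section \<open>Gap-two lists and q-binomial coefficients\<close>

lemma gap2_sorted_wrt: "gap2 xs \<longleftrightarrow> sorted_wrt (\<lambda>x y. x \<ge> y + 2) xs"
proof (induction xs rule: induct_list012)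
  case (3 x y zs)
  have "transp (\<lambda>x y. x \<ge> y + (2::int))" by (auto simp: transp_def)
  thus ?case using 3 by (simp add: sorted_wrt2 del: sorted_wrt.simps)
qed auto

definition glist :: "nat \<Rightarrow> int \<Rightarrow> int \<Rightarrow> int list set" where
  "glist m lo hi = {is. length is = m \<and> gap2 is \<and> (\<forall>i\<in>set is. lo \<le> i \<and> i < hi)}"

lemma finite_glist: "finite (glist m lo hi)"
  by (rule finite_subset[OF _ finite_lists_length_eq[of "{lo..<hi}" m]]) (auto simp: glist_def)

text \<open>The sum of the lowest list \<open>lo + 2 * (m - 1), ..., lo + 2, lo\<close>.\<close>

definition gmin :: "nat \<Rightarrow> int \<Rightarrow> int" where
  "gmin m lo = int m * lo + int m * (int m - 1)"

lemma glist_sum_ge: "is \<in> glist m lo hi \<Longrightarrow> gmin m lo \<le> sum_list is"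
proof -
  have "gap2 is \<Longrightarrow> (\<forall>i\<in>set is. lo \<le> i) \<Longrightarrow> gmin (length is) lo \<le> sum_list is"
  proof (induction "is")
    case (Cons i "is")
    have "lo + 2 * int (length is) \<le> i" using Cons.prems by (intro gap2_head) auto
    moreover have "gmin (length is) lo \<le> sum_list is" using Cons gap2_ConsD by auto
    ultimately show ?case by (simp add: gmin_def algebra_simps)
  qed (simp add: gmin_def)
  thus "is \<in> glist m lo hi \<Longrightarrow> gmin m lo \<le> sum_list is" by (auto simp: glist_def)
qed

lemma glist_empty: "m > 0 \<Longrightarrow> hi - lo < int m \<Longrightarrow> glist m lo hi = {}"
proof (rule ccontr)
  assume m: "m > 0" "hi - lo < int m" and "glist m lo hi \<noteq> {}"
  then obtain xs where xs: "xs \<in> glist m lo hi" by auto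
  then obtain i "is" where i: "xs = i # is" using m by (cases xs) (auto simp: glist_def)
  hence "lo + 2 * int (length is) \<le> i" using xs by (intro gap2_head) (auto simp: glist_def)
  moreover have "i < hi" "m = Suc (length is)" using xs i by (auto simp: glist_def)
  ultimately show False using m by simp
qed

text \<open>According to whether \<open>lo\<close> occurs or not; this is the recursion of the \<open>q\<close>-binomials.\<close>

lemma glist_Suc:
  "glist (Suc k) lo hi = (if lo < hi then (\<lambda>is. is @ [lo]) ` glist k (lo + 2) hi else {}) \<union> glist (Suc k) (lo + 1) hi"
proof (intro equalityI subsetI)
  fix xs assume xs: "xs \<in> glist (Suc k) lo hi"
  then obtain ys y where y: "xs = ys @ [y]" by (cases xs rule: rev_cases) (auto simp: glist_def)
  have a: "length ys = k" "gap2 ys" "\<forall>x\<in>set ys. y + 2 \<le> x \<and> x < hi" "lo \<le> y" "y < hi"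
    using xs by (auto simp: glist_def y gap2_sorted_wrt sorted_wrt_append)
  show "xs \<in> (if lo < hi then (\<lambda>is. is @ [lo]) ` glist k (lo + 2) hi else {}) \<union> glist (Suc k) (lo + 1) hi"
  proof (cases "y = lo")
    case True
    thus ?thesis using a by (auto simp: y glist_def)
  next
    case False
    thus ?thesis using a xs by (force simp: y glist_def)
  qed
next
  fix xs assume "xs \<in> (if lo < hi then (\<lambda>is. is @ [lo]) ` glist k (lo + 2) hi else {}) \<union> glist (Suc k) (lo + 1) hi"
  thus "xs \<in> glist (Suc k) lo hi"
    by (auto simp: glist_def gap2_sorted_wrt sorted_wrt_append split: if_splits) force+
qed

text \<open>Closing up the \<open>m - 1\<close> gaps shrinks the window of size
  \<open>x + m - 1\<close> to \<open>x\<close>. If \<open>lo\<close> occurs, removing it leaves the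
  excess over the minimal sum unchanged; if not, raising \<open>lo\<close> by one lifts the minimum
  by the length, which is the power of \<open>q\<close> in the recursion.\<close>

lemma glist_gf_nat:
  "(\<Sum>is\<in>glist m lo (lo + int x + int m - 1). monom (1::int) (nat (sum_list is - gmin m lo))) = qbin_nat x m"
proof (induction x m arbitrary: lo rule: qbin_nat.induct)
  case (1 n)
  have "glist 0 lo hi = {[]}" for hi by (auto simp: glist_def)
  thus ?case by (simp add: gmin_def)
next
  case (2 k)
  have "glist (Suc k) lo (lo + int 0 + int (Suc k) - 1) = {}" by (rule glist_empty) auto
  thus ?case by (simp only: sum.empty qbin_nat.simps)
next
  case (3 n k)
  define hi where "hi = lo + int (Suc n) + int (Suc k) - 1"
  have hi1: "hi = (lo + 2) + int n + int k - 1" and hi2: "hi = (lo + 1) + int n + int (Suc k) - 1"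
    by (simp_all add: hi_def)
  have eq: "glist (Suc k) lo hi = (\<lambda>is. is @ [lo]) ` glist k (lo + 2) hi \<union> glist (Suc k) (lo + 1) hi"
    using glist_Suc[of k lo hi] by (simp add: hi_def)
  have "(\<Sum>is\<in>glist (Suc k) lo hi. monom (1::int) (nat (sum_list is - gmin (Suc k) lo))) =
     (\<Sum>is\<in>(\<lambda>is. is @ [lo]) ` glist k (lo + 2) hi. monom 1 (nat (sum_list is - gmin (Suc k) lo))) +
     (\<Sum>is\<in>glist (Suc k) (lo + 1) hi. monom 1 (nat (sum_list is - gmin (Suc k) lo)))"
    unfolding eq by (rule sum.union_disjoint) (auto simp: finite_glist, auto simp: glist_def)
  also have "(\<Sum>is\<in>(\<lambda>is. is @ [lo]) ` glist k (lo + 2) hi. monom (1::int) (nat (sum_list is - gmin (Suc k) lo))) =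
     (\<Sum>is\<in>glist k (lo + 2) hi. monom 1 (nat (sum_list is - gmin k (lo + 2))))"
  proof -
    have "sum_list (is @ [lo]) - gmin (Suc k) lo = sum_list is - gmin k (lo + 2)" for "is" :: "int list"
      by (simp add: gmin_def algebra_simps)
    thus ?thesis by (subst sum.reindex) (auto simp only: inj_on_def append_same_eq o_def)
  qed
  also have "\<dots> = qbin_nat n k" unfolding hi1 by (rule "3.IH"(1))
  also have "(\<Sum>is\<in>glist (Suc k) (lo + 1) hi. monom (1::int) (nat (sum_list is - gmin (Suc k) lo))) =
     (\<Sum>is\<in>glist (Suc k) (lo + 1) hi. monom 1 (Suc k) * monom 1 (nat (sum_list is - gmin (Suc k) (lo + 1))))"
  proof (intro sum.cong refl)
    fix "is" assume "is \<in> glist (Suc k) (lo + 1) hi"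
    hence "gmin (Suc k) (lo + 1) \<le> sum_list is" by (rule glist_sum_ge)
    moreover have "gmin (Suc k) (lo + 1) = gmin (Suc k) lo + int (Suc k)" by (simp add: gmin_def algebra_simps)
    ultimately have "nat (sum_list is - gmin (Suc k) lo) = Suc k + nat (sum_list is - gmin (Suc k) (lo + 1))" by simp
    thus "monom (1::int) (nat (sum_list is - gmin (Suc k) lo)) = monom 1 (Suc k) * monom 1 (nat (sum_list is - gmin (Suc k) (lo + 1)))"
      by (simp add: mult_monom)
  qed
  also have "\<dots> = monom 1 (Suc k) * qbin_nat n (Suc k)"
    unfolding sum_distrib_left[symmetric] hi2 by (simp only: "3.IH"(2))
  finally show ?case by (simp add: hi_def)
qed

text \<open>For \<open>m = 0\<close> the empty list counts in any window, while
  \<open>qbinom\<close> is 0 for a negative upper argument. The hypothesis excludes this clash,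
  which in the theorem occurs only in degree \<open>(0, 0)\<close> with \<open>M = -1\<close> or
  \<open>N = -1\<close>.\<close>

lemma glist_gf:
  assumes "hi - lo - int m + 1 \<ge> 0 \<or> m > 0"
  shows "(\<Sum>is\<in>glist m lo hi. monom (1::int) (nat (sum_list is - gmin m lo))) = qbinom (hi - lo - int m + 1) (int m)"
proof (cases "hi - lo - int m + 1 \<ge> 0")
  case True
  define x where "x = nat (hi - lo - int m + 1)"
  have hi: "lo + int x + int m - 1 = hi" using True by (simp add: x_def)
  have "qbinom (hi - lo - int m + 1) (int m) = qbin_nat x m" using True by (simp add: qbinom_def x_def)
  thus ?thesis using glist_gf_nat[of m lo x] unfolding hi by (simp only:)
next
  case False
  hence "glist m lo hi = {}" using assms by (intro glist_empty) auto
  thus ?thesis using False by (simp add: qbinom_def)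
qed

lemma basis_idx_eq: "basis_idx M N m n = glist m (1 - int n) M \<times> glist n 1 (N + int m)"
  by (auto simp: basis_idx_def glist_def)

text \<open>The exponent \<open>e\<close> is the degree of the lowest monomial,
  \<open>gmin m (1 - n) + gmin n 1\<close>. The two factors are the generating functions of the
  lists of \<open>e\<close>-indices and \<open>f\<close>-indices by their excess over these
  minima.\<close>

lemma card_basis_deg:
  fixes M N :: int
  assumes "M - int m + int n \<ge> 0 \<or> m > 0" "N - int n + int m \<ge> 0 \<or> n > 0"
  defines "e \<equiv> int n ^ 2 + int m ^ 2 - int m * int n"
  shows "int (card (basis_deg M N m n d)) = (if e \<le> d
     then coeff (qbinom (M - int m + int n) (int m) * qbinom (N - int n + int m) (int n)) (nat (d - e)) else 0)"
proof -
  let ?I = "glist m (1 - int n) M" and ?J = "glist n 1 (N + int m)"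
  let ?a = "\<lambda>is. nat (sum_list is - gmin m (1 - int n))" and ?b = "\<lambda>js. nat (sum_list js - gmin n 1)"
  have e: "e = gmin m (1 - int n) + gmin n 1" by (simp add: e_def gmin_def power2_eq_square algebra_simps)
  have I: "(\<Sum>is\<in>?I. monom (1::int) (?a is)) = qbinom (M - int m + int n) (int m)"
    using glist_gf[of M "1 - int n" m] assms(1) by (simp add: algebra_simps)
  have J: "(\<Sum>js\<in>?J. monom (1::int) (?b js)) = qbinom (N - int n + int m) (int n)"
    using glist_gf[of "N + int m" 1 n] assms(2) by (simp add: algebra_simps)
  have "qbinom (M - int m + int n) (int m) * qbinom (N - int n + int m) (int n) =
      (\<Sum>is\<in>?I. \<Sum>js\<in>?J. monom 1 (?a is + ?b js))"
    unfolding I[symmetric] J[symmetric] by (simp add: sum_product mult_monom)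
  also have "\<dots> = (\<Sum>(is, js)\<in>?I \<times> ?J. monom 1 (?a is + ?b js))" by (rule sum.cartesian_product)
  finally have P: "qbinom (M - int m + int n) (int m) * qbinom (N - int n + int m) (int n) =
      (\<Sum>p\<in>?I \<times> ?J. monom 1 (?a (fst p) + ?b (snd p)))" by (simp add: case_prod_unfold)
  \<comment> \<open>These bounds keep \<open>nat\<close> from truncating the excesses.\<close>
  have ge: "gmin m (1 - int n) \<le> sum_list (fst p)" "gmin n 1 \<le> sum_list (snd p)" if "p \<in> ?I \<times> ?J" for p
    using that glist_sum_ge by (auto simp: mem_Times_iff)
  show ?thesis
  proof (cases "e \<le> d")
    case True
    have "coeff (\<Sum>p\<in>?I \<times> ?J. monom 1 (?a (fst p) + ?b (snd p))) (nat (d - e)) =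
        (\<Sum>p\<in>?I \<times> ?J. if ?a (fst p) + ?b (snd p) = nat (d - e) then 1 else 0 :: int)"
      by (simp add: coeff_sum)
    also have "\<dots> = (\<Sum>p\<in>basis_deg M N m n d. 1)"
    proof -
      have "basis_deg M N m n d = (?I \<times> ?J) \<inter> {p. ?a (fst p) + ?b (snd p) = nat (d - e)}"
      proof (intro set_eqI)
        fix p
        show "p \<in> basis_deg M N m n d \<longleftrightarrow> p \<in> (?I \<times> ?J) \<inter> {p. ?a (fst p) + ?b (snd p) = nat (d - e)}"
        proof (cases "p \<in> ?I \<times> ?J")
          case p: True
          show ?thesis using ge[OF p] p True e by (auto simp: basis_deg_def basis_idx_eq)
        qed (auto simp: basis_deg_def basis_idx_eq)
      qed
      thus ?thesis by (simp add: sum.If_cases finite_glist)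
    qed
    finally show ?thesis using True P by simp
  next
    case False
    hence "basis_deg M N m n d = {}" using ge e by (fastforce simp: basis_deg_def basis_idx_eq)
    thus ?thesis using False by simp
  qed
qed

lemma finite_basis_deg: "finite (basis_deg M N m n d)"
  unfolding basis_deg_def basis_idx_eq by (simp add: finite_glist)

text \<open>A gap-two list must fit into its range, so \<open>2 * m <= |M| + n\<close> and
  \<open>2 * n <= |N| + m\<close>. Adding them bounds \<open>m + n\<close> by
  \<open>|M| + |N|\<close>, which leaves finitely many bidegrees.\<close>

lemma finite_all_basis_idx: "finite (\<Union>m n. basis_idx M N m n)"
proof -
  define R where "R = nat (2 * \<bar>M\<bar> + 2 * \<bar>N\<bar> + 2)"
  let ?L = "{xs :: int list. set xs \<subseteq> {- int R..int R} \<and> length xs \<le> R}"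
  have "basis_idx M N m n \<subseteq> ?L \<times> ?L" for m n
  proof
    fix p assume p: "p \<in> basis_idx M N m n"
    obtain "is" js where q: "p = (is, js)" by (cases p)
    have b: "length is = m" "length js = n" "gap2 is" "gap2 js"
      "\<And>i. i \<in> set is \<Longrightarrow> 1 - int n \<le> i \<and> i < M" "\<And>j. j \<in> set js \<Longrightarrow> 0 < j \<and> j < N + int m"
      using p by (auto simp: q basis_idx_def)
    have 1: "2 * int m \<le> \<bar>M\<bar> + int n"
    proof (cases "is")
      case (Cons i xs)
      have "1 - int n + 2 * int (length xs) \<le> i" using b Cons by (intro gap2_head) auto
      thus ?thesis using b(1) b(5)[of i] Cons by simp
    qed (use b in simp)
    have 2: "2 * int n \<le> \<bar>N\<bar> + int m"
    proof (cases js)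
      case (Cons j xs)
      have "1 + 2 * int (length xs) \<le> j" using b Cons by (intro gap2_head) force+
      thus ?thesis using b(2) b(6)[of j] Cons by simp
    qed (use b in simp)
    have mn: "int m + int n \<le> \<bar>M\<bar> + \<bar>N\<bar>" using 1 2 by simp
    have "m \<le> R" "n \<le> R" using mn by (simp_all add: R_def)
    moreover have "- int R \<le> i \<and> i \<le> int R" if "i \<in> set is" for i using b(5)[OF that] mn unfolding R_def by linarith
    moreover have "- int R \<le> i \<and> i \<le> int R" if "i \<in> set js" for i using b(6)[OF that] mn unfolding R_def by linarith
    ultimately show "p \<in> ?L \<times> ?L" using b by (auto simp: q)
  qed
  hence "(\<Union>m n. basis_idx M N m n) \<subseteq> ?L \<times> ?L" by blast
  moreover have "finite (?L \<times> ?L)" by (intro finite_cartesian_product finite_lists_length_le) auto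
  ultimately show ?thesis by (rule finite_subset)
qed

lemma wH_basis: "wH1 (map E is @ map F js) = length is" "wH2 (map E is @ map F js) = length js"
  "wdeg (map E is @ map F js) = sum_list is + sum_list js"
  by (induction "is"; induction js; simp add: wH1_def wH2_def wdeg_def)+

theorem theorem4p3p2:
  fixes M N :: int
  assumes "M \<ge> -1" and "N \<ge> -1" and "(M, N) \<noteq> (-1, -1)"
  shows "(\<forall>m n. (m, n) \<noteq> (0, 0) \<longrightarrow>
            basis_mod (Kfull M N) (comp m n) (basis_idx M N m n) basis_vec)
       \<and> fin_dim_mod (Kfull M N) Tall
       \<and> (\<forall>m n d. int (qdim (Kfull M N) (comp3 m n d)) =
            (let e = int n ^ 2 + int m ^ 2 - int m * int n in
             if e \<le> d
             then coeff (qbinom (M - int m + int n) (int m) * qbinom (N - int n + int m) (int n))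
                        (nat (d - e))
             else 0))"
proof (intro conjI allI impI)
  let ?K = "Kfull M N"
  note Ksub = Kfull_subspace[of M N]
  have wB: "wvec w \<in> vs.span (?K \<union> basis_vec ` basis_deg M N (wH1 w) (wH2 w) (wdeg w))" for w
    by (rule word_in_span_basis)
  fix m n :: nat assume mn: "(m, n) \<noteq> (0, 0)"
  have "basis_vec ` basis_idx M N m n \<subseteq> comp m n"
    unfolding comp_def lspan_eq
    by (auto simp: basis_vec_def basis_idx_def intro!: vs.span_base) (metis wH_basis(1,2))
  moreover have "spans_mod ?K (comp m n) (basis_idx M N m n) basis_vec"
    unfolding spans_mod_def
  proof
    fix a assume "a \<in> comp m n"
    hence "a \<in> vs.span {wvec w |w. wH1 w = m \<and> wH2 w = n}" by (simp add: comp_def lspan_eq)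
    moreover have "wvec w \<in> vs.span (?K \<union> basis_vec ` basis_idx M N m n)" if "wH1 w = m" "wH2 w = n" for w
      using subsetD[OF vs.span_mono wB[of w], of "?K \<union> basis_vec ` basis_idx M N m n"] that
      by (auto simp: basis_deg_def)
    ultimately have "a \<in> vs.span (?K \<union> basis_vec ` basis_idx M N m n)" by (elim span_bind) auto
    thus "\<exists>G c. finite G \<and> G \<subseteq> basis_idx M N m n \<and> vdiff a (vsum c basis_vec G) \<in> ?K"
      by (rule span_mod_obtain[OF Ksub])
  qed
  ultimately show "basis_mod ?K (comp m n) (basis_idx M N m n) basis_vec"
    using indep_basis[OF disjI1[OF mn]] by (simp add: basis_mod_def)
next
  let ?G = "basis_vec ` (\<Union>m n. basis_idx M N m n)"
  show "fin_dim_mod (Kfull M N) Tall"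
    unfolding fin_dim_mod_def
  proof (intro exI conjI)
    show "finite ?G" using finite_all_basis_idx by simp
    show "?G \<subseteq> Tall" by (auto simp: Tall_def lspan_eq basis_vec_def intro!: vs.span_base)
    show "spans_mod (Kfull M N) Tall ?G id"
      unfolding spans_mod_def
    proof
      fix a assume "a \<in> Tall"
      hence "a \<in> vs.span (range wvec)" by (simp add: Tall_def lspan_eq)
      moreover have "wvec w \<in> vs.span (Kfull M N \<union> ?G)" for w
        by (rule subsetD[OF vs.span_mono word_in_span_basis]) (auto simp: basis_deg_def)
      ultimately have "a \<in> vs.span (Kfull M N \<union> id ` ?G)" by (elim span_bind) auto
      thus "\<exists>G c. finite G \<and> G \<subseteq> ?G \<and> vdiff a (vsum c id G) \<in> Kfull M N"
        by (rule span_mod_obtain[OF Kfull_subspace])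
    qed
  qed
next
  fix m n :: nat and d :: int
  let ?K = "Kfull M N"
  show "int (qdim ?K (comp3 m n d)) = (let e = int n ^ 2 + int m ^ 2 - int m * int n in
             if e \<le> d
             then coeff (qbinom (M - int m + int n) (int m) * qbinom (N - int n + int m) (int n))
                        (nat (d - e))
             else 0)"
  \<comment> \<open>Here the whole component is spanned by \<open>v\<close>, which has been divided
    out. The formula agrees because \<open>qbinom (-1) 0\<close> is 0.\<close>
  proof (cases "(m, n) = (0, 0) \<and> (M = -1 \<or> N = -1)")
    case True
    hence "wvec [] \<in> ?K" unfolding Kfull_def lspan_eq by (intro vs.span_base) auto
    moreover have "w = []" if "wH1 w = 0" "wH2 w = 0" for w
    proof (cases w)
      case (Cons x w')
      thus ?thesis using that by (cases x) (auto simp: wH1_def wH2_def)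
    qed simp
    ultimately have "{wvec w |w. wH1 w = m \<and> wH2 w = n \<and> wdeg w = d} \<subseteq> ?K" using True by auto
    hence "comp3 m n d \<subseteq> ?K"
      unfolding comp3_def lspan_eq by (rule vs.span_minimal[OF _ Kfull_subspace])
    hence "comp3 m n d \<subseteq> vs.span (?K \<union> (basis_vec ` {}))" by (auto intro: vs.span_base)
    hence "qdim ?K (comp3 m n d) = card ({} :: (int list \<times> int list) set)"
      by (intro qdim_eq[OF Kfull_subspace]) (auto simp: indep_mod_def)
    thus ?thesis using True by (auto simp: qbinom_def Let_def)
  next
    case False
    have "qdim ?K (comp3 m n d) = card (basis_deg M N m n d)"
    proof (rule qdim_eq[OF Kfull_subspace finite_basis_deg])
      show "basis_vec ` basis_deg M N m n d \<subseteq> comp3 m n d"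
        unfolding comp3_def lspan_eq
        by (auto simp: basis_vec_def basis_idx_def basis_deg_def intro!: vs.span_base) (metis wH_basis)
      have "indep_mod ?K (basis_idx M N m n) basis_vec" using False by (intro indep_basis) auto
      thus "indep_mod ?K (basis_deg M N m n d) basis_vec"
        by (rule indep_mod_subset) (auto simp: basis_deg_def)
      show "comp3 m n d \<subseteq> vs.span (?K \<union> basis_vec ` basis_deg M N m n d)"
        unfolding comp3_def lspan_eq
        by (rule vs.span_minimal[OF _ vs.subspace_span]) (use word_in_span_basis[of _ M N] in blast)
    qed
    moreover have "M - int m + int n \<ge> 0 \<or> m > 0" "N - int n + int m \<ge> 0 \<or> n > 0"
      using False assms by auto
    ultimately show ?thesis using card_basis_deg[of M m n N d] by (simp add: Let_def)
  qed
qed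

end
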